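(* Let $\Phi\in C^\infty(\mathbb R_{>0},\mathbb R_{>0})$, let $\ell(c)=\int_{S^1}|c_\theta|d\theta$ denote the length, and let $\Omega^{\Phi(\ell)}=-d(\Phi(\ell)\,\Theta^{\mathrm{id}})$ on $\mathrm{Imm}(S^1,\mathbb R^3)$. Then $$\Omega^{\Phi(\ell)}_c(h,k)=\Phi(\ell(c))\,\Omega^{\mathrm{id}}_c(h,k)-\Phi'(\ell(c))\Big(\int_{S^1}\langle D_sh,D_sc\rangle ds\;\Theta^{\mathrm{id}}_c(k)-\int_{S^1}\langle D_sk,D_sc\rangle ds\;\Theta^{\mathrm{id}}_c(h)\Big)$$ $$=\Phi(\ell(c))\,\Omega^{\mathrm{id}}_c(h,k)+\Phi'(\ell(c))\Big(\int_{S^1}\langle h,D_s^2c\rangle ds\;\Theta^{\mathrm{id}}_c(k)-\int_{S^1}\langle k,D_s^2c\rangle ds\;\Theta^{\mathrm{id}}_c(h)\Big).$$ Furthermore: (a) If $\Phi(\ell)\neq C\ell^{-3}$ (that is, $\Phi$ is not of the form $C\ell^{-3}$ with a constant $C$), then the presymplectic structure $\bar\Omega^{\Phi(\ell)}$ on $B_i(S^1,\mathbb R^3)=\mathrm{Imm}(S^1,\mathbb R^3)/\mathrm{Diff}^+(S^1)$ is non-degenerate and thus symplectic. (b) If $\Phi(\ell)=C\ell^{-3}$ for a constant $C$, then $\Omega^{\Phi(\ell)}$ induces a non-degenerate 2-form on $\mathrm{Imm}(S^1,\mathbb R^3)/(\mathrm{Diff}^+(S^1)\times\mathcal F)\simeq\{\bar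 c\in B_i(S^1,\mathbb R^3):\bar\ell(\bar c)=1\}/\mathrm{span}(\mathrm{grad}^{\bar\Omega^{\mathrm{id}}}\bar\ell)$, where it agrees with a multiple of the Marsden–Weinstein symplectic structure. Here $\mathcal F$ is the 2-dimensional vector subbundle spanned by the scaling vector field $I_c=c$ and $\mathrm{hgrad}^{\Omega^{\mathrm{MW}}}\ell=D_sc\times D_s^2c$.
   Context: $\mathrm{Imm}(S^1,\mathbb R^3)=\{c\in C^\infty(S^1,\mathbb R^3): |c_\theta|\neq 0 \text{ everywhere}\}$ is an open subset of $C^\infty(S^1,\mathbb R^3)$, with tangent spaces $C^\infty(S^1,\mathbb R^3)$. For an immersion $c$, $D_s=\frac1{|c_\theta|}\partial_\theta$, $ds=|c_\theta|\,d\theta$; $\times$ is the cross product on $\mathbb R^3$. $\Theta^{\mathrm{id}}_c(h)=\int_{S^1}\langle c\times D_sc,h\rangle ds$, $\Omega^{\mathrm{id}}_c(h,k)=-d\Theta^{\mathrm{id}}_c(h,k)=3\int_{S^1}\langle D_sc\times h,k\rangle ds$, and the Marsden–Weinstein form is $\Omega^{\mathrm{MW}}=\frac13\Omega^{\mathrm{id}}$. $\mathrm{hgrad}^{\Omega^{\mathrm{MW}}}\ell$ is the vector field $X$ with $i_X\Omega^{\mathrm{MW}}=d\ell$ and $\langle X_c,D_sc\rangle=0$ pointwise. $\pi:\mathrm{Imm}(S^1,\mathbb R^3)\to B_i(S^1,\mathbb R^3)$ is the quotient projection; $\mathrm{Diff}^+(S^1)$ acts by reparametrization and the tangent space to the orbit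 at $c$ is $\{a\,D_sc: a\in C^\infty(S^1)\}$. Barred objects are the induced ones on $B_i$: $\bar\ell\circ\pi=\ell$, $\pi^*\bar\Omega=\Omega$; $\mathrm{grad}^{\bar\Omega^{\mathrm{id}}}\bar\ell$ satisfies $\bar\Omega^{\mathrm{id}}(\mathrm{grad}^{\bar\Omega^{\mathrm{id}}}\bar\ell,\cdot)=d\bar\ell$. Non-degeneracy is understood weakly (injectivity of the associated map from tangent to cotangent spaces). Thus non-degeneracy of $\bar\Omega^{\Phi(\ell)}$ on $B_i$ means $\ker\Omega^{\Phi(\ell)}_c=\{a\,D_sc\}$ for all $c$. Quotients by $\mathcal F$ (or by the span of a vector field) denote the leaf space of the corresponding foliation; $\mathrm{Imm}/(\mathrm{Diff}^+(S^1)\times\mathcal F)$ has tangent space $T_c\mathrm{Imm}/(\{a\,D_sc\}+\mathcal F_c)$ at the class of $c$, so inducing a non-degenerate form there means $\ker\Omega^{\Phi(\ell)}_c=\{a\,D_sc\}+\mathcal F_c$ for all $c$. On $\{\bar\ell=1\}$ forms are restricted (pulled back) before passing to the leaf space.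
   Formalization: In (a), "Φ is not of the form Cℓ^{-3}" is replaced by ℓΦ'(ℓ)+3Φ(ℓ)≠0 for every ℓ>0. The literal claim fails: for Φ(ℓ)=e^{-3ℓ} the form is degenerate at all curves of length 1. The new condition is necessary and sufficient. *)

theory Defs
  imports "HOL-Analysis.Analysis"
begin

section \<open>Smooth maps\<close>

text \<open>
  \<open>Ck_on k S f\<close> says that \<open>f\<close> is of class \<open>C\<^sup>k\<close> on the open set \<open>S\<close>; it is only used for open
  sets. All directional derivatives in a fixed direction are required to be of class \<open>C\<^sup>k\<^sup>-\<^sup>1\<close>,
  which on finite-dimensional spaces is the usual notion.
\<close>

primrec Ck_on ::
  "nat \<Rightarrow> 'a::real_normed_vector set \<Rightarrow> ('a \<Rightarrow> 'b::real_normed_vector) \<Rightarrow> bool" where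
  "Ck_on 0 S f \<longleftrightarrow> continuous_on S f"
| "Ck_on (Suc k) S f \<longleftrightarrow> (\<forall>x\<in>S. f differentiable (at x)) \<and>
     (\<forall>v. Ck_on k S (\<lambda>x. frechet_derivative f (at x) v))"

definition smooth_on ::
  "'a::real_normed_vector set \<Rightarrow> ('a \<Rightarrow> 'b::real_normed_vector) \<Rightarrow> bool" where
  "smooth_on S f \<longleftrightarrow> (\<forall>k. Ck_on k S f)"


section \<open>Loops, immersions and reparametrizations\<close>

text \<open>
  The circle is \<open>\<real> / 2\<pi>\<int>\<close>: functions on it are \<open>2\<pi>\<close>-periodic functions on the line, and
  orientation preserving diffeomorphisms are given by their lifts to the line.
\<close>

type_synonym curve = "real \<Rightarrow> real^3"

definition circle_smooth :: "(real \<Rightarrow> 'b::real_normed_vector) set" where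
  "circle_smooth = {f. smooth_on UNIV f \<and> (\<forall>\<theta>. f (\<theta> + 2 * pi) = f \<theta>)}"

abbreviation loops :: "curve set" where
  "loops \<equiv> circle_smooth"

abbreviation dtheta :: "curve \<Rightarrow> curve" where
  "dtheta c \<equiv> (\<lambda>\<theta>. vector_derivative c (at \<theta>))"

definition Imm :: "curve set" where
  "Imm = {c \<in> loops. \<forall>\<theta>. dtheta c \<theta> \<noteq> 0}"

definition diff_plus :: "(real \<Rightarrow> real) set" where
  "diff_plus = {\<phi>. smooth_on UNIV \<phi> \<and> (\<forall>\<theta>. \<phi> (\<theta> + 2 * pi) = \<phi> \<theta> + 2 * pi) \<and>
     (\<forall>\<theta>. deriv \<phi> \<theta> > 0)}"

definition Ds :: "curve \<Rightarrow> curve \<Rightarrow> curve" where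
  "Ds c h = (\<lambda>\<theta>. (1 / norm (dtheta c \<theta>)) *\<^sub>R dtheta h \<theta>)"

definition arc_integral :: "curve \<Rightarrow> (real \<Rightarrow> real) \<Rightarrow> real" where
  "arc_integral c f = integral {0..2 * pi} (\<lambda>\<theta>. f \<theta> * norm (dtheta c \<theta>))"

definition curve_length :: "curve \<Rightarrow> real" where
  "curve_length c = integral {0..2 * pi} (\<lambda>\<theta>. norm (dtheta c \<theta>))"


section \<open>Differential forms on the space of immersions\<close>

text \<open>
  \<open>Imm\<close> is open in the space of loops, so every tangent space is \<open>loops\<close>, and the exterior
  derivative is evaluated on constant vector fields by means of directional derivatives.
\<close>

type_synonym one_form = "curve \<Rightarrow> curve \<Rightarrow> real"
type_synonym two_form = "curve \<Rightarrow> curve \<Rightarrow> curve \<Rightarrow> real"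

definition has_dir_deriv :: "(curve \<Rightarrow> real) \<Rightarrow> curve \<Rightarrow> curve \<Rightarrow> bool" where
  "has_dir_deriv F c h \<longleftrightarrow> (\<lambda>t::real. F (\<lambda>\<theta>. c \<theta> + t *\<^sub>R h \<theta>)) field_differentiable (at 0)"

definition dir_deriv :: "(curve \<Rightarrow> real) \<Rightarrow> curve \<Rightarrow> curve \<Rightarrow> real" where
  "dir_deriv F c h = deriv (\<lambda>t::real. F (\<lambda>\<theta>. c \<theta> + t *\<^sub>R h \<theta>)) 0"

definition ext_deriv :: "one_form \<Rightarrow> two_form" where
  "ext_deriv \<alpha> c h k = dir_deriv (\<lambda>c. \<alpha> c k) c h - dir_deriv (\<lambda>c. \<alpha> c h) c k"

definition Theta_id :: one_form where
  "Theta_id c h = arc_integral c (\<lambda>\<theta>. cross3 (c \<theta>) (Ds c c \<theta>) \<bullet> h \<theta>)"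

definition Omega_id :: two_form where
  "Omega_id c h k = - ext_deriv Theta_id c h k"

definition Omega_MW :: two_form where
  "Omega_MW c h k = (1 / 3) * Omega_id c h k"

definition Omega_Phi :: "(real \<Rightarrow> real) \<Rightarrow> two_form" where
  "Omega_Phi \<Phi> c h k = - ext_deriv (\<lambda>c h. \<Phi> (curve_length c) * Theta_id c h) c h k"

definition closed_form :: "two_form \<Rightarrow> bool" where
  "closed_form \<omega> \<longleftrightarrow> (\<forall>c\<in>Imm. \<forall>h\<in>loops. \<forall>k\<in>loops. \<forall>m\<in>loops.
     has_dir_deriv (\<lambda>c. \<omega> c k m) c h \<and>
     dir_deriv (\<lambda>c. \<omega> c k m) c h - dir_deriv (\<lambda>c. \<omega> c h m) c k
       + dir_deriv (\<lambda>c. \<omega> c h k) c m = 0)"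

definition alternating_bilinear :: "two_form \<Rightarrow> bool" where
  "alternating_bilinear \<omega> \<longleftrightarrow> (\<forall>c\<in>Imm. \<forall>h\<in>loops. \<forall>k\<in>loops.
     \<omega> c h k = - \<omega> c k h \<and>
     (\<forall>m\<in>loops. \<omega> c (\<lambda>\<theta>. h \<theta> + m \<theta>) k = \<omega> c h k + \<omega> c m k) \<and>
     (\<forall>r::real. \<omega> c (\<lambda>\<theta>. r *\<^sub>R h \<theta>) k = r * \<omega> c h k))"

text \<open>Radical of the restriction of \<open>\<omega>\<^sub>c\<close> to a subspace \<open>V\<close> of the tangent space at \<open>c\<close>.\<close>

definition radical_on :: "curve set \<Rightarrow> two_form \<Rightarrow> curve \<Rightarrow> curve set" where
  "radical_on V \<omega> c = {h \<in> V. \<forall>k\<in>V. \<omega> c h k = 0}"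

abbreviation form_kernel :: "two_form \<Rightarrow> curve \<Rightarrow> curve set" where
  "form_kernel \<equiv> radical_on loops"


section \<open>Forms and gradients on the quotient \<open>B\<^sub>i\<close> by reparametrizations\<close>

definition Vert :: "curve \<Rightarrow> curve set" where
  "Vert c = {(\<lambda>\<theta>. a \<theta> *\<^sub>R Ds c c \<theta>) | a :: real \<Rightarrow> real. a \<in> circle_smooth}"

text \<open>
  Forms on \<open>B\<^sub>i\<close> are handled through their pullbacks to \<open>Imm\<close>: a form on \<open>Imm\<close> is such a
  pullback if it is invariant under reparametrization and annihilates the orbit directions.
\<close>

definition presymplectic_Bi :: "two_form \<Rightarrow> bool" where
  "presymplectic_Bi \<omega> \<longleftrightarrow> alternating_bilinear \<omega> \<and> closed_form \<omega> \<and>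
     (\<forall>c\<in>Imm. \<forall>h\<in>loops. \<forall>k\<in>loops. \<forall>\<phi>\<in>diff_plus. \<omega> (c \<circ> \<phi>) (h \<circ> \<phi>) (k \<circ> \<phi>) = \<omega> c h k) \<and>
     (\<forall>c\<in>Imm. Vert c \<subseteq> form_kernel \<omega> c)"

definition symplectic_Bi :: "two_form \<Rightarrow> bool" where
  "symplectic_Bi \<omega> \<longleftrightarrow> presymplectic_Bi \<omega> \<and> (\<forall>c\<in>Imm. form_kernel \<omega> c = Vert c)"

text \<open>
  \<open>grad_lifts \<omega> f c\<close> is the set of all tangent vectors at \<open>c\<close> that project to the gradient on \<open>B\<^sub>i\<close>;
  \<open>hgrad\<close> is the horizontal one among them.
\<close>

definition grad_lifts :: "two_form \<Rightarrow> (curve \<Rightarrow> real) \<Rightarrow> curve \<Rightarrow> curve set" where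
  "grad_lifts \<omega> f c = {X \<in> loops. \<forall>k\<in>loops. \<omega> c X k = dir_deriv f c k}"

definition is_hgrad :: "two_form \<Rightarrow> (curve \<Rightarrow> real) \<Rightarrow> curve \<Rightarrow> curve \<Rightarrow> bool" where
  "is_hgrad \<omega> f c X \<longleftrightarrow> X \<in> grad_lifts \<omega> f c \<and> (\<forall>\<theta>. X \<theta> \<bullet> Ds c c \<theta> = 0)"

definition hgrad :: "two_form \<Rightarrow> (curve \<Rightarrow> real) \<Rightarrow> curve \<Rightarrow> curve" where
  "hgrad \<omega> f c = (THE X. is_hgrad \<omega> f c X)"


section \<open>The distributions and their leaf spaces\<close>

definition vsum :: "curve set \<Rightarrow> curve set \<Rightarrow> curve set" where
  "vsum A B = {(\<lambda>\<theta>. a \<theta> + b \<theta>) | a b. a \<in> A \<and> b \<in> B}"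

text \<open>Fibre of \<open>\<F>\<close>, spanned by the scaling field \<open>I\<^sub>c = c\<close> and the horizontal gradient of the length.\<close>

definition F_fib :: "curve \<Rightarrow> curve set" where
  "F_fib c = {(\<lambda>\<theta>. \<alpha> *\<^sub>R c \<theta> + \<beta> *\<^sub>R hgrad Omega_MW curve_length c \<theta>) | \<alpha> \<beta>. True}"

text \<open>Preimage under \<open>T\<pi>\<close> of the line spanned by the gradient of the length on \<open>B\<^sub>i\<close>.\<close>

definition grad_length_span :: "curve \<Rightarrow> curve set" where
  "grad_length_span c =
     vsum (Vert c) {(\<lambda>\<theta>. r *\<^sub>R X \<theta>) | r X. X \<in> grad_lifts Omega_id curve_length c}"

definition Imm1 :: "curve set" where
  "Imm1 = {c \<in> Imm. curve_length c = 1}"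

definition T_Imm1 :: "curve \<Rightarrow> curve set" where
  "T_Imm1 c = {h \<in> loops. dir_deriv curve_length c h = 0}"

text \<open>
  Let \<open>M \<subseteq> Imm\<close> be invariant under reparametrization and let \<open>D c\<close> be the preimage under \<open>T\<pi>\<close> of the
  fibre at \<open>\<pi> c\<close> of a distribution on \<open>\<pi> M\<close>. Two curves in \<open>M\<close> project to the same leaf in \<open>\<pi> M\<close> iff
  they are joined by a chain of reparametrizations and of smooth paths in \<open>M\<close> tangent to \<open>D\<close>.
  Paths may be taken to be defined for all real times, since a path on \<open>[0,1]\<close> can be
  reparametrized in time so as to be constant near, and then beyond, its end points.
\<close>

definition leaf_step :: "curve set \<Rightarrow> (curve \<Rightarrow> curve set) \<Rightarrow> (curve \<times> curve) set" where
  "leaf_step M D =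
     {(c, c \<circ> \<phi>) | c \<phi>. c \<in> M \<and> c \<circ> \<phi> \<in> M \<and> \<phi> \<in> diff_plus} \<union>
     {(\<gamma> 0, \<gamma> 1) | \<gamma> :: real \<Rightarrow> curve. smooth_on UNIV (\<lambda>(t, \<theta>). \<gamma> t \<theta>) \<and>
        (\<forall>t. \<gamma> t \<in> M \<and> (\<lambda>\<theta>. vector_derivative (\<lambda>s. \<gamma> s \<theta>) (at t)) \<in> D (\<gamma> t))}"

definition leaf_rel :: "curve set \<Rightarrow> (curve \<Rightarrow> curve set) \<Rightarrow> (curve \<times> curve) set" where
  "leaf_rel M D = {(c, c'). c \<in> M \<and> c' \<in> M \<and> (c, c') \<in> (leaf_step M D \<union> (leaf_step M D)\<inverse>)\<^sup>*}"

abbreviation leaf_Imm :: "(curve \<times> curve) set" where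
  "leaf_Imm \<equiv> leaf_rel Imm (\<lambda>c. vsum (Vert c) (F_fib c))"

abbreviation leaf_Imm1 :: "(curve \<times> curve) set" where
  "leaf_Imm1 \<equiv> leaf_rel Imm1 grad_length_span"


section \<open>Contact with the exceptional conformal factor\<close>

text \<open>
  \<open>cubic_contact \<Phi> r\<close>: some function \<open>C l\<^sup>-\<^sup>3\<close> has the same value and the same derivative as \<open>\<Phi>\<close> at
  \<open>l = r\<close>. The kernel of the form at a curve only depends on value and derivative of \<open>\<Phi>\<close> at the
  length of the curve. So merely excluding that \<open>\<Phi>\<close> is globally of the form \<open>C l\<^sup>-\<^sup>3\<close> does not give
  non-degeneracy at every curve: \<open>\<Phi> l = exp (-3 l)\<close> has contact at \<open>l = 1\<close>, and the form is
  degenerate at every curve of length one.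
\<close>

definition cubic_contact :: "(real \<Rightarrow> real) \<Rightarrow> real \<Rightarrow> bool" where
  "cubic_contact \<Phi> r \<longleftrightarrow> (\<exists>C. \<Phi> r = C / r ^ 3 \<and> deriv \<Phi> r = deriv (\<lambda>l. C / l ^ 3) r)"

end

theory Submission
  imports Defs
begin

text \<open>
  Integration by parts gives \<open>\<Omega>\<^sup>i\<^sup>d\<^sub>c(h, k) = 3 \<integral> det(c\<^sub>\<theta>, h, k) d\<theta>\<close> and \<open>d\<ell>(h) = - \<integral> \<langle>h, D\<^sub>s\<^sup>2c\<rangle> ds\<close>. With
  \<open>X = D\<^sub>sc \<times> D\<^sub>s\<^sup>2c\<close> both \<open>d\<ell>\<close> and \<open>\<Theta>\<close> are contractions of the determinant form, with \<open>X\<close> and \<open>- c\<close>, so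
  \<open>\<Omega>\<^sup>\<Phi>(h, \<cdot>)\<close> is its contraction with \<open>3 \<Phi> h + \<Phi>' (d\<ell>(h) c + \<Theta>(h) X)\<close>. The determinant form
  has kernel \<open>Vert\<close>; hence all kernels are given by linear algebra in the plane spanned by \<open>c\<close> and \<open>X\<close>.
  For the leaf spaces, the retraction \<open>c \<mapsto> c / \<ell>(c)\<close> maps reparametrizations to reparametrizations
  and paths tangent to \<open>\<F>\<close> to paths tangent to the gradient of the length.
\<close>

section \<open>Calculus of smooth maps\<close>

text \<open>The exponent -3 comes from homogeneity: scaling multiplies \<Theta> by the cube of the
  factor and \<Theta>_c(c) = 0, so \<Phi>(l) \<Theta> is invariant under scaling exactly when l^3
  \<Phi>(l) is constant. In the linear algebra the pairing of the covectors (dl, \<Theta>) with (c,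
  X) is l times the identity matrix. Hence the single scalar 3 \<Phi> + l \<Phi>' decides about both
  directions at once, and the kernel is either purely vertical or larger by the whole plane. This
  scalar depends only on the length of the curve, and l^2 times it is the derivative of l^3 \<Phi>.
  The leaf spaces demand more than derivatives along straight lines: the length has to be
  differentiated along arbitrary smooth families of curves, which rests on the symmetry of mixed
  partials and on smoothness of parameter integrals. The calculus of smooth maps is kept to those
  operations for which induction on the order closes without expanding a derivative in a basis:
  bilinear products, outer functions of one real variable, and affine inner maps.\<close>

lemma Ck_on_cong_imp:
  assumes "open S" "\<And>x. x \<in> S \<Longrightarrow> f x = g x" "Ck_on k S f"
  shows "Ck_on k S g"
  using assms(2,3)
proof (induction k arbitrary: f g)
  case 0
  then show ?case using continuous_on_cong[of S S f g] by simp
next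
  case (Suc k)
  have d: "(g has_derivative frechet_derivative f (at x)) (at x)" if "x \<in> S" for x
  proof (rule has_derivative_transform_within_open[OF _ assms(1) that])
    show "(f has_derivative frechet_derivative f (at x)) (at x)"
      using Suc.prems(2) that by (simp add: frechet_derivative_works)
  qed (use Suc.prems(1) in simp)
  have "Ck_on k S (\<lambda>x. frechet_derivative g (at x) v)" for v
  proof (rule Suc.IH)
    show "frechet_derivative f (at x) v = frechet_derivative g (at x) v" if "x \<in> S" for x
      using frechet_derivative_at[OF d[OF that]] by simp
  qed (use Suc.prems(2) in simp)
  then show ?case using d by (auto simp: differentiable_def)
qed

lemma Ck_on_cong:
  "open S \<Longrightarrow> (\<And>x. x \<in> S \<Longrightarrow> f x = g x) \<Longrightarrow> Ck_on k S f \<longleftrightarrow> Ck_on k S g"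
  using Ck_on_cong_imp[of S f g k] Ck_on_cong_imp[of S g f k] by auto

text \<open>\<open>frechet_derivative\<close> is a choice term; with this rule and
  \<open>Ck_on_SucE\<close> the inductions run on explicit derivatives instead. Openness of the set
  lets the equality of the two derivatives pass to all higher orders.\<close>

lemma Ck_on_SucI:
  assumes "open S" "\<And>x. x \<in> S \<Longrightarrow> (f has_derivative f' x) (at x)"
    and "\<And>v. Ck_on k S (\<lambda>x. f' x v)"
  shows "Ck_on (Suc k) S f"
proof -
  have "Ck_on k S (\<lambda>x. frechet_derivative f (at x) v)" for v
    using assms(3)[of v] frechet_derivative_at[OF assms(2)]
    by (subst Ck_on_cong[OF assms(1), of _ "\<lambda>x. f' x v"]) auto
  then show ?thesis using assms(2) by (auto simp: differentiable_def)
qed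

lemma Ck_on_SucE:
  assumes "Ck_on (Suc k) S f"
  obtains f' where "\<And>x. x \<in> S \<Longrightarrow> (f has_derivative f' x) (at x)" "\<And>v. Ck_on k S (\<lambda>x. f' x v)"
  using assms that[of "\<lambda>x. frechet_derivative f (at x)"] by (auto simp: frechet_derivative_works)

lemma Ck_on_SucD: "Ck_on (Suc k) S f \<Longrightarrow> Ck_on k S f"
proof (induction k arbitrary: f)
  case 0
  then show ?case
    by (simp add: differentiable_at_imp_differentiable_on differentiable_imp_continuous_on)
next
  case (Suc k)
  have "Ck_on k S (\<lambda>x. frechet_derivative f (at x) v)" for v
    using Suc.prems by (intro Suc.IH) simp
  then show ?case using Suc.prems by simp
qed

lemma Ck_on_const: "Ck_on k S (\<lambda>x. a)"
  by (induction k arbitrary: a) auto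

lemma Ck_on_add:
  assumes "open S" "Ck_on k S f" "Ck_on k S g"
  shows "Ck_on k S (\<lambda>x. f x + g x)"
  using assms(2,3)
proof (induction k arbitrary: f g)
  case 0 then show ?case by (auto intro: continuous_intros)
next
  case (Suc k)
  obtain f' where f: "\<And>x. x \<in> S \<Longrightarrow> (f has_derivative f' x) (at x)" "\<And>v. Ck_on k S (\<lambda>x. f' x v)"
    using Suc.prems(1) by (rule Ck_on_SucE) (rule that)
  obtain g' where g: "\<And>x. x \<in> S \<Longrightarrow> (g has_derivative g' x) (at x)" "\<And>v. Ck_on k S (\<lambda>x. g' x v)"
    using Suc.prems(2) by (rule Ck_on_SucE) (rule that)
  show ?case
    by (rule Ck_on_SucI[OF assms(1) has_derivative_add[OF f(1) g(1)]]) (auto intro: Suc.IH f g)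
qed

text \<open>By the product rule a directional derivative is a sum of two terms of the same shape,
  each with one undifferentiated factor whose order is lowered by \<open>Ck_on_SucD\<close>. One
  induction serves multiplication, scaling, inner and cross products.\<close>

lemma Ck_on_bilinear:
  assumes "bounded_bilinear B" "open S" "Ck_on k S f" "Ck_on k S g"
  shows "Ck_on k S (\<lambda>x. B (f x) (g x))"
  using assms(3,4)
proof (induction k arbitrary: f g)
  case 0 then show ?case by (auto intro: bounded_bilinear.continuous_on[OF assms(1)])
next
  case (Suc k)
  obtain f' where f: "\<And>x. x \<in> S \<Longrightarrow> (f has_derivative f' x) (at x)" "\<And>v. Ck_on k S (\<lambda>x. f' x v)"
    using Suc.prems(1) by (rule Ck_on_SucE) (rule that)
  obtain g' where g: "\<And>x. x \<in> S \<Longrightarrow> (g has_derivative g' x) (at x)" "\<And>v. Ck_on k S (\<lambda>x. g' x v)"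
    using Suc.prems(2) by (rule Ck_on_SucE) (rule that)
  show ?case
    by (rule Ck_on_SucI[OF assms(2) bounded_bilinear.FDERIV[OF assms(1) f(1) g(1)]])
      (auto intro!: Suc.IH Ck_on_add assms(2) f g Ck_on_SucD[OF Suc.prems(1)] Ck_on_SucD[OF Suc.prems(2)])
qed

text \<open>The outer map has a one-dimensional domain, so its derivative needs no basis expansion.\<close>

lemma Ck_on_compose_real:
  fixes g :: "real \<Rightarrow> 'b::real_normed_vector"
  assumes "open S" "open T" "f ` S \<subseteq> T" "Ck_on k S f" "Ck_on k T g"
  shows "Ck_on k S (\<lambda>x. g (f x))"
  using assms(4,5)
proof (induction k arbitrary: g)
  case 0 then show ?case using assms(3) by (auto intro: continuous_on_compose2)
next
  case (Suc k)
  obtain f' where f: "\<And>x. x \<in> S \<Longrightarrow> (f has_derivative f' x) (at x)" "\<And>v. Ck_on k S (\<lambda>x. f' x v)"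
    using Suc.prems(1) by (rule Ck_on_SucE) (rule that)
  obtain g' where g: "\<And>x. x \<in> T \<Longrightarrow> (g has_derivative g' x) (at x)" "\<And>v. Ck_on k T (\<lambda>x. g' x v)"
    using Suc.prems(2) by (rule Ck_on_SucE) (rule that)
  have lin: "g' y r = r *\<^sub>R g' y 1" if "y \<in> T" for y r
    using linear_scale[OF has_derivative_linear[OF g(1)[OF that]], of r 1] by simp
  show ?case
  proof (rule Ck_on_SucI[OF assms(1)])
    fix x assume x: "x \<in> S"
    then have "f x \<in> T" using assms(3) by auto
    then show "((\<lambda>x. g (f x)) has_derivative (\<lambda>v. f' x v *\<^sub>R g' (f x) 1)) (at x)"
      using has_derivative_compose[OF f(1)[OF x] g(1)] by (subst lin[symmetric]) simp_all
  next
    show "Ck_on k S (\<lambda>x. f' x v *\<^sub>R g' (f x) 1)" for v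
      by (intro Ck_on_bilinear[OF bounded_bilinear_scaleR] assms(1) f(2) Suc.IH g(2)
          Ck_on_SucD[OF Suc.prems(1)])
  qed
qed

text \<open>The inner map has constant derivative, so differentiating in direction \<open>v\<close>
  gives a directional derivative of \<open>g\<close> in the fixed direction \<open>L v\<close>,
  composed with the same affine map; the induction hypothesis applies to it directly.\<close>

lemma Ck_on_compose_affine:
  assumes L: "bounded_linear L" and "open S" "open T" "(\<lambda>x. a + L x) ` S \<subseteq> T" "Ck_on k T g"
  shows "Ck_on k S (\<lambda>x. g (a + L x))"
  using assms(5)
proof (induction k arbitrary: g)
  case 0
  then show ?case using assms(4)
    by (auto intro!: continuous_on_compose2[of T g] continuous_intros linear_continuous_on[OF L])
next
  case (Suc k)
  obtain g' where g: "\<And>x. x \<in> T \<Longrightarrow> (g has_derivative g' x) (at x)" "\<And>v. Ck_on k T (\<lambda>x. g' x v)"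
    using Suc.prems by (rule Ck_on_SucE) (rule that)
  show ?case
  proof (rule Ck_on_SucI[OF assms(2)])
    fix x assume x: "x \<in> S"
    then have "a + L x \<in> T" using assms(4) by auto
    moreover have "((\<lambda>x. a + L x) has_derivative L) (at x)"
      using has_derivative_add[OF has_derivative_const bounded_linear_imp_has_derivative[OF L]] by simp
    ultimately show "((\<lambda>x. g (a + L x)) has_derivative (\<lambda>v. g' (a + L x) (L v))) (at x)"
      using has_derivative_compose g(1) by blast
  next
    show "Ck_on k S (\<lambda>x. g' (a + L x) (L v))" for v
      by (rule Suc.IH[OF g(2)])
  qed
qed

lemma smooth_on_cong:
  "open S \<Longrightarrow> (\<And>x. x \<in> S \<Longrightarrow> f x = g x) \<Longrightarrow> smooth_on S f \<longleftrightarrow> smooth_on S g"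
  using Ck_on_cong[of S f g] by (simp add: smooth_on_def)

lemma smooth_on_const: "smooth_on S (\<lambda>x. a)"
  by (simp add: smooth_on_def Ck_on_const)

lemma smooth_on_add:
  "open S \<Longrightarrow> smooth_on S f \<Longrightarrow> smooth_on S g \<Longrightarrow> smooth_on S (\<lambda>x. f x + g x)"
  by (simp add: smooth_on_def Ck_on_add)

lemma smooth_on_bilinear:
  "bounded_bilinear B \<Longrightarrow> open S \<Longrightarrow> smooth_on S f \<Longrightarrow> smooth_on S g \<Longrightarrow> smooth_on S (\<lambda>x. B (f x) (g x))"
  by (simp add: smooth_on_def Ck_on_bilinear)

lemmas smooth_on_scaleR = smooth_on_bilinear[OF bounded_bilinear_scaleR]
lemmas smooth_on_inner = smooth_on_bilinear[OF bounded_bilinear_inner]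

lemma bounded_bilinear_cross3: "bounded_bilinear cross3"
  by (simp add: bilinear_conv_bounded_bilinear[symmetric] bilinear_cross)

lemma smooth_on_compose_real:
  fixes g :: "real \<Rightarrow> 'b::real_normed_vector"
  shows "open S \<Longrightarrow> open T \<Longrightarrow> f ` S \<subseteq> T \<Longrightarrow> smooth_on S f \<Longrightarrow> smooth_on T g \<Longrightarrow> smooth_on S (\<lambda>x. g (f x))"
  by (simp add: smooth_on_def Ck_on_compose_real[of S T])

lemma smooth_on_compose_affine:
  "bounded_linear L \<Longrightarrow> open S \<Longrightarrow> smooth_on UNIV g \<Longrightarrow> smooth_on S (\<lambda>x. g (a + L x))"
  by (simp add: smooth_on_def Ck_on_compose_affine[of L S UNIV])

lemma smooth_on_compose_linear:
  "bounded_linear L \<Longrightarrow> open S \<Longrightarrow> smooth_on UNIV g \<Longrightarrow> smooth_on S (\<lambda>x. g (L x))"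
  using smooth_on_compose_affine[of L S g 0] by simp

lemma smooth_on_imp_Ck_on: "smooth_on S f \<Longrightarrow> Ck_on k S f"
  by (simp add: smooth_on_def)

lemma smooth_on_imp_continuous_on: "smooth_on S f \<Longrightarrow> continuous_on S f"
  using smooth_on_imp_Ck_on[of S f 0] by simp

lemma smooth_on_differentiable: "smooth_on S f \<Longrightarrow> x \<in> S \<Longrightarrow> f differentiable (at x)"
  using smooth_on_imp_Ck_on[of S f 1] by simp

lemma smooth_on_frechet_derivative:
  assumes "smooth_on S f" shows "smooth_on S (\<lambda>x. frechet_derivative f (at x) v)"
  unfolding smooth_on_def
proof
  show "Ck_on k S (\<lambda>x. frechet_derivative f (at x) v)" for k
    using smooth_on_imp_Ck_on[OF assms, of "Suc k"] by simp
qed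

section \<open>Smoothness of the elementary functions, of norms and of parameter integrals\<close>

lemma smooth_on_exp: "smooth_on UNIV (exp :: real \<Rightarrow> real)"
  unfolding smooth_on_def
proof
  show "Ck_on k UNIV (exp :: real \<Rightarrow> real)" for k
  proof (induction k)
    case 0 then show ?case by (simp add: continuous_on_exp continuous_on_id)
  next
    case (Suc k)
    show ?case
    proof (rule Ck_on_SucI)
      show "(exp has_derivative (\<lambda>v. exp x * v)) (at x)" for x :: real
        using DERIV_exp[of x] by (simp add: has_field_derivative_def)
      show "Ck_on k UNIV (\<lambda>x. exp x * v)" for v :: real
        by (intro Ck_on_bilinear[OF bounded_bilinear_mult] Suc Ck_on_const) auto
    qed auto
  qed
qed

text \<open>Differentiation is a phase shift by \<open>pi / 2\<close>, so the induction closes once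
  it is generalised over the phase. The phase \<open>- pi / 2\<close> yields the sine.\<close>

lemma smooth_on_cos: "smooth_on UNIV (\<lambda>x::real. cos (x + a))"
  unfolding smooth_on_def
proof
  show "Ck_on k UNIV (\<lambda>x::real. cos (x + a))" for k
  proof (induction k arbitrary: a)
    case 0 then show ?case by (simp add: continuous_on_cos continuous_on_add continuous_on_id)
  next
    case (Suc k)
    show ?case
    proof (rule Ck_on_SucI)
      show "((\<lambda>x. cos (x + a)) has_derivative (*) (cos (x + (a + pi / 2)))) (at x)" for x :: real
      proof -
        have "cos (x + (a + pi / 2)) = - sin (x + a)" using minus_sin_cos_eq[of "x + a"] by (simp add: add.assoc)
        moreover have "((\<lambda>x. cos (x + a)) has_real_derivative - sin (x + a)) (at x)"
          by (rule derivative_eq_intros refl | simp)+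
        ultimately show ?thesis by (simp only: has_field_derivative_def)
      qed
      show "Ck_on k UNIV (\<lambda>x. cos (x + (a + pi / 2)) * v)" for v :: real
        by (intro Ck_on_bilinear[OF bounded_bilinear_mult] Suc Ck_on_const) auto
    qed auto
  qed
qed

text \<open>Differentiation lowers the exponent by one, hence the generalisation over
  \<open>a\<close>. The exponents -1 and 1/2 supply reciprocals of positive functions and norms of
  nonvanishing ones.\<close>

lemma smooth_on_powr: "smooth_on {0<..} (\<lambda>x::real. x powr a)"
  unfolding smooth_on_def
proof
  show "Ck_on k {0<..} (\<lambda>x::real. x powr a)" for k
  proof (induction k arbitrary: a)
    case 0 then show ?case by (auto intro!: continuous_on_powr continuous_on_id continuous_on_const)
  next
    case (Suc k)
    show ?case
    proof (rule Ck_on_SucI)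
      show "((\<lambda>x. x powr a) has_derivative (*) (a * x powr (a - 1))) (at x)" if "x \<in> {0<..}" for x :: real
        using has_real_derivative_powr[of x a] that by (simp add: has_field_derivative_def)
      show "Ck_on k {0<..} (\<lambda>x. a * x powr (a - 1) * v)" for v :: real
        by (intro Ck_on_bilinear[OF bounded_bilinear_mult] Suc Ck_on_const) auto
    qed auto
  qed
qed

lemma smooth_on_inverse_pos:
  fixes f :: "'a::real_normed_vector \<Rightarrow> real"
  assumes "open S" "smooth_on S f" "\<And>x. x \<in> S \<Longrightarrow> f x > 0"
  shows "smooth_on S (\<lambda>x. 1 / f x)"
proof -
  have "smooth_on S (\<lambda>x. f x powr - 1)"
    by (rule smooth_on_compose_real[OF assms(1) _ _ assms(2) smooth_on_powr]) (auto simp: assms(3))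
  moreover have "f x powr - 1 = 1 / f x" if "x \<in> S" for x
    using assms(3)[OF that] by (simp add: powr_minus_divide)
  ultimately show ?thesis
    using smooth_on_cong[OF assms(1), of "\<lambda>x. f x powr - 1" "\<lambda>x. 1 / f x"] by blast
qed

lemma smooth_on_norm:
  fixes f :: "'a::real_normed_vector \<Rightarrow> 'b::real_inner"
  assumes "open S" "smooth_on S f" "\<And>x. x \<in> S \<Longrightarrow> f x \<noteq> 0"
  shows "smooth_on S (\<lambda>x. norm (f x))"
proof -
  have "smooth_on S (\<lambda>x. (f x \<bullet> f x) powr (1/2))"
    by (rule smooth_on_compose_real[OF assms(1) _ _ smooth_on_inner[OF assms(1,2,2)] smooth_on_powr])
      (auto simp: assms(3))
  moreover have "(f x \<bullet> f x) powr (1/2) = norm (f x)" for x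
    by (simp only: powr_half_sqrt inner_ge_zero norm_eq_sqrt_inner)
  ultimately show ?thesis by (simp only:)
qed

text \<open>Differentiation under the integral sign turns the integral of \<open>F\<close> into the
  integral of its first partial, the derivative in direction \<open>(1, 0)\<close>. This is again a
  parameter integral, of one order less, so the induction is over all \<open>F\<close>.\<close>

lemma Ck_on_integral:
  fixes F :: "real \<times> real \<Rightarrow> real"
  assumes "Ck_on k UNIV F"
  shows "Ck_on k UNIV (\<lambda>t. integral {a..b} (\<lambda>\<theta>. F (t, \<theta>)))"
  using assms
proof (induction k arbitrary: F)
  case 0
  then have "continuous_on (UNIV \<times> cbox a b) (\<lambda>(t, \<theta>). F (t, \<theta>))"
    using continuous_on_subset[of UNIV F "UNIV \<times> cbox a b"] by simp
  from integral_continuous_on_param[OF this] show ?case by simp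
next
  case (Suc k)
  obtain F' where F: "\<And>x. (F has_derivative F' x) (at x)" "\<And>v. Ck_on k UNIV (\<lambda>x. F' x v)"
    using Suc.prems by (rule Ck_on_SucE) (rule that, auto)
  have cont: "continuous_on UNIV F" "continuous_on UNIV (\<lambda>x. F' x v)" for v
  proof -
    have *: "continuous_on UNIV h" if "Ck_on k UNIV h" for h :: "real \<times> real \<Rightarrow> real"
      using that by (induction k) (simp, metis Ck_on_SucD)
    show "continuous_on UNIV F" "continuous_on UNIV (\<lambda>x. F' x v)"
      using *[OF Ck_on_SucD[OF Suc.prems]] *[OF F(2)[of v]] by simp_all
  qed
  show ?case
  proof (rule Ck_on_SucI)
    fix t :: real
    have "((\<lambda>t. integral (cbox a b) (\<lambda>\<theta>. F (t, \<theta>))) has_field_derivative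
        integral (cbox a b) (\<lambda>\<theta>. F' (t, \<theta>) (1, 0))) (at t within UNIV)"
    proof (rule leibniz_rule_field_derivative)
      show "((\<lambda>t. F (t, \<theta>)) has_field_derivative F' (t, \<theta>) (1, 0)) (at t within UNIV)" for t \<theta>
      proof -
        have "((\<lambda>t. F (t, \<theta>)) has_derivative (\<lambda>v. F' (t, \<theta>) (v, 0))) (at t)"
          by (rule has_derivative_compose[OF has_derivative_Pair[OF has_derivative_ident has_derivative_const] F(1)])
        moreover have "(\<lambda>v. F' (t, \<theta>) (v, 0)) = (*) (F' (t, \<theta>) (1, 0))"
        proof
          fix v
          have "F' (t, \<theta>) (v, 0) = F' (t, \<theta>) (v *\<^sub>R (1, 0))" by simp
          also have "\<dots> = F' (t, \<theta>) (1, 0) * v"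
            by (simp only: linear_scale[OF has_derivative_linear[OF F(1)]] real_scaleR_def mult.commute)
          finally show "F' (t, \<theta>) (v, 0) = F' (t, \<theta>) (1, 0) * v" .
        qed
        ultimately show ?thesis unfolding has_field_derivative_def by (rule has_derivative_eq_rhs)
      qed
      show "(\<lambda>\<theta>. F (t, \<theta>)) integrable_on cbox a b" for t
        by (intro integrable_continuous continuous_on_compose2[OF cont(1)] continuous_on_Pair
            continuous_on_const continuous_on_id) simp
      show "continuous_on (UNIV \<times> cbox a b) (\<lambda>(t, \<theta>). F' (t, \<theta>) (1, 0))"
        using continuous_on_subset[OF cont(2)[of "(1, 0)"], of "UNIV \<times> cbox a b"]
        by (simp add: case_prod_unfold)
    qed auto
    then show "((\<lambda>t. integral {a..b} (\<lambda>\<theta>. F (t, \<theta>))) has_derivative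
        (\<lambda>v. integral {a..b} (\<lambda>\<theta>. F' (t, \<theta>) (1, 0)) * v)) (at t)"
      by (simp add: has_field_derivative_def)
  next
    show "Ck_on k UNIV (\<lambda>t. integral {a..b} (\<lambda>\<theta>. F' (t, \<theta>) (1, 0)) * v)" for v
      by (intro Ck_on_bilinear[OF bounded_bilinear_mult] Suc.IH[OF F(2)] Ck_on_const open_UNIV)
  qed auto
qed

lemma smooth_on_integral:
  fixes F :: "real \<times> real \<Rightarrow> real"
  shows "smooth_on UNIV F \<Longrightarrow> smooth_on UNIV (\<lambda>t. integral {a..b} (\<lambda>\<theta>. F (t, \<theta>)))"
  by (simp add: smooth_on_def Ck_on_integral)

lemma smooth_on_has_vector_derivative:
  fixes f :: "real \<Rightarrow> 'b::real_normed_vector"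
  assumes "smooth_on S f" "x \<in> S"
  shows "(f has_vector_derivative vector_derivative f (at x)) (at x)"
    and "vector_derivative f (at x) = frechet_derivative f (at x) 1"
proof -
  have d: "(f has_derivative frechet_derivative f (at x)) (at x)"
    using smooth_on_differentiable[OF assms] by (simp add: frechet_derivative_works)
  have e: "frechet_derivative f (at x) = (\<lambda>r. r *\<^sub>R frechet_derivative f (at x) 1)"
  proof
    show "frechet_derivative f (at x) r = r *\<^sub>R frechet_derivative f (at x) 1" for r
      using linear_scale[OF has_derivative_linear[OF d], of r 1] by simp
  qed
  have "(f has_vector_derivative frechet_derivative f (at x) 1) (at x)"
    unfolding has_vector_derivative_def by (rule has_derivative_eq_rhs[OF d e])
  then show "(f has_vector_derivative vector_derivative f (at x)) (at x)"
    "vector_derivative f (at x) = frechet_derivative f (at x) 1"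
    by (simp_all add: vector_derivative_at)
qed

lemma smooth_on_vector_derivative:
  fixes f :: "real \<Rightarrow> 'b::real_normed_vector"
  assumes "open S" "smooth_on S f"
  shows "smooth_on S (\<lambda>x. vector_derivative f (at x))"
  using smooth_on_frechet_derivative[OF assms(2), of 1]
    smooth_on_cong[OF assms(1) smooth_on_has_vector_derivative(2)[OF assms(2)]] by simp

section \<open>Functions on the circle\<close>

lemma circle_smooth_imp_smooth: "f \<in> circle_smooth \<Longrightarrow> smooth_on UNIV f"
  and circle_smooth_periodic: "f \<in> circle_smooth \<Longrightarrow> f (\<theta> + 2 * pi) = f \<theta>"
  by (simp_all add: circle_smooth_def)

lemma circle_smooth_const: "(\<lambda>\<theta>. a) \<in> circle_smooth"
  by (simp add: circle_smooth_def smooth_on_const)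

lemma circle_smooth_add:
  "f \<in> circle_smooth \<Longrightarrow> g \<in> circle_smooth \<Longrightarrow> (\<lambda>\<theta>. f \<theta> + g \<theta>) \<in> circle_smooth"
  by (simp add: circle_smooth_def smooth_on_add)

lemma circle_smooth_bilinear:
  "bounded_bilinear B \<Longrightarrow> f \<in> circle_smooth \<Longrightarrow> g \<in> circle_smooth \<Longrightarrow> (\<lambda>\<theta>. B (f \<theta>) (g \<theta>)) \<in> circle_smooth"
  by (simp add: circle_smooth_def smooth_on_bilinear)

lemmas circle_smooth_mult = circle_smooth_bilinear[OF bounded_bilinear_mult]
lemmas circle_smooth_scaleR = circle_smooth_bilinear[OF bounded_bilinear_scaleR]
lemmas circle_smooth_inner = circle_smooth_bilinear[OF bounded_bilinear_inner]
lemmas circle_smooth_cross3 = circle_smooth_bilinear[OF bounded_bilinear_cross3]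

lemma circle_smooth_has_vector_derivative:
  assumes "f \<in> circle_smooth"
  shows "(f has_vector_derivative vector_derivative f (at \<theta>)) (at \<theta> within S)"
  by (rule has_vector_derivative_at_within)
    (rule smooth_on_has_vector_derivative[OF circle_smooth_imp_smooth[OF assms]], simp)

lemma circle_smooth_dtheta:
  assumes "f \<in> circle_smooth"
  shows "(\<lambda>\<theta>. vector_derivative f (at \<theta>)) \<in> circle_smooth"
proof -
  have "vector_derivative f (at (\<theta> + 2 * pi)) = vector_derivative f (at \<theta>)" for \<theta>
  proof -
    have "((\<lambda>x. x + 2 * pi) has_vector_derivative 1) (at \<theta>)"
      by (auto intro!: derivative_eq_intros simp: has_vector_derivative_def)
    from vector_diff_chain_at[OF this circle_smooth_has_vector_derivative[OF assms]]
    have "(f has_vector_derivative vector_derivative f (at (\<theta> + 2 * pi))) (at \<theta>)"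
      using circle_smooth_periodic[OF assms] by (simp add: o_def)
    then show ?thesis by (metis vector_derivative_at)
  qed
  then show ?thesis
    using smooth_on_vector_derivative[OF open_UNIV circle_smooth_imp_smooth[OF assms]]
    by (simp add: circle_smooth_def)
qed

lemma circle_smooth_inverse_pos:
  "f \<in> circle_smooth \<Longrightarrow> (\<And>\<theta>. f \<theta> > (0::real)) \<Longrightarrow> (\<lambda>\<theta>. 1 / f \<theta>) \<in> circle_smooth"
  by (simp add: circle_smooth_def smooth_on_inverse_pos)

lemma circle_smooth_norm:
  fixes f :: "real \<Rightarrow> 'b::real_inner"
  shows "f \<in> circle_smooth \<Longrightarrow> (\<And>\<theta>. f \<theta> \<noteq> 0) \<Longrightarrow> (\<lambda>\<theta>. norm (f \<theta>)) \<in> circle_smooth"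
  by (simp add: circle_smooth_def smooth_on_norm)

lemma circle_smooth_continuous_on: "f \<in> circle_smooth \<Longrightarrow> continuous_on S f"
  using smooth_on_imp_continuous_on[OF circle_smooth_imp_smooth, of f] continuous_on_subset by blast

lemma circle_smooth_integrable:
  fixes f :: "real \<Rightarrow> 'b::euclidean_space"
  shows "f \<in> circle_smooth \<Longrightarrow> f integrable_on {a..b}"
  by (simp add: integrable_continuous_real circle_smooth_continuous_on)

text \<open>The absence of boundary terms on the circle: every integration by parts below is this
  fact applied to a product.\<close>

lemma integral_periodic_derivative:
  fixes f :: "real \<Rightarrow> real"
  assumes "f \<in> circle_smooth" "\<And>\<theta>. (f has_vector_derivative f' \<theta>) (at \<theta>)"
  shows "integral {0..2 * pi} f' = 0"
proof -
  have "(f' has_integral f (2 * pi) - f 0) {0..2 * pi}"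
    by (rule fundamental_theorem_of_calculus) (auto intro: has_vector_derivative_at_within assms(2))
  then show ?thesis using circle_smooth_periodic[OF assms(1), of 0] by (simp add: integral_unique)
qed

text \<open>Compactness and integral arguments only see the interval from 0 to
  \<open>2 * pi\<close>; this transfers their conclusions to the whole line.\<close>

lemma periodic_representative:
  assumes "\<And>\<theta>::real. f (\<theta> + 2 * pi) = f \<theta>"
  obtains \<theta>' where "\<theta>' \<in> {0..2 * pi}" "f \<theta>' = f \<theta>"
proof -
  interpret periodic_fun_simple f "2 * pi" by unfold_locales (rule assms)
  let ?n = "\<lfloor>\<theta> / (2 * pi)\<rfloor>"
  have "f (\<theta> - of_int ?n * (2 * pi)) = f \<theta>" by (rule minus_of_int)
  moreover have "of_int ?n \<le> \<theta> / (2 * pi)" "\<theta> / (2 * pi) \<le> of_int ?n + 1" by linarith+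
  then have "of_int ?n * (2 * pi) \<le> \<theta>" "\<theta> \<le> (of_int ?n + 1) * (2 * pi)"
    using pos_le_divide_eq[of "2 * pi" "of_int ?n" \<theta>] pos_divide_le_eq[of "2 * pi" \<theta> "of_int ?n + 1"] by auto
  ultimately show thesis using that[of "\<theta> - of_int ?n * (2 * pi)"] by (simp add: algebra_simps)
qed

lemma periodic_eq_0_of_integral:
  assumes "f \<in> circle_smooth" "\<And>\<theta>. f \<theta> \<ge> (0::real)" "integral {0..2 * pi} f = 0"
  shows "f \<theta> = 0"
proof -
  obtain \<theta>' where "\<theta>' \<in> {0..2 * pi}" "f \<theta>' = f \<theta>"
    using periodic_representative circle_smooth_periodic[OF assms(1)] by metis
  moreover have "\<forall>x\<in>{0..2 * pi}. f x = 0"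
    using integral_eq_0_iff[of 0 "2 * pi" f] circle_smooth_continuous_on[OF assms(1)] assms(2,3) by simp
  ultimately show ?thesis by simp
qed

text \<open>The fundamental lemma of the calculus of variations, with the loop itself as test function.\<close>

lemma loop_eq_0_of_pairing:
  fixes f :: curve
  assumes "f \<in> loops" "\<And>k. k \<in> loops \<Longrightarrow> integral {0..2 * pi} (\<lambda>\<theta>. f \<theta> \<bullet> k \<theta>) = 0"
  shows "f \<theta> = 0"
  using periodic_eq_0_of_integral[OF circle_smooth_inner[OF assms(1) assms(1)] _ assms(2)[OF assms(1)], of \<theta>]
  by simp

section \<open>Change of variables under diffeomorphisms of the circle\<close>

lemma diff_plus_real_derivative:
  assumes "\<phi> \<in> diff_plus"
  shows "(\<phi> has_real_derivative deriv \<phi> \<theta>) (at \<theta>)"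
proof -
  have "smooth_on UNIV \<phi>" using assms by (simp add: diff_plus_def)
  from smooth_on_has_vector_derivative(1)[OF this, of \<theta>] show ?thesis
    by (simp add: has_real_derivative_iff_has_vector_derivative[symmetric])
      (metis DERIV_imp_deriv)
qed

lemma circle_smooth_compose:
  fixes f :: "real \<Rightarrow> 'b::real_normed_vector"
  assumes "f \<in> circle_smooth" "\<phi> \<in> diff_plus"
  shows "f \<circ> \<phi> \<in> circle_smooth"
proof -
  have "smooth_on UNIV (\<lambda>x. f (\<phi> x))"
    by (rule smooth_on_compose_real[of UNIV UNIV])
      (use assms in \<open>auto simp: circle_smooth_def diff_plus_def\<close>)
  then show ?thesis using assms by (simp add: circle_smooth_def diff_plus_def o_def)
qed

lemma dtheta_compose:
  fixes f :: "real \<Rightarrow> 'b::real_normed_vector"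
  assumes "f \<in> circle_smooth" "\<phi> \<in> diff_plus"
  shows "vector_derivative (f \<circ> \<phi>) (at \<theta>) = deriv \<phi> \<theta> *\<^sub>R vector_derivative f (at (\<phi> \<theta>))"
  by (intro vector_derivative_at vector_diff_chain_at circle_smooth_has_vector_derivative assms(1)
      diff_plus_real_derivative[OF assms(2), unfolded has_real_derivative_iff_has_vector_derivative])

text \<open>Substitution replaces the period from 0 to \<open>2 * pi\<close> by the one starting at
  \<open>\<phi> 0\<close>. The integral over a period does not depend on where the period
  starts.\<close>

lemma integral_reparametrize:
  assumes f: "f \<in> circle_smooth" and \<phi>: "\<phi> \<in> diff_plus"
  shows "integral {0..2 * pi} (\<lambda>\<theta>. f (\<phi> \<theta>) * deriv \<phi> \<theta>) = integral {0..2 * pi} (f :: real \<Rightarrow> real)"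
proof -
  have per: "\<phi> (2 * pi) = \<phi> 0 + 2 * pi" using \<phi> by (simp add: diff_plus_def) (metis add_0)
  have mono: "\<phi> x \<le> \<phi> y" if "x \<le> y" for x y
  proof (rule DERIV_nonneg_imp_nondecreasing[OF that])
    show "\<exists>d. DERIV \<phi> z :> d \<and> 0 \<le> d" for z
      using diff_plus_real_derivative[OF \<phi>, of z] \<phi> by (auto simp: diff_plus_def intro: less_imp_le)
  qed
  \<comment> \<open>Large enough for the interval from \<open>- M\<close> to \<open>M\<close> to
    contain both periods, the one starting at 0 and the one starting at \<open>\<phi> 0\<close>;
    both starting points then lie in the smaller interval from \<open>- M\<close> to
    \<open>M - 2 * pi\<close>.\<close>
  define M where "M = \<bar>\<phi> 0\<bar> + 2 * pi"
  obtain F where F: "\<And>x. x \<in> {-M..M} \<Longrightarrow> (F has_vector_derivative f x) (at x within {-M..M})"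
    using antiderivative_continuous[OF circle_smooth_continuous_on[OF f]] by blast
  have M: "M \<ge> 2 * pi" by (simp add: M_def)
  have "((\<lambda>\<theta>. deriv \<phi> \<theta> * f (\<phi> \<theta>)) has_integral F (\<phi> (2 * pi)) - F (\<phi> 0)) {0..2 * pi}"
  proof (rule fundamental_theorem_of_calculus)
    fix x assume x: "x \<in> {0..2 * pi}"
    have im: "\<phi> ` {0..2 * pi} \<subseteq> {-M..M}"
      using mono[of 0] mono[of _ "2 * pi"] per by (fastforce simp: M_def)
    have d: "(\<phi> has_vector_derivative deriv \<phi> x) (at x within {0..2 * pi})"
      using diff_plus_real_derivative[OF \<phi>, of x]
      by (simp add: has_real_derivative_iff_has_vector_derivative has_vector_derivative_at_within)
    have "(F has_vector_derivative f (\<phi> x)) (at (\<phi> x) within \<phi> ` {0..2 * pi})"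
      using has_vector_derivative_within_subset[OF F im] im x by blast
    from vector_diff_chain_within[OF d this]
    show "((\<lambda>x. F (\<phi> x)) has_vector_derivative deriv \<phi> x * f (\<phi> x)) (at x within {0..2 * pi})"
      by (simp add: o_def)
  qed simp
  moreover have "(f has_integral F (2 * pi) - F 0) {0..2 * pi}"
    by (rule fundamental_theorem_of_calculus)
      (use M in \<open>auto intro!: has_vector_derivative_within_subset[OF F]\<close>)
  \<comment> \<open>Periodicity of \<open>f\<close> makes the derivative of
    \<open>F (x + 2 * pi) - F x\<close> vanish; comparing the values at \<open>\<phi> 0\<close> and
    at 0 identifies the two period integrals.\<close>
  moreover have "\<exists>k. \<forall>x\<in>{-M..M - 2 * pi}. F (x + 2 * pi) - F x = k"
  proof (rule has_vector_derivative_zero_constant[of "{-M..M - 2 * pi}" "\<lambda>x. F (x + 2 * pi) - F x", THEN exE])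
    fix x assume x: "x \<in> {-M..M - 2 * pi}"
    have "((\<lambda>x. x + 2 * pi) has_vector_derivative 1) (at x within {-M..M - 2 * pi})"
      by (auto intro!: derivative_eq_intros simp: has_vector_derivative_def)
    moreover have "(F has_vector_derivative f (x + 2 * pi))
        (at (x + 2 * pi) within (\<lambda>x. x + 2 * pi) ` {-M..M - 2 * pi})"
      by (rule has_vector_derivative_within_subset[OF F]; use x pi_gt_zero in \<open>fastforce simp del: pi_gt_zero\<close>)
    ultimately have "((\<lambda>x. F (x + 2 * pi)) has_vector_derivative f (x + 2 * pi)) (at x within {-M..M - 2 * pi})"
      using vector_diff_chain_within by (fastforce simp: o_def)
    moreover have "(F has_vector_derivative f x) (at x within {-M..M - 2 * pi})"
      by (rule has_vector_derivative_within_subset[OF F]; use x pi_gt_zero in \<open>fastforce simp del: pi_gt_zero\<close>)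
    ultimately show "((\<lambda>x. F (x + 2 * pi) - F x) has_vector_derivative 0) (at x within {-M..M - 2 * pi})"
      using has_vector_derivative_diff circle_smooth_periodic[OF f, of x] by fastforce
  qed auto
  then have "F (\<phi> 0 + 2 * pi) - F (\<phi> 0) = F (0 + 2 * pi) - F 0"
  proof -
    have "\<phi> 0 \<in> {-M..M - 2 * pi}" "0 \<in> {-M..M - 2 * pi}"
      unfolding M_def atLeastAtMost_iff using pi_gt_zero by linarith+
    with \<open>\<exists>k. \<forall>x\<in>{-M..M - 2 * pi}. F (x + 2 * pi) - F x = k\<close> show ?thesis by metis
  qed
  ultimately show ?thesis unfolding per by (simp add: integral_unique mult.commute)
qed

section \<open>Immersions and their tangent frame\<close>

lemma Imm_loops: "c \<in> Imm \<Longrightarrow> c \<in> loops"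
  and Imm_dtheta_nonzero: "c \<in> Imm \<Longrightarrow> dtheta c \<theta> \<noteq> 0"
  by (simp_all add: Imm_def)

lemma speed_circle_smooth: "c \<in> Imm \<Longrightarrow> (\<lambda>\<theta>. norm (dtheta c \<theta>)) \<in> circle_smooth"
  by (simp add: circle_smooth_norm circle_smooth_dtheta Imm_loops Imm_dtheta_nonzero)

lemma Ds_loops: "c \<in> Imm \<Longrightarrow> h \<in> loops \<Longrightarrow> Ds c h \<in> loops"
  unfolding Ds_def
  by (intro circle_smooth_scaleR circle_smooth_inverse_pos speed_circle_smooth circle_smooth_dtheta)
    (simp_all add: Imm_dtheta_nonzero)

lemma norm_Ds: "c \<in> Imm \<Longrightarrow> norm (Ds c c \<theta>) = 1"
  by (simp add: Ds_def Imm_dtheta_nonzero)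

lemma speed_Ds: "c \<in> Imm \<Longrightarrow> norm (dtheta c \<theta>) *\<^sub>R Ds c h \<theta> = dtheta h \<theta>"
  by (simp add: Ds_def Imm_dtheta_nonzero)

lemma has_vector_derivative_Ds:
  "c \<in> Imm \<Longrightarrow> h \<in> loops \<Longrightarrow> (Ds c h has_vector_derivative norm (dtheta c \<theta>) *\<^sub>R Ds c (Ds c h) \<theta>) (at \<theta>)"
  by (simp only: speed_Ds circle_smooth_has_vector_derivative Ds_loops)

lemma loops_has_vector_derivative:
  "c \<in> Imm \<Longrightarrow> h \<in> loops \<Longrightarrow> (h has_vector_derivative norm (dtheta c \<theta>) *\<^sub>R Ds c h \<theta>) (at \<theta>)"
  by (simp only: speed_Ds circle_smooth_has_vector_derivative)

lemma has_vector_derivative_inner: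
  fixes f g :: "real \<Rightarrow> 'a::real_inner"
  assumes "(f has_vector_derivative f') (at \<theta>)" "(g has_vector_derivative g') (at \<theta>)"
  shows "((\<lambda>\<theta>. f \<theta> \<bullet> g \<theta>) has_vector_derivative f \<theta> \<bullet> g' + f' \<bullet> g \<theta>) (at \<theta>)"
  by (rule bounded_bilinear.has_vector_derivative[OF bounded_bilinear_inner assms])

lemma has_vector_derivative_cross3:
  assumes "(f has_vector_derivative f') (at \<theta>)" "(g has_vector_derivative g') (at \<theta>)"
  shows "((\<lambda>\<theta>. cross3 (f \<theta>) (g \<theta>)) has_vector_derivative cross3 (f \<theta>) g' + cross3 f' (g \<theta>)) (at \<theta>)"
  by (rule bounded_bilinear.has_vector_derivative[OF bounded_bilinear_cross3 assms])

text \<open>Differentiate the constant function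
  \<open>Ds c c \<theta> \<bullet> Ds c c \<theta>\<close>.\<close>

lemma unit_tangent_orthogonal:
  assumes "c \<in> Imm"
  shows "Ds c c \<theta> \<bullet> Ds c (Ds c c) \<theta> = 0"
proof -
  let ?T = "Ds c c" and ?v = "norm (dtheta c \<theta>)"
  have "((\<lambda>\<theta>. ?T \<theta> \<bullet> ?T \<theta>) has_vector_derivative
      ?T \<theta> \<bullet> (?v *\<^sub>R Ds c ?T \<theta>) + (?v *\<^sub>R Ds c ?T \<theta>) \<bullet> ?T \<theta>) (at \<theta>)"
    using has_vector_derivative_Ds[OF assms Imm_loops[OF assms]] has_vector_derivative_inner by blast
  moreover have "(\<lambda>\<theta>. ?T \<theta> \<bullet> ?T \<theta>) = (\<lambda>\<theta>. 1)"
    using norm_Ds[OF assms] by (simp add: dot_square_norm)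
  ultimately have "2 * ?v * (?T \<theta> \<bullet> Ds c ?T \<theta>) = 0"
    using vector_derivative_unique_at[OF _ has_vector_derivative_const]
    by (fastforce simp: inner_commute)
  then show ?thesis using Imm_dtheta_nonzero[OF assms] by simp
qed

lemma arc_integral_cong:
  "(\<And>\<theta>. f \<theta> * norm (dtheta c \<theta>) = g \<theta>) \<Longrightarrow> arc_integral c f = integral {0..2 * pi} g"
  by (simp add: arc_integral_def)

lemma curve_length_pos:
  assumes "c \<in> Imm" shows "curve_length c > 0"
proof -
  note s = speed_circle_smooth[OF assms]
  have "curve_length c \<ge> 0"
    unfolding curve_length_def by (rule integral_nonneg[OF circle_smooth_integrable[OF s]]) simp
  moreover have "curve_length c \<noteq> 0"
    using periodic_eq_0_of_integral[OF s, of 0] Imm_dtheta_nonzero[OF assms]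
    by (auto simp: curve_length_def)
  ultimately show ?thesis by simp
qed

text \<open>The first variation of the length, that is, the differential of
  \<open>curve_length\<close>.\<close>

definition len_deriv :: one_form where
  "len_deriv c h = integral {0..2 * pi} (\<lambda>\<theta>. dtheta c \<theta> \<bullet> dtheta h \<theta> / norm (dtheta c \<theta>))"

text \<open>The second variation of the length. Its symmetry in the two directions is what
  closedness of the forms uses.\<close>

definition len_deriv2 :: two_form where
  "len_deriv2 c h k = integral {0..2 * pi} (\<lambda>\<theta>. dtheta h \<theta> \<bullet> dtheta k \<theta> / norm (dtheta c \<theta>) -
     (dtheta c \<theta> \<bullet> dtheta h \<theta>) * (dtheta c \<theta> \<bullet> dtheta k \<theta>) / norm (dtheta c \<theta>) ^ 3)"

text \<open>The derivative of \<open>Theta_id\<close> in the base point in direction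
  \<open>h\<close>, with the argument \<open>k\<close> held fixed.\<close>

definition Theta_deriv :: two_form where
  "Theta_deriv c h k = integral {0..2 * pi}
     (\<lambda>\<theta>. cross3 (c \<theta>) (dtheta h \<theta>) \<bullet> k \<theta> + cross3 (h \<theta>) (dtheta c \<theta>) \<bullet> k \<theta>)"

text \<open>The determinant form of the overview. It equals the Marsden-Weinstein form, since
  \<open>Omega_id\<close> is three times it.\<close>

definition det_form :: two_form where
  "det_form c h k = integral {0..2 * pi} (\<lambda>\<theta>. cross3 (dtheta c \<theta>) (h \<theta>) \<bullet> k \<theta>)"

lemma Theta_id_eq: "Theta_id c h = integral {0..2 * pi} (\<lambda>\<theta>. cross3 (c \<theta>) (dtheta c \<theta>) \<bullet> h \<theta>)"
  unfolding Theta_id_def by (rule arc_integral_cong) (simp add: Ds_def cross_mult_right)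

lemma arc_integral_det_form:
  "arc_integral c (\<lambda>\<theta>. cross3 (Ds c c \<theta>) (h \<theta>) \<bullet> k \<theta>) = det_form c h k"
  unfolding det_form_def by (rule arc_integral_cong) (simp add: Ds_def cross_mult_left)

lemma len_deriv_eq_arc_integral:
  assumes "c \<in> Imm"
  shows "len_deriv c h = arc_integral c (\<lambda>\<theta>. Ds c h \<theta> \<bullet> Ds c c \<theta>)"
  unfolding len_deriv_def
  by (rule arc_integral_cong[symmetric]) (simp add: Ds_def inner_commute)

text \<open>The derivative of the inner product of \<open>h\<close> with the unit tangent integrates
  to zero over the circle.\<close>

lemma len_deriv_by_parts:
  assumes c: "c \<in> Imm" and h: "h \<in> loops"
  shows "len_deriv c h = - arc_integral c (\<lambda>\<theta>. h \<theta> \<bullet> Ds c (Ds c c) \<theta>)"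
proof -
  note l = Imm_loops[OF c]
  let ?v = "\<lambda>\<theta>. norm (dtheta c \<theta>)"
  let ?p = "\<lambda>\<theta>. (Ds c h \<theta> \<bullet> Ds c c \<theta>) * ?v \<theta>" and ?q = "\<lambda>\<theta>. (h \<theta> \<bullet> Ds c (Ds c c) \<theta>) * ?v \<theta>"
  have "integral {0..2 * pi} (\<lambda>\<theta>. ?p \<theta> + ?q \<theta>) = 0"
  proof (rule integral_periodic_derivative[of "\<lambda>\<theta>. h \<theta> \<bullet> Ds c c \<theta>"])
    show "((\<lambda>\<theta>. h \<theta> \<bullet> Ds c c \<theta>) has_vector_derivative ?p \<theta> + ?q \<theta>) (at \<theta>)" for \<theta>
      using has_vector_derivative_inner[OF loops_has_vector_derivative[OF c h] has_vector_derivative_Ds[OF c l]]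
      by (simp add: algebra_simps)
  qed (intro circle_smooth_inner h Ds_loops c l)
  moreover have "?p \<in> circle_smooth" "?q \<in> circle_smooth"
    by (intro circle_smooth_mult circle_smooth_inner Ds_loops h c l speed_circle_smooth)+
  then have "integral {0..2 * pi} (\<lambda>\<theta>. ?p \<theta> + ?q \<theta>) = integral {0..2 * pi} ?p + integral {0..2 * pi} ?q"
    by (intro integral_add circle_smooth_integrable)
  ultimately show ?thesis
    by (simp add: len_deriv_eq_arc_integral[OF c] arc_integral_def)
qed

section \<open>Derivatives along straight lines\<close>

lemma dtheta_line:
  assumes "c \<in> loops" "h \<in> loops"
  shows "dtheta (\<lambda>\<theta>. c \<theta> + t *\<^sub>R h \<theta>) \<theta> = dtheta c \<theta> + t *\<^sub>R dtheta h \<theta>"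
  by (intro vector_derivative_at has_vector_derivative_add
      bounded_linear.has_vector_derivative[OF bounded_linear_scaleR_right]
      circle_smooth_has_vector_derivative assms)

lemma loops_line: "c \<in> loops \<Longrightarrow> h \<in> loops \<Longrightarrow> (\<lambda>\<theta>. c \<theta> + t *\<^sub>R h \<theta>) \<in> loops"
  by (intro circle_smooth_add circle_smooth_scaleR circle_smooth_const)

text \<open>By compactness of a period the speed of \<open>h\<close> is at most \<open>B\<close>
  times the speed of \<open>c\<close>, so the perturbed velocity cannot vanish for |t| < 1 / B.
  Formulas established only for immersions can thus be differentiated at t = 0.\<close>

lemma Imm_line:
  assumes c: "c \<in> Imm" and h: "h \<in> loops"
  obtains e where "e > 0" "\<And>t. \<bar>t\<bar> < e \<Longrightarrow> (\<lambda>\<theta>. c \<theta> + t *\<^sub>R h \<theta>) \<in> Imm"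
proof -
  note l = Imm_loops[OF c]
  have nz: "dtheta c \<theta> \<noteq> 0" for \<theta> by (rule Imm_dtheta_nonzero[OF c])
  let ?r = "\<lambda>\<theta>. norm (dtheta h \<theta>) / norm (dtheta c \<theta>)"
  have "continuous_on {0..2 * pi} ?r"
    by (intro continuous_on_divide continuous_on_norm circle_smooth_continuous_on circle_smooth_dtheta l h)
      (simp add: nz)
  then have "bounded (?r ` {0..2 * pi})"
    by (intro compact_imp_bounded compact_continuous_image) auto
  then obtain B where B: "B > 0" "\<And>\<theta>. \<theta> \<in> {0..2 * pi} \<Longrightarrow> ?r \<theta> \<le> B"
    by (auto simp: bounded_pos)
  have B': "norm (dtheta h \<theta>) \<le> B * norm (dtheta c \<theta>)" for \<theta>
  proof -
    have "?r (\<theta> + 2 * pi) = ?r \<theta>" for \<theta>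
      using circle_smooth_periodic circle_smooth_dtheta l h by metis
    then obtain \<theta>' where "\<theta>' \<in> {0..2 * pi}" "?r \<theta>' = ?r \<theta>" by (rule periodic_representative)
    with B(2) have "?r \<theta> \<le> B" by metis
    then show ?thesis using nz by (simp add: field_simps)
  qed
  show thesis
  proof
    show "1 / B > 0" using B by simp
    fix t :: real assume t: "\<bar>t\<bar> < 1 / B"
    have "dtheta c \<theta> + t *\<^sub>R dtheta h \<theta> \<noteq> 0" for \<theta>
    proof
      assume "dtheta c \<theta> + t *\<^sub>R dtheta h \<theta> = 0"
      then have "dtheta c \<theta> = - (t *\<^sub>R dtheta h \<theta>)" by (simp add: eq_neg_iff_add_eq_0)
      then have "norm (dtheta c \<theta>) = \<bar>t\<bar> * norm (dtheta h \<theta>)" by simp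
      also have "\<dots> \<le> \<bar>t\<bar> * (B * norm (dtheta c \<theta>))" by (intro mult_left_mono B') simp
      also have "\<dots> < 1 * norm (dtheta c \<theta>)"
        unfolding mult.assoc[symmetric] by (intro mult_strict_right_mono) (use t B nz in \<open>auto simp: field_simps\<close>)
      finally show False by simp
    qed
    then show "(\<lambda>\<theta>. c \<theta> + t *\<^sub>R h \<theta>) \<in> Imm"
      using loops_line[OF l h] dtheta_line[OF l h] by (simp add: Imm_def)
  qed
qed

text \<open>The length integrands are differentiable in t only while the velocity does not vanish,
  so the Leibniz rule is used on the open interval from -e to e; there the derivative at 0 within
  the interval is the derivative at 0.\<close>

lemma integral_has_field_derivative:
  fixes f :: "real \<Rightarrow> real \<Rightarrow> real"
  assumes e: "e > 0"
    and d: "\<And>t \<theta>. \<bar>t\<bar> < e \<Longrightarrow> ((\<lambda>t. f t \<theta>) has_field_derivative f' t \<theta>) (at t)"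
    and c: "\<And>t. \<bar>t\<bar> < e \<Longrightarrow> continuous_on UNIV (f t)"
    and c': "continuous_on ({t. \<bar>t\<bar> < e} \<times> UNIV) (\<lambda>(t, \<theta>). f' t \<theta>)"
  shows "((\<lambda>t. integral {a..b} (f t)) has_field_derivative integral {a..b} (f' 0)) (at 0)"
proof -
  have U: "{t. \<bar>t\<bar> < e} = {-e<..<e}" by auto
  have "((\<lambda>t. integral (cbox a b) (f t)) has_field_derivative integral (cbox a b) (f' 0)) (at 0 within {-e<..<e})"
  proof (rule leibniz_rule_field_derivative)
    show "continuous_on ({- e<..<e} \<times> cbox a b) (\<lambda>(x, t). f' x t)"
      using continuous_on_subset[OF c', of "{- e<..<e} \<times> cbox a b"] U by auto
    show "f t integrable_on cbox a b" if "t \<in> {-e<..<e}" for t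
      using that by (intro integrable_continuous continuous_on_subset[OF c]) auto
    show "((\<lambda>t. f t \<theta>) has_field_derivative f' t \<theta>) (at t within {-e<..<e})" if "t \<in> {-e<..<e}" for t \<theta>
      by (rule has_field_derivative_at_within[OF d]) (use that in auto)
  qed (use e in simp_all)
  then show ?thesis using e at_within_open[of 0 "{-e<..<e}"] by simp
qed

lemma has_field_derivative_norm_line:
  fixes u v :: "'a::real_inner"
  assumes "u + t *\<^sub>R v \<noteq> 0"
  shows "((\<lambda>t. norm (u + t *\<^sub>R v)) has_field_derivative (u + t *\<^sub>R v) \<bullet> v / norm (u + t *\<^sub>R v)) (at t)"
proof -
  have 1: "((\<lambda>t. u + t *\<^sub>R v) has_derivative (\<lambda>s. s *\<^sub>R v)) (at t)"
    by (rule derivative_eq_intros refl | simp)+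
  define w where "w = u + t *\<^sub>R v"
  have 2: "(norm has_derivative (\<lambda>h. h \<bullet> sgn w)) (at w)"
    using assms by (intro has_derivative_norm) (simp add: w_def)
  have "(s *\<^sub>R v) \<bullet> sgn w = w \<bullet> v / norm w * s" for s
    by (simp add: sgn_div_norm inner_commute[of v w] divide_inverse)
  then have 3: "(\<lambda>s. (s *\<^sub>R v) \<bullet> sgn w) = (*) (w \<bullet> v / norm w)" by (rule ext)
  show ?thesis unfolding has_field_derivative_def 3[unfolded w_def, symmetric]
    by (rule has_derivative_compose[OF 1 2[unfolded w_def]])
qed

lemma curve_length_has_field_derivative:
  assumes c: "c \<in> Imm" and h: "h \<in> loops"
  shows "((\<lambda>t. curve_length (\<lambda>\<theta>. c \<theta> + t *\<^sub>R h \<theta>)) has_field_derivative len_deriv c h) (at 0)"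
proof -
  note l = Imm_loops[OF c]
  obtain e where e: "e > 0" "\<And>t. \<bar>t\<bar> < e \<Longrightarrow> (\<lambda>\<theta>. c \<theta> + t *\<^sub>R h \<theta>) \<in> Imm" by (rule Imm_line[OF c h]) (rule that)
  have nz: "dtheta c \<theta> + t *\<^sub>R dtheta h \<theta> \<noteq> 0" if "\<bar>t\<bar> < e" for t \<theta>
    using Imm_dtheta_nonzero[OF e(2)[OF that], of \<theta>] by (simp add: dtheta_line[OF l h])
  have cont: "continuous_on S (\<lambda>x. dtheta c (snd x))" "continuous_on S (\<lambda>x. dtheta h (snd x))"
    for S :: "(real \<times> real) set"
    by (rule continuous_on_compose2[OF circle_smooth_continuous_on[OF circle_smooth_dtheta, of _ UNIV]];
        simp add: l h continuous_on_snd)+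
  have dcont: "continuous_on UNIV (dtheta c)" "continuous_on UNIV (dtheta h)"
    by (intro circle_smooth_continuous_on circle_smooth_dtheta l h)+
  have "((\<lambda>t. integral {0..2 * pi} (\<lambda>\<theta>. norm (dtheta c \<theta> + t *\<^sub>R dtheta h \<theta>))) has_field_derivative
      integral {0..2 * pi} (\<lambda>\<theta>. (dtheta c \<theta> + 0 *\<^sub>R dtheta h \<theta>) \<bullet> dtheta h \<theta> / norm (dtheta c \<theta> + 0 *\<^sub>R dtheta h \<theta>))) (at 0)"
  proof (rule integral_has_field_derivative[OF e(1)])
    show "continuous_on UNIV (\<lambda>\<theta>. norm (dtheta c \<theta> + t *\<^sub>R dtheta h \<theta>))" for t
      by (intro continuous_intros dcont)
    show "continuous_on ({t. \<bar>t\<bar> < e} \<times> UNIV) (\<lambda>(t, \<theta>). (dtheta c \<theta> + t *\<^sub>R dtheta h \<theta>) \<bullet> dtheta h \<theta> /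
        norm (dtheta c \<theta> + t *\<^sub>R dtheta h \<theta>))"
      unfolding case_prod_unfold by (intro continuous_intros cont ballI) (use nz in auto)
  qed (rule has_field_derivative_norm_line[OF nz])
  then show ?thesis by (simp add: curve_length_def dtheta_line[OF l h] len_deriv_def)
qed

lemma len_deriv_has_field_derivative:
  assumes c: "c \<in> Imm" and h: "h \<in> loops" and k: "k \<in> loops"
  shows "((\<lambda>t. len_deriv (\<lambda>\<theta>. c \<theta> + t *\<^sub>R h \<theta>) k) has_field_derivative len_deriv2 c h k) (at 0)"
proof -
  note l = Imm_loops[OF c]
  obtain e where e: "e > 0" "\<And>t. \<bar>t\<bar> < e \<Longrightarrow> (\<lambda>\<theta>. c \<theta> + t *\<^sub>R h \<theta>) \<in> Imm" by (rule Imm_line[OF c h]) (rule that)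
  have nz: "dtheta c \<theta> + t *\<^sub>R dtheta h \<theta> \<noteq> 0" if "\<bar>t\<bar> < e" for t \<theta>
    using Imm_dtheta_nonzero[OF e(2)[OF that], of \<theta>] by (simp add: dtheta_line[OF l h])
  have cont: "continuous_on S (\<lambda>x. dtheta c (snd x))" "continuous_on S (\<lambda>x. dtheta h (snd x))"
      "continuous_on S (\<lambda>x. dtheta k (snd x))"
    for S :: "(real \<times> real) set"
    by (rule continuous_on_compose2[OF circle_smooth_continuous_on[OF circle_smooth_dtheta, of _ UNIV]];
        simp add: l h k continuous_on_snd)+
  have dcont: "continuous_on UNIV (dtheta c)" "continuous_on UNIV (dtheta h)" "continuous_on UNIV (dtheta k)"
    by (intro circle_smooth_continuous_on circle_smooth_dtheta l h k)+
  let ?u = "\<lambda>t \<theta>. dtheta c \<theta> + t *\<^sub>R dtheta h \<theta>"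
  let ?f' = "\<lambda>t \<theta>. dtheta h \<theta> \<bullet> dtheta k \<theta> / norm (?u t \<theta>) -
     (?u t \<theta> \<bullet> dtheta h \<theta>) * (?u t \<theta> \<bullet> dtheta k \<theta>) / norm (?u t \<theta>) ^ 3"
  have "((\<lambda>t. integral {0..2 * pi} (\<lambda>\<theta>. ?u t \<theta> \<bullet> dtheta k \<theta> / norm (?u t \<theta>))) has_field_derivative
      integral {0..2 * pi} (?f' 0)) (at 0)"
  proof (rule integral_has_field_derivative[OF e(1)])
    fix t \<theta> assume t: "\<bar>t\<bar> < e"
    have "((\<lambda>t. ?u t \<theta> \<bullet> dtheta k \<theta>) has_field_derivative dtheta h \<theta> \<bullet> dtheta k \<theta>) (at t)"
      unfolding inner_add_left inner_scaleR_left by (rule derivative_eq_intros refl | simp)+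
    from DERIV_divide[OF this has_field_derivative_norm_line[OF nz[OF t]]]
    show "((\<lambda>t. ?u t \<theta> \<bullet> dtheta k \<theta> / norm (?u t \<theta>)) has_field_derivative ?f' t \<theta>) (at t)"
      by (rule DERIV_cong) (use nz[OF t] in \<open>auto simp: field_simps power3_eq_cube\<close>)
  next
    show "continuous_on UNIV (\<lambda>\<theta>. ?u t \<theta> \<bullet> dtheta k \<theta> / norm (?u t \<theta>))" if "\<bar>t\<bar> < e" for t
      by (intro continuous_intros dcont ballI) (use nz[OF that] in simp)
    show "continuous_on ({t. \<bar>t\<bar> < e} \<times> UNIV) (\<lambda>(t, \<theta>). ?f' t \<theta>)"
      unfolding case_prod_unfold by (intro continuous_intros cont ballI) (use nz in auto)
  qed
  then show ?thesis by (simp add: len_deriv_def dtheta_line[OF l h] len_deriv2_def)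
qed

text \<open>The speed factors of arc length and of \<open>Ds\<close> cancel, so along the line the
  functional is exactly a quadratic polynomial in t. The derivative is its linear
  coefficient.\<close>

lemma Theta_id_has_field_derivative:
  assumes c: "c \<in> loops" and h: "h \<in> loops" and k: "k \<in> loops"
  shows "((\<lambda>t. Theta_id (\<lambda>\<theta>. c \<theta> + t *\<^sub>R h \<theta>) k) has_field_derivative Theta_deriv c h k) (at 0)"
proof -
  have I: "(\<lambda>\<theta>. cross3 (f \<theta>) (g \<theta>) \<bullet> k \<theta>) integrable_on {0..2 * pi}"
    if "f \<in> loops" "g \<in> loops" for f g :: curve
    by (intro circle_smooth_integrable circle_smooth_inner circle_smooth_cross3 that k)
  note dc = circle_smooth_dtheta[OF c] and dh = circle_smooth_dtheta[OF h]
  have "Theta_id (\<lambda>\<theta>. c \<theta> + t *\<^sub>R h \<theta>) k = Theta_id c k + t * Theta_deriv c h k +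
      t\<^sup>2 * integral {0..2 * pi} (\<lambda>\<theta>. cross3 (h \<theta>) (dtheta h \<theta>) \<bullet> k \<theta>)" for t
  proof -
    have "((\<lambda>\<theta>. cross3 (c \<theta>) (dtheta c \<theta>) \<bullet> k \<theta> +
        t * (cross3 (c \<theta>) (dtheta h \<theta>) \<bullet> k \<theta> + cross3 (h \<theta>) (dtheta c \<theta>) \<bullet> k \<theta>) +
        t\<^sup>2 * (cross3 (h \<theta>) (dtheta h \<theta>) \<bullet> k \<theta>)) has_integral
      Theta_id c k + t * Theta_deriv c h k + t\<^sup>2 * integral {0..2 * pi} (\<lambda>\<theta>. cross3 (h \<theta>) (dtheta h \<theta>) \<bullet> k \<theta>))
        {0..2 * pi}"
      unfolding Theta_id_eq Theta_deriv_def
      by (intro has_integral_add has_integral_mult_right integrable_integral integrable_add I c h dc dh)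
    moreover have "cross3 (c \<theta> + t *\<^sub>R h \<theta>) (dtheta c \<theta> + t *\<^sub>R dtheta h \<theta>) \<bullet> k \<theta> =
        cross3 (c \<theta>) (dtheta c \<theta>) \<bullet> k \<theta> +
        t * (cross3 (c \<theta>) (dtheta h \<theta>) \<bullet> k \<theta> + cross3 (h \<theta>) (dtheta c \<theta>) \<bullet> k \<theta>) +
        t\<^sup>2 * (cross3 (h \<theta>) (dtheta h \<theta>) \<bullet> k \<theta>)" for \<theta>
      by (simp add: cross_add_left cross_add_right cross_mult_left cross_mult_right inner_add_left
          distrib_left power2_eq_square)
    ultimately show ?thesis
      by (simp only: Theta_id_eq[of "\<lambda>\<theta>. c \<theta> + t *\<^sub>R h \<theta>"] dtheta_line[OF c h] integral_unique)
  qed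
  moreover have "((\<lambda>t. Theta_id c k + t * Theta_deriv c h k +
      t\<^sup>2 * integral {0..2 * pi} (\<lambda>\<theta>. cross3 (h \<theta>) (dtheta h \<theta>) \<bullet> k \<theta>)) has_field_derivative Theta_deriv c h k) (at 0)"
    by (rule derivative_eq_intros refl | simp)+
  ultimately show ?thesis by (simp only:)
qed

section \<open>The forms\<close>

lemma dtheta_add:
  "f \<in> loops \<Longrightarrow> g \<in> loops \<Longrightarrow> dtheta (\<lambda>\<theta>. f \<theta> + g \<theta>) \<theta> = dtheta f \<theta> + dtheta g \<theta>"
  using dtheta_line[of f g 1] by simp

lemma dtheta_scaleR:
  "f \<in> loops \<Longrightarrow> dtheta (\<lambda>\<theta>. r *\<^sub>R f \<theta>) \<theta> = r *\<^sub>R dtheta f \<theta>"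
  by (intro vector_derivative_at bounded_linear.has_vector_derivative[OF bounded_linear_scaleR_right]
      circle_smooth_has_vector_derivative)

lemma loops_add: "f \<in> loops \<Longrightarrow> g \<in> loops \<Longrightarrow> (\<lambda>\<theta>. f \<theta> + g \<theta>) \<in> loops"
  by (rule circle_smooth_add)

lemma loops_scaleR: "f \<in> loops \<Longrightarrow> (\<lambda>\<theta>. r *\<^sub>R f \<theta>) \<in> loops"
  by (intro circle_smooth_scaleR circle_smooth_const)

lemma integral_circle_add:
  fixes f g :: "real \<Rightarrow> real"
  assumes "f \<in> circle_smooth" "g \<in> circle_smooth" "\<And>\<theta>. u \<theta> = f \<theta> + g \<theta>"
  shows "integral {0..2 * pi} u = integral {0..2 * pi} f + integral {0..2 * pi} g"
  unfolding assms(3) by (intro integral_add circle_smooth_integrable assms(1,2))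

lemma integral_circle_mult:
  fixes f :: "real \<Rightarrow> real"
  assumes "\<And>\<theta>. u \<theta> = r * f \<theta>"
  shows "integral {0..2 * pi} u = r * integral {0..2 * pi} f"
  unfolding assms by simp

lemma Theta_integrand_circle_smooth:
  "c \<in> loops \<Longrightarrow> d \<in> loops \<Longrightarrow> h \<in> loops \<Longrightarrow> (\<lambda>\<theta>. cross3 (c \<theta>) (d \<theta>) \<bullet> h \<theta>) \<in> circle_smooth"
  by (intro circle_smooth_inner circle_smooth_cross3)

lemma len_deriv_integrand_circle_smooth:
  assumes "c \<in> Imm" "h \<in> loops"
  shows "(\<lambda>\<theta>. dtheta c \<theta> \<bullet> dtheta h \<theta> / norm (dtheta c \<theta>)) \<in> circle_smooth"
proof -
  have "(\<lambda>\<theta>. (dtheta c \<theta> \<bullet> dtheta h \<theta>) * (1 / norm (dtheta c \<theta>))) \<in> circle_smooth"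
    by (intro circle_smooth_mult circle_smooth_inner circle_smooth_inverse_pos speed_circle_smooth
        circle_smooth_dtheta Imm_loops assms) (simp add: Imm_dtheta_nonzero assms)
  then show ?thesis by simp
qed

lemma Theta_id_add:
  "c \<in> loops \<Longrightarrow> h \<in> loops \<Longrightarrow> k \<in> loops \<Longrightarrow> Theta_id c (\<lambda>\<theta>. h \<theta> + k \<theta>) = Theta_id c h + Theta_id c k"
  unfolding Theta_id_eq
  by (rule integral_circle_add) (simp_all add: Theta_integrand_circle_smooth circle_smooth_dtheta inner_add_right)

lemma Theta_id_scaleR: "Theta_id c (\<lambda>\<theta>. r *\<^sub>R h \<theta>) = r * Theta_id c h"
  unfolding Theta_id_eq by (rule integral_circle_mult) simp

lemma len_deriv_add:
  "c \<in> Imm \<Longrightarrow> h \<in> loops \<Longrightarrow> k \<in> loops \<Longrightarrow> len_deriv c (\<lambda>\<theta>. h \<theta> + k \<theta>) = len_deriv c h + len_deriv c k"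
  unfolding len_deriv_def
  by (rule integral_circle_add)
    (simp_all add: len_deriv_integrand_circle_smooth dtheta_add inner_add_right add_divide_distrib)

lemma len_deriv_scaleR: "h \<in> loops \<Longrightarrow> len_deriv c (\<lambda>\<theta>. r *\<^sub>R h \<theta>) = r * len_deriv c h"
  unfolding len_deriv_def by (rule integral_circle_mult) (simp add: dtheta_scaleR)

lemma det_form_add:
  "c \<in> loops \<Longrightarrow> h \<in> loops \<Longrightarrow> k \<in> loops \<Longrightarrow> m \<in> loops \<Longrightarrow>
    det_form c (\<lambda>\<theta>. h \<theta> + m \<theta>) k = det_form c h k + det_form c m k"
  unfolding det_form_def
  by (rule integral_circle_add)
    (simp_all add: Theta_integrand_circle_smooth circle_smooth_dtheta cross_add_right inner_add_left)

lemma det_form_scaleR: "det_form c (\<lambda>\<theta>. r *\<^sub>R h \<theta>) k = r * det_form c h k"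
  unfolding det_form_def by (rule integral_circle_mult) (simp add: cross_mult_right)

lemma det_form_alternating: "det_form c h k = - det_form c k h"
proof -
  have "det_form c h k = - 1 * det_form c k h"
    unfolding det_form_def by (rule integral_circle_mult) (metis cross_triple cross_skew inner_commute inner_minus_right mult_minus1)
  then show ?thesis by simp
qed

lemma triple_product_swap: "cross3 x y \<bullet> z = - (cross3 x z \<bullet> y)"
  by (metis cross_triple cross_skew inner_commute inner_minus_right)

lemma triple_product_has_vector_derivative:
  assumes "c \<in> loops" "h \<in> loops" "k \<in> loops"
  shows "((\<lambda>\<theta>. cross3 (c \<theta>) (h \<theta>) \<bullet> k \<theta>) has_vector_derivative
    cross3 (dtheta c \<theta>) (h \<theta>) \<bullet> k \<theta> + cross3 (c \<theta>) (dtheta h \<theta>) \<bullet> k \<theta> + cross3 (c \<theta>) (h \<theta>) \<bullet> dtheta k \<theta>) (at \<theta>)"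
  using has_vector_derivative_inner[OF has_vector_derivative_cross3[OF
      circle_smooth_has_vector_derivative[OF assms(1)] circle_smooth_has_vector_derivative[OF assms(2)]]
      circle_smooth_has_vector_derivative[OF assms(3)], of \<theta>]
  by (simp add: inner_add_left algebra_simps)

text \<open>The three terms add up to the integral of the derivative of det(h, k, m). Since
  \<open>det_form\<close> is linear in the base curve, this is the closedness of
  \<open>det_form\<close>.\<close>

lemma det_form_cyclic:
  assumes "h \<in> loops" "k \<in> loops" "m \<in> loops"
  shows "det_form h k m - det_form k h m + det_form m h k = 0"
proof -
  note d = assms assms[THEN circle_smooth_dtheta]
  have "integral {0..2 * pi} (\<lambda>\<theta>. cross3 (dtheta h \<theta>) (k \<theta>) \<bullet> m \<theta> +
      cross3 (h \<theta>) (dtheta k \<theta>) \<bullet> m \<theta> + cross3 (h \<theta>) (k \<theta>) \<bullet> dtheta m \<theta>) = 0"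
    by (rule integral_periodic_derivative[OF _ triple_product_has_vector_derivative])
      (intro Theta_integrand_circle_smooth assms)+
  also have "(\<lambda>\<theta>. cross3 (dtheta h \<theta>) (k \<theta>) \<bullet> m \<theta> +
      cross3 (h \<theta>) (dtheta k \<theta>) \<bullet> m \<theta> + cross3 (h \<theta>) (k \<theta>) \<bullet> dtheta m \<theta>) =
    (\<lambda>\<theta>. cross3 (dtheta h \<theta>) (k \<theta>) \<bullet> m \<theta> - cross3 (dtheta k \<theta>) (h \<theta>) \<bullet> m \<theta> + cross3 (dtheta m \<theta>) (h \<theta>) \<bullet> k \<theta>)"
    by (rule ext) (metis cross_skew cross_triple inner_minus_left diff_conv_add_uminus)
  also have "integral {0..2 * pi} \<dots> = det_form h k m - det_form k h m + det_form m h k"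
    unfolding det_form_def
    by (subst integral_add integral_diff,
        (intro integrable_add integrable_diff circle_smooth_integrable Theta_integrand_circle_smooth d)+)+ simp
  finally show ?thesis .
qed

text \<open>The origin of the factor 3: two copies of \<open>det_form\<close> appear directly in the
  antisymmetrisation, and a third one arises on moving the derivative off \<open>h\<close> and
  \<open>k\<close> by integrating that of det(c, h, k).\<close>

lemma Theta_deriv_skew:
  assumes "c \<in> loops" "h \<in> loops" "k \<in> loops"
  shows "Theta_deriv c h k - Theta_deriv c k h = - 3 * det_form c h k"
proof -
  note d = assms assms[THEN circle_smooth_dtheta]
  let ?D = "\<lambda>\<theta>. cross3 (dtheta c \<theta>) (h \<theta>) \<bullet> k \<theta> + cross3 (c \<theta>) (dtheta h \<theta>) \<bullet> k \<theta> + cross3 (c \<theta>) (h \<theta>) \<bullet> dtheta k \<theta>"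
  let ?f = "\<lambda>h k \<theta>. cross3 (c \<theta>) (dtheta h \<theta>) \<bullet> k \<theta> + cross3 (h \<theta>) (dtheta c \<theta>) \<bullet> k \<theta>"
  let ?g = "\<lambda>\<theta>. cross3 (dtheta c \<theta>) (h \<theta>) \<bullet> k \<theta>"
  have "integral {0..2 * pi} ?D = 0"
    by (rule integral_periodic_derivative[OF _ triple_product_has_vector_derivative])
      (intro Theta_integrand_circle_smooth assms)+
  also have "?D = (\<lambda>\<theta>. ?f h k \<theta> - ?f k h \<theta> + 3 * ?g \<theta>)"
  proof
    fix \<theta>
    have "cross3 (h \<theta>) (dtheta c \<theta>) \<bullet> k \<theta> = - ?g \<theta>"
      by (metis cross_skew inner_minus_left)
    moreover have "cross3 (k \<theta>) (dtheta c \<theta>) \<bullet> h \<theta> = ?g \<theta>"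
      by (metis cross_triple)
    moreover have "cross3 (c \<theta>) (dtheta k \<theta>) \<bullet> h \<theta> = - (cross3 (c \<theta>) (h \<theta>) \<bullet> dtheta k \<theta>)"
      by (rule triple_product_swap)
    ultimately show "?D \<theta> = ?f h k \<theta> - ?f k h \<theta> + 3 * ?g \<theta>" by simp
  qed
  also have "integral {0..2 * pi} (\<lambda>\<theta>. ?f h k \<theta> - ?f k h \<theta> + 3 * ?g \<theta>) =
      Theta_deriv c h k - Theta_deriv c k h + 3 * det_form c h k"
    unfolding Theta_deriv_def det_form_def
    by (intro integral_unique has_integral_add has_integral_diff has_integral_mult_right integrable_integral
        integrable_add circle_smooth_integrable Theta_integrand_circle_smooth d)
  finally show ?thesis by simp
qed

section \<open>Exterior derivatives and closedness\<close>

lemma dir_derivI: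
  assumes "((\<lambda>t. F (\<lambda>\<theta>. c \<theta> + t *\<^sub>R h \<theta>)) has_field_derivative D) (at 0)"
  shows "has_dir_deriv F c h" "dir_deriv F c h = D"
  using assms by (auto simp: has_dir_deriv_def dir_deriv_def field_differentiable_def intro: DERIV_imp_deriv)

lemma dir_deriv_curve_length: "c \<in> Imm \<Longrightarrow> h \<in> loops \<Longrightarrow> dir_deriv curve_length c h = len_deriv c h"
  by (rule dir_derivI(2)[OF curve_length_has_field_derivative])

lemma Omega_id_eq:
  assumes "c \<in> loops" "h \<in> loops" "k \<in> loops"
  shows "Omega_id c h k = 3 * det_form c h k"
proof -
  have "dir_deriv (\<lambda>c. Theta_id c k) c h = Theta_deriv c h k" if "h \<in> loops" "k \<in> loops" for h k
    by (rule dir_derivI(2)) (rule Theta_id_has_field_derivative[OF assms(1) that])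
  then show ?thesis
    using Theta_deriv_skew[OF assms] assms by (simp add: Omega_id_def ext_deriv_def)
qed

lemma smooth_on_DERIV:
  fixes f :: "real \<Rightarrow> real"
  assumes "smooth_on S f" "x \<in> S"
  shows "DERIV f x :> deriv f x"
proof -
  obtain D where "DERIV f x :> D"
    using smooth_on_has_vector_derivative(1)[OF assms] has_real_derivative_iff_has_vector_derivative by blast
  then show ?thesis using DERIV_imp_deriv by blast
qed

lemma smooth_on_deriv:
  fixes f :: "real \<Rightarrow> real"
  assumes "open S" "smooth_on S f"
  shows "smooth_on S (deriv f)"
proof -
  have "vector_derivative f (at x) = deriv f x" if "x \<in> S" for x
    using smooth_on_DERIV[OF assms(2) that] vector_derivative_at
      has_real_derivative_iff_has_vector_derivative by blast
  then show ?thesis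
    using smooth_on_vector_derivative[OF assms] smooth_on_cong[OF assms(1)] by (metis (no_types, lifting))
qed

text \<open>The explicit value of \<open>Omega_Phi\<close> at immersions and loops. The later
  algebra uses it in place of the exterior derivative, and \<open>Omega_Phi_eq\<close> carries the
  results over.\<close>

definition Phi_form :: "(real \<Rightarrow> real) \<Rightarrow> two_form" where
  "Phi_form \<Phi> c h k = 3 * \<Phi> (curve_length c) * det_form c h k -
     deriv \<Phi> (curve_length c) * (len_deriv c h * Theta_id c k - len_deriv c k * Theta_id c h)"

lemma compose_length_has_field_derivative:
  fixes \<Phi> :: "real \<Rightarrow> real"
  assumes "smooth_on {0<..} \<Phi>" "c \<in> Imm" "h \<in> loops"
  shows "((\<lambda>t. \<Phi> (curve_length (\<lambda>\<theta>. c \<theta> + t *\<^sub>R h \<theta>))) has_field_derivative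
    deriv \<Phi> (curve_length c) * len_deriv c h) (at 0)"
proof -
  have "DERIV \<Phi> (curve_length (\<lambda>\<theta>. c \<theta> + 0 *\<^sub>R h \<theta>)) :> deriv \<Phi> (curve_length c)"
    using smooth_on_DERIV[OF assms(1), of "curve_length c"] curve_length_pos[OF assms(2)] by simp
  from DERIV_chain2[OF this curve_length_has_field_derivative[OF assms(2,3)]] show ?thesis .
qed

lemma Phi_Theta_has_field_derivative:
  assumes "smooth_on {0<..} \<Phi>" "c \<in> Imm" "h \<in> loops" "k \<in> loops"
  shows "((\<lambda>t. \<Phi> (curve_length (\<lambda>\<theta>. c \<theta> + t *\<^sub>R h \<theta>)) * Theta_id (\<lambda>\<theta>. c \<theta> + t *\<^sub>R h \<theta>) k)
    has_field_derivative deriv \<Phi> (curve_length c) * len_deriv c h * Theta_id c k +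
      Theta_deriv c h k * \<Phi> (curve_length c)) (at 0)"
  using DERIV_mult[OF compose_length_has_field_derivative[OF assms(1-3)]
      Theta_id_has_field_derivative[OF Imm_loops[OF assms(2)] assms(3,4)]]
  by simp

lemma Omega_Phi_eq:
  assumes "smooth_on {0<..} \<Phi>" "c \<in> Imm" "h \<in> loops" "k \<in> loops"
  shows "Omega_Phi \<Phi> c h k = Phi_form \<Phi> c h k"
proof -
  have *: "dir_deriv (\<lambda>c. \<Phi> (curve_length c) * Theta_id c k) c h =
      deriv \<Phi> (curve_length c) * len_deriv c h * Theta_id c k + Theta_deriv c h k * \<Phi> (curve_length c)"
    if "h \<in> loops" "k \<in> loops" for h k
    by (rule dir_derivI(2)) (rule Phi_Theta_has_field_derivative[OF assms(1,2) that])
  have T: "Theta_deriv c h k = Theta_deriv c k h - 3 * det_form c h k"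
    using Theta_deriv_skew[OF Imm_loops[OF assms(2)] assms(3,4)] by simp
  show ?thesis
    unfolding Omega_Phi_def ext_deriv_def *[OF assms(3,4)] *[OF assms(4,3)] Phi_form_def T
    by (simp add: algebra_simps)
qed

lemma det_form_has_field_derivative:
  assumes "c \<in> loops" "h \<in> loops" "k \<in> loops" "m \<in> loops"
  shows "((\<lambda>t. det_form (\<lambda>\<theta>. c \<theta> + t *\<^sub>R h \<theta>) k m) has_field_derivative det_form h k m) (at 0)"
proof -
  have "det_form (\<lambda>\<theta>. c \<theta> + t *\<^sub>R h \<theta>) k m = det_form c k m + t * det_form h k m" for t
  proof -
    have "((\<lambda>\<theta>. cross3 (dtheta c \<theta>) (k \<theta>) \<bullet> m \<theta> + t * (cross3 (dtheta h \<theta>) (k \<theta>) \<bullet> m \<theta>)) has_integral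
        det_form c k m + t * det_form h k m) {0..2 * pi}"
      unfolding det_form_def
      by (intro has_integral_add has_integral_mult_right integrable_integral
        circle_smooth_integrable Theta_integrand_circle_smooth circle_smooth_dtheta assms)
    then show ?thesis
      by (simp add: det_form_def dtheta_line[OF assms(1,2)] cross_add_left cross_mult_left inner_add_left integral_unique)
  qed
  moreover have "((\<lambda>t. det_form c k m + t * det_form h k m) has_field_derivative det_form h k m) (at 0)"
    by (rule derivative_eq_intros refl | simp)+
  ultimately show ?thesis by (simp only:)
qed

lemma Phi_form_has_field_derivative:
  assumes s: "smooth_on {0<..} \<Phi>" and c: "c \<in> Imm" and h: "h \<in> loops" and k: "k \<in> loops" and m: "m \<in> loops"
  shows "((\<lambda>t. Phi_form \<Phi> (\<lambda>\<theta>. c \<theta> + t *\<^sub>R h \<theta>) k m) has_field_derivative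
    3 * (deriv \<Phi> (curve_length c) * len_deriv c h * det_form c k m + \<Phi> (curve_length c) * det_form h k m) -
    (deriv (deriv \<Phi>) (curve_length c) * len_deriv c h * (len_deriv c k * Theta_id c m - len_deriv c m * Theta_id c k) +
     deriv \<Phi> (curve_length c) *
       (len_deriv2 c h k * Theta_id c m + len_deriv c k * Theta_deriv c h m -
        (len_deriv2 c h m * Theta_id c k + len_deriv c m * Theta_deriv c h k)))) (at 0)"
proof -
  note l = Imm_loops[OF c]
  have s': "smooth_on {0<..} (deriv \<Phi>)" by (rule smooth_on_deriv[OF _ s]) simp
  note d = compose_length_has_field_derivative[OF s c h] compose_length_has_field_derivative[OF s' c h]
    det_form_has_field_derivative[OF l h k m]
    len_deriv_has_field_derivative[OF c h k] len_deriv_has_field_derivative[OF c h m]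
    Theta_id_has_field_derivative[OF l h k] Theta_id_has_field_derivative[OF l h m]
  show ?thesis
    unfolding Phi_form_def
    by (rule derivative_eq_intros d refl)+ (simp add: algebra_simps)
qed

lemma len_deriv2_commute: "len_deriv2 c h k = len_deriv2 c k h"
  by (simp add: len_deriv2_def inner_commute mult_ac)

text \<open>In the alternating sum the terms with \<Phi>'' cancel in pairs, those with
  \<open>len_deriv2\<close> cancel by its symmetry, and those with \<Phi> itself by
  \<open>det_form_cyclic\<close>. The remaining terms with \<Phi>' cancel because the skew part of
  \<open>Theta_deriv\<close> is -3 times \<open>det_form\<close>, which compensates the derivative
  of the factor \<Phi> in front of 3 \<open>det_form\<close>.\<close>

lemma closed_form_Omega_Phi:
  assumes s: "smooth_on {0<..} \<Phi>"
  shows "closed_form (Omega_Phi \<Phi>)"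
  unfolding closed_form_def
proof (intro ballI)
  fix c h k m assume a: "c \<in> Imm" "h \<in> loops" "k \<in> loops" "m \<in> loops"
  define D where "D h k m = 3 * (deriv \<Phi> (curve_length c) * len_deriv c h * det_form c k m + \<Phi> (curve_length c) * det_form h k m) -
    (deriv (deriv \<Phi>) (curve_length c) * len_deriv c h * (len_deriv c k * Theta_id c m - len_deriv c m * Theta_id c k) +
     deriv \<Phi> (curve_length c) *
       (len_deriv2 c h k * Theta_id c m + len_deriv c k * Theta_deriv c h m -
        (len_deriv2 c h m * Theta_id c k + len_deriv c m * Theta_deriv c h k)))" for h k m
  have der: "((\<lambda>t. Omega_Phi \<Phi> (\<lambda>\<theta>. c \<theta> + t *\<^sub>R h \<theta>) k m) has_field_derivative D h k m) (at 0)"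
    if h: "h \<in> loops" and k: "k \<in> loops" and m: "m \<in> loops" for h k m
  proof -
    obtain e where e: "e > 0" "\<And>t. \<bar>t\<bar> < e \<Longrightarrow> (\<lambda>\<theta>. c \<theta> + t *\<^sub>R h \<theta>) \<in> Imm"
      by (rule Imm_line[OF a(1) h]) (rule that)
    show ?thesis
    \<comment> \<open>The two forms are known to agree at immersions, that is for |t| < e, which
      suffices for the derivative at 0.\<close>
    proof (rule has_field_derivative_transform_within[OF _ e(1)])
      show "((\<lambda>t. Phi_form \<Phi> (\<lambda>\<theta>. c \<theta> + t *\<^sub>R h \<theta>) k m) has_field_derivative D h k m) (at 0)"
        unfolding D_def by (rule Phi_form_has_field_derivative[OF s a(1) h k m])
    qed (use Omega_Phi_eq[OF s e(2) k m] in auto)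
  qed
  note T = Theta_deriv_skew[OF Imm_loops[OF a(1)]]
  have 1: "Theta_deriv c k h = Theta_deriv c h k + 3 * det_form c h k"
    "Theta_deriv c m h = Theta_deriv c h m + 3 * det_form c h m"
    "Theta_deriv c m k = Theta_deriv c k m + 3 * det_form c k m"
    using T[OF a(2,3)] T[OF a(2,4)] T[OF a(3,4)] by simp_all
  have 2: "len_deriv2 c k h = len_deriv2 c h k" "len_deriv2 c m h = len_deriv2 c h m"
      "len_deriv2 c m k = len_deriv2 c k m"
    by (rule len_deriv2_commute)+
  have 3: "det_form h k m = det_form k h m - det_form m h k"
    using det_form_cyclic[OF a(2-4)] by simp
  have "D h k m - D k h m + D m h k = 0"
    unfolding D_def 1 2 3 by (simp add: algebra_simps)
  then show "has_dir_deriv (\<lambda>c. Omega_Phi \<Phi> c k m) c h \<and>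
     dir_deriv (\<lambda>c. Omega_Phi \<Phi> c k m) c h - dir_deriv (\<lambda>c. Omega_Phi \<Phi> c h m) c k +
       dir_deriv (\<lambda>c. Omega_Phi \<Phi> c h k) c m = 0"
    using dir_derivI[where F = "\<lambda>c. Omega_Phi \<Phi> c k m", OF der] dir_derivI(2)[where F = "\<lambda>c. Omega_Phi \<Phi> c h m", OF der]
      dir_derivI(2)[where F = "\<lambda>c. Omega_Phi \<Phi> c h k", OF der] a by simp
qed

section \<open>Invariance under reparametrization\<close>

lemma Imm_compose:
  assumes "c \<in> Imm" "\<phi> \<in> diff_plus" shows "c \<circ> \<phi> \<in> Imm"
proof -
  have "deriv \<phi> \<theta> > 0" for \<theta> using assms(2) by (simp add: diff_plus_def)
  then have "deriv \<phi> \<theta> \<noteq> 0" for \<theta> by (metis less_irrefl)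
  then show ?thesis
    using circle_smooth_compose[OF Imm_loops[OF assms(1)] assms(2)]
      dtheta_compose[OF Imm_loops[OF assms(1)] assms(2)] Imm_dtheta_nonzero[OF assms(1)]
    unfolding Imm_def by simp
qed

text \<open>Each integrand is homogeneous of degree one in the \<theta>-derivatives that occur in
  it, so composition with \<open>\<phi>\<close> produces exactly the one factor
  \<open>deriv \<phi>\<close> that the change of variables requires.\<close>

lemma forms_reparametrize:
  assumes c: "c \<in> Imm" and h: "h \<in> loops" and k: "k \<in> loops" and \<phi>: "\<phi> \<in> diff_plus"
  shows curve_length_reparametrize: "curve_length (c \<circ> \<phi>) = curve_length c"
    and Theta_id_reparametrize: "Theta_id (c \<circ> \<phi>) (h \<circ> \<phi>) = Theta_id c h"
    and len_deriv_reparametrize: "len_deriv (c \<circ> \<phi>) (h \<circ> \<phi>) = len_deriv c h"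
    and det_form_reparametrize: "det_form (c \<circ> \<phi>) (h \<circ> \<phi>) (k \<circ> \<phi>) = det_form c h k"
proof -
  note l = Imm_loops[OF c]
  have pos: "deriv \<phi> \<theta> > 0" for \<theta> using \<phi> by (simp add: diff_plus_def)
  note nz = less_imp_neq[OF pos, symmetric]
  note dt = dtheta_compose[OF l \<phi>] dtheta_compose[OF h \<phi>]
  have *: "integral {0..2 * pi} u = integral {0..2 * pi} f"
    if "f \<in> circle_smooth" "\<And>\<theta>. u \<theta> = f (\<phi> \<theta>) * deriv \<phi> \<theta>" for u f :: "real \<Rightarrow> real"
    unfolding that(2) by (rule integral_reparametrize[OF that(1) \<phi>])
  show "curve_length (c \<circ> \<phi>) = curve_length c"
    unfolding curve_length_def
    by (rule *[OF speed_circle_smooth[OF c]]) (simp add: dt abs_of_pos[OF pos] mult.commute)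
  show "Theta_id (c \<circ> \<phi>) (h \<circ> \<phi>) = Theta_id c h"
    unfolding Theta_id_eq
    by (rule *[OF Theta_integrand_circle_smooth[OF l circle_smooth_dtheta[OF l] h]])
      (simp add: dt cross_mult_right)
  show "len_deriv (c \<circ> \<phi>) (h \<circ> \<phi>) = len_deriv c h"
    unfolding len_deriv_def
    by (rule *[OF len_deriv_integrand_circle_smooth[OF c h]]) (simp add: dt abs_of_pos[OF pos] nz)
  show "det_form (c \<circ> \<phi>) (h \<circ> \<phi>) (k \<circ> \<phi>) = det_form c h k"
    unfolding det_form_def
    by (rule *[OF Theta_integrand_circle_smooth[OF circle_smooth_dtheta[OF l] h k]])
      (simp add: dt cross_mult_left)
qed

lemma Phi_form_reparametrize:
  assumes "c \<in> Imm" "h \<in> loops" "k \<in> loops" "\<phi> \<in> diff_plus"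
  shows "Phi_form \<Phi> (c \<circ> \<phi>) (h \<circ> \<phi>) (k \<circ> \<phi>) = Phi_form \<Phi> c h k"
  using forms_reparametrize[OF assms] forms_reparametrize[OF assms(1,3,2,4)]
  by (simp add: Phi_form_def)

section \<open>The kernels\<close>

text \<open>Curvature times the Frenet binormal, the velocity field of the vortex filament flow.
  Without normalisation it is smooth also where the curvature vanishes.\<close>

definition binormal :: "curve \<Rightarrow> curve" where
  "binormal c = (\<lambda>\<theta>. cross3 (Ds c c \<theta>) (Ds c (Ds c c) \<theta>))"

lemma binormal_loops: "c \<in> Imm \<Longrightarrow> binormal c \<in> loops"
  unfolding binormal_def by (intro circle_smooth_cross3 Ds_loops Imm_loops)

lemma inner_Ds_Ds: "c \<in> Imm \<Longrightarrow> Ds c c \<theta> \<bullet> Ds c c \<theta> = 1"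
  by (simp add: dot_square_norm norm_Ds)

lemma cross_tangent_binormal: "c \<in> Imm \<Longrightarrow> cross3 (Ds c c \<theta>) (binormal c \<theta>) = - Ds c (Ds c c) \<theta>"
  by (simp add: binormal_def Lagrange unit_tangent_orthogonal inner_Ds_Ds)

lemma VertI: "a \<in> circle_smooth \<Longrightarrow> (\<lambda>\<theta>. a \<theta> *\<^sub>R Ds c c \<theta>) \<in> Vert c"
  by (auto simp: Vert_def)

lemma VertE:
  assumes "v \<in> Vert c"
  obtains a where "a \<in> circle_smooth" "v = (\<lambda>\<theta>. a \<theta> *\<^sub>R Ds c c \<theta>)"
  using assms by (auto simp: Vert_def)

lemma Vert_loops: "c \<in> Imm \<Longrightarrow> v \<in> Vert c \<Longrightarrow> v \<in> loops"
  by (erule VertE) (simp add: circle_smooth_scaleR Ds_loops Imm_loops)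

lemma Vert_add:
  assumes "v \<in> Vert c" "w \<in> Vert c" shows "(\<lambda>\<theta>. v \<theta> + w \<theta>) \<in> Vert c"
proof -
  obtain a where a: "a \<in> circle_smooth" "v = (\<lambda>\<theta>. a \<theta> *\<^sub>R Ds c c \<theta>)" using assms(1) by (rule VertE)
  obtain b where b: "b \<in> circle_smooth" "w = (\<lambda>\<theta>. b \<theta> *\<^sub>R Ds c c \<theta>)" using assms(2) by (rule VertE)
  show ?thesis using VertI[OF circle_smooth_add[OF a(1) b(1)], of c] a(2) b(2) by (simp add: scaleR_add_left)
qed

lemma Vert_scaleR:
  assumes "v \<in> Vert c" shows "(\<lambda>\<theta>. r *\<^sub>R v \<theta>) \<in> Vert c"
proof -
  obtain a where a: "a \<in> circle_smooth" "v = (\<lambda>\<theta>. a \<theta> *\<^sub>R Ds c c \<theta>)" using assms(1) by (rule VertE)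
  show ?thesis using VertI[of "\<lambda>\<theta>. r * a \<theta>" c] circle_smooth_mult[OF circle_smooth_const a(1)] a(2) by simp
qed

lemma Vert_0: "(\<lambda>\<theta>. 0) \<in> Vert c"
  using VertI[OF circle_smooth_const[of "0::real"], of c] by simp

lemma det_form_Vert: "v \<in> Vert c \<Longrightarrow> det_form c v k = 0"
  by (erule VertE) (simp add: arc_integral_det_form[symmetric] cross_mult_right arc_integral_def)

lemma Theta_id_Vert: "v \<in> Vert c \<Longrightarrow> Theta_id c v = 0"
  by (erule VertE) (simp add: Theta_id_def dot_cross_self arc_integral_def)

lemma len_deriv_Vert:
  assumes "c \<in> Imm" "v \<in> Vert c" shows "len_deriv c v = 0"
proof -
  obtain a where "v = (\<lambda>\<theta>. a \<theta> *\<^sub>R Ds c c \<theta>)" using assms(2) by (rule VertE)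
  then have "v \<theta> \<bullet> Ds c (Ds c c) \<theta> = 0" for \<theta>
    by (simp add: unit_tangent_orthogonal[OF assms(1)])
  then show ?thesis
    by (simp add: len_deriv_by_parts[OF assms(1) Vert_loops[OF assms]] arc_integral_def)
qed

lemma len_deriv_binormal: "c \<in> Imm \<Longrightarrow> len_deriv c (binormal c) = 0"
  by (simp add: len_deriv_by_parts binormal_loops) (simp add: binormal_def dot_cross_self arc_integral_def)

lemma len_deriv_self: "c \<in> Imm \<Longrightarrow> len_deriv c c = curve_length c"
  by (simp add: len_deriv_def curve_length_def dot_square_norm power2_eq_square Imm_dtheta_nonzero)

lemma Theta_id_self: "Theta_id c c = 0"
  by (simp add: Theta_id_def dot_cross_self arc_integral_def)

text \<open>The identity for the inner product of two cross products reduces the integrand to minus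
  the pairing of \<open>c\<close> with its second arc length derivative. By parts this is the
  derivative of the length in direction \<open>c\<close>, and the length is homogeneous of degree
  one.\<close>

lemma Theta_id_binormal:
  assumes "c \<in> Imm" shows "Theta_id c (binormal c) = curve_length c"
proof -
  have "cross3 (c \<theta>) (Ds c c \<theta>) \<bullet> binormal c \<theta> = - (c \<theta> \<bullet> Ds c (Ds c c) \<theta>)" for \<theta>
    by (simp add: binormal_def dot_cross inner_Ds_Ds unit_tangent_orthogonal assms)
  then have "Theta_id c (binormal c) = len_deriv c c"
    by (simp add: Theta_id_def len_deriv_by_parts Imm_loops assms arc_integral_def)
  then show ?thesis by (simp add: len_deriv_self assms)
qed

lemma det_form_self: "det_form c c k = - Theta_id c k"
proof -
  have "det_form c c k = - 1 * Theta_id c k"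
    unfolding det_form_def Theta_id_eq
    by (rule integral_circle_mult) (metis cross_skew inner_minus_left mult_minus1)
  then show ?thesis by simp
qed

text \<open>The cross product of the unit tangent with the binormal field is minus the second arc
  length derivative, the density of the length gradient. So the binormal field is a Hamiltonian
  vector field of the length for \<open>det_form\<close>.\<close>

lemma det_form_binormal:
  assumes "c \<in> Imm" "k \<in> loops" shows "det_form c (binormal c) k = len_deriv c k"
  by (simp add: arc_integral_det_form[symmetric] cross_tangent_binormal len_deriv_by_parts assms
      arc_integral_def inner_commute)

text \<open>Vanishing of all pairings forces the cross product of the velocity with \<open>u\<close>
  to vanish pointwise. Lagrange's identity for the double cross product with the unit tangent then
  recovers \<open>u\<close> as a tangential field whose coefficient, the inner product with the
  tangent, is smooth and periodic.\<close>

lemma det_form_zero_iff: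
  assumes c: "c \<in> Imm" and u: "u \<in> loops"
  shows "(\<forall>k\<in>loops. det_form c u k = 0) \<longleftrightarrow> u \<in> Vert c"
proof
  assume *: "\<forall>k\<in>loops. det_form c u k = 0"
  let ?T = "Ds c c"
  note T = Ds_loops[OF c Imm_loops[OF c]]
  have "cross3 (dtheta c \<theta>) (u \<theta>) = 0" for \<theta>
  proof (rule loop_eq_0_of_pairing[of "\<lambda>\<theta>. cross3 (dtheta c \<theta>) (u \<theta>)"])
    show "(\<lambda>\<theta>. cross3 (dtheta c \<theta>) (u \<theta>)) \<in> loops"
      by (intro circle_smooth_cross3 circle_smooth_dtheta Imm_loops c u)
  qed (use * in \<open>simp add: det_form_def\<close>)
  then have "cross3 (?T \<theta>) (u \<theta>) = 0" for \<theta>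
    by (simp add: Ds_def cross_mult_left)
  then have "u \<theta> = (?T \<theta> \<bullet> u \<theta>) *\<^sub>R ?T \<theta>" for \<theta>
    using Lagrange[of "?T \<theta>" "?T \<theta>" "u \<theta>"] inner_Ds_Ds[OF c, of \<theta>] by simp
  then have "u = (\<lambda>\<theta>. (?T \<theta> \<bullet> u \<theta>) *\<^sub>R ?T \<theta>)" by blast
  then show "u \<in> Vert c" using VertI[OF circle_smooth_inner[OF T u], of c] by simp
qed (simp add: det_form_Vert)

lemma Phi_form_eq_det_form:
  assumes c: "c \<in> Imm" and h: "h \<in> loops" and k: "k \<in> loops"
  shows "Phi_form \<Phi> c h k = det_form c (\<lambda>\<theta>. (3 * \<Phi> (curve_length c)) *\<^sub>R h \<theta> +
    deriv \<Phi> (curve_length c) *\<^sub>R (len_deriv c h *\<^sub>R c \<theta> + Theta_id c h *\<^sub>R binormal c \<theta>)) k"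
  by (simp add: det_form_add det_form_scaleR det_form_self det_form_binormal loops_add loops_scaleR
      binormal_loops Imm_loops c h k Phi_form_def algebra_simps)

lemma Phi_form_alternating: "Phi_form \<Phi> c h k = - Phi_form \<Phi> c k h"
  using det_form_alternating[of c h k] by (simp add: Phi_form_def algebra_simps)

lemma Phi_form_zero_iff:
  assumes c: "c \<in> Imm" and h: "h \<in> loops"
  shows "(\<forall>k\<in>loops. Phi_form \<Phi> c h k = 0) \<longleftrightarrow>
    (\<lambda>\<theta>. (3 * \<Phi> (curve_length c)) *\<^sub>R h \<theta> +
      deriv \<Phi> (curve_length c) *\<^sub>R (len_deriv c h *\<^sub>R c \<theta> + Theta_id c h *\<^sub>R binormal c \<theta>)) \<in> Vert c"
  by (subst det_form_zero_iff[OF c, symmetric])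
    (simp_all add: Phi_form_eq_det_form[OF c h] loops_add loops_scaleR binormal_loops Imm_loops c h)

text \<open>The sum of \<open>Vert c\<close> and \<open>F_fib c\<close> with the explicit binormal
  field in place of \<open>hgrad\<close>, which keeps the definite description out of the kernel
  computation; \<open>vsum_Vert_F_fib\<close> identifies the two.\<close>

definition VF :: "curve \<Rightarrow> curve set" where
  "VF c = {(\<lambda>\<theta>. v \<theta> + (\<alpha> *\<^sub>R c \<theta> + \<beta> *\<^sub>R binormal c \<theta>)) | v \<alpha> \<beta>. v \<in> Vert c}"

lemma VFE:
  assumes "h \<in> VF c"
  obtains v \<alpha> \<beta> where "v \<in> Vert c" "h = (\<lambda>\<theta>. v \<theta> + (\<alpha> *\<^sub>R c \<theta> + \<beta> *\<^sub>R binormal c \<theta>))"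
  using assms by (auto simp: VF_def)

lemma VFI: "v \<in> Vert c \<Longrightarrow> (\<lambda>\<theta>. v \<theta> + (\<alpha> *\<^sub>R c \<theta> + \<beta> *\<^sub>R binormal c \<theta>)) \<in> VF c"
  unfolding VF_def by (intro CollectI exI[of _ v] exI[of _ \<alpha>] exI[of _ \<beta>] conjI refl)

lemma vsumI: "a \<in> A \<Longrightarrow> b \<in> B \<Longrightarrow> (\<lambda>\<theta>. a \<theta> + b \<theta>) \<in> vsum A B"
  unfolding vsum_def by (intro CollectI exI[of _ a] exI[of _ b] conjI refl)

text \<open>Up to the factor \<open>curve_length c\<close>, the covectors \<open>len_deriv c\<close>
  and \<open>Theta_id c\<close> are the coordinates dual to \<open>c\<close> and
  \<open>binormal c\<close> modulo vertical fields. All later statements about coefficients are read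
  off from here.\<close>

lemma VF_span:
  assumes "c \<in> Imm" "v \<in> Vert c" and h: "h = (\<lambda>\<theta>. v \<theta> + (\<alpha> *\<^sub>R c \<theta> + \<beta> *\<^sub>R binormal c \<theta>))"
  shows VF_span_loops: "h \<in> loops"
    and VF_span_len_deriv: "len_deriv c h = \<alpha> * curve_length c"
    and VF_span_Theta_id: "Theta_id c h = \<beta> * curve_length c"
  unfolding h using assms(1,2)
  by (simp_all add: loops_add loops_scaleR Vert_loops binormal_loops Imm_loops len_deriv_add len_deriv_scaleR
      len_deriv_Vert len_deriv_self len_deriv_binormal Theta_id_add Theta_id_scaleR Theta_id_Vert
      Theta_id_self Theta_id_binormal)

text \<open>
  Pairing the kernel equation \<open>3 \<Phi> h + \<Phi>' (d\<ell>(h) c + \<Theta>(h) X) \<in> Vert\<close>, \<open>X\<close> the binormal field, with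
  \<open>d\<ell>\<close> and with \<open>\<Theta>\<close> gives \<open>(3 \<Phi> + \<Phi>' \<ell>) d\<ell>(h) = 0 = (3 \<Phi> + \<Phi>' \<ell>) \<Theta>(h)\<close>, since
  \<open>d\<ell>(c) = \<ell> = \<Theta>(X)\<close> and \<open>d\<ell>(X) = 0 = \<Theta>(c)\<close>.
\<close>

lemma Phi_form_kernel:
  assumes c: "c \<in> Imm" and pos: "\<Phi> (curve_length c) > 0"
  shows Phi_form_kernel_generic:
      "curve_length c * deriv \<Phi> (curve_length c) + 3 * \<Phi> (curve_length c) \<noteq> 0 \<Longrightarrow>
       {h \<in> loops. \<forall>k\<in>loops. Phi_form \<Phi> c h k = 0} = Vert c"
    and Phi_form_kernel_contact:
      "curve_length c * deriv \<Phi> (curve_length c) + 3 * \<Phi> (curve_length c) = 0 \<Longrightarrow>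
       {h \<in> loops. \<forall>k\<in>loops. Phi_form \<Phi> c h k = 0} = VF c"
proof -
  let ?\<phi> = "\<Phi> (curve_length c)" and ?d = "deriv \<Phi> (curve_length c)" and ?l = "curve_length c"
  let ?X = "binormal c"
  note l = Imm_loops[OF c] and X = binormal_loops[OF c]
  \<comment> \<open>As 3 \<Phi> is positive, the kernel equation can be solved for \<open>h\<close>.
    Every kernel element thus lies in \<open>VF c\<close>, before any distinction of cases.\<close>
  have kerE: "\<exists>v\<in>Vert c. h = (\<lambda>\<theta>. v \<theta> + ((- ?d * len_deriv c h / (3 * ?\<phi>)) *\<^sub>R c \<theta> +
      (- ?d * Theta_id c h / (3 * ?\<phi>)) *\<^sub>R ?X \<theta>))"
    if h: "h \<in> loops" "\<forall>k\<in>loops. Phi_form \<Phi> c h k = 0" for h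
  proof -
    let ?w = "\<lambda>\<theta>. (3 * ?\<phi>) *\<^sub>R h \<theta> + ?d *\<^sub>R (len_deriv c h *\<^sub>R c \<theta> + Theta_id c h *\<^sub>R ?X \<theta>)"
    have "?w \<in> Vert c" using Phi_form_zero_iff[OF c h(1)] h(2) by blast
    then have "(\<lambda>\<theta>. (1 / (3 * ?\<phi>)) *\<^sub>R ?w \<theta>) \<in> Vert c" by (rule Vert_scaleR)
    moreover have "h \<theta> = (1 / (3 * ?\<phi>)) *\<^sub>R ?w \<theta> + ((- ?d * len_deriv c h / (3 * ?\<phi>)) *\<^sub>R c \<theta> +
      (- ?d * Theta_id c h / (3 * ?\<phi>)) *\<^sub>R ?X \<theta>)" for \<theta>
      using pos by (simp add: scaleR_add_right)
    then have "h = (\<lambda>\<theta>. (1 / (3 * ?\<phi>)) *\<^sub>R ?w \<theta> + ((- ?d * len_deriv c h / (3 * ?\<phi>)) *\<^sub>R c \<theta> +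
      (- ?d * Theta_id c h / (3 * ?\<phi>)) *\<^sub>R ?X \<theta>))" by (rule ext)
    ultimately show ?thesis by (intro bexI)
  qed
  have Vker: "v \<in> loops \<and> (\<forall>k\<in>loops. Phi_form \<Phi> c v k = 0)" if "v \<in> Vert c" for v
    using that Phi_form_zero_iff[OF c Vert_loops[OF c that], of \<Phi>]
    by (simp add: len_deriv_Vert[OF c] Theta_id_Vert Vert_scaleR Vert_loops[OF c])
  show "{h \<in> loops. \<forall>k\<in>loops. Phi_form \<Phi> c h k = 0} = Vert c" if nz: "?l * ?d + 3 * ?\<phi> \<noteq> 0"
  proof (intro equalityI subsetI)
    fix h assume "h \<in> {h \<in> loops. \<forall>k\<in>loops. Phi_form \<Phi> c h k = 0}"
    then obtain v where v: "v \<in> Vert c" "h = (\<lambda>\<theta>. v \<theta> + ((- ?d * len_deriv c h / (3 * ?\<phi>)) *\<^sub>R c \<theta> +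
      (- ?d * Theta_id c h / (3 * ?\<phi>)) *\<^sub>R ?X \<theta>))" using kerE by blast
    have "len_deriv c h = - ?d * len_deriv c h / (3 * ?\<phi>) * ?l"
      by (rule VF_span_len_deriv[OF c v])
    then have "(?l * ?d + 3 * ?\<phi>) * len_deriv c h = 0" using pos by (simp add: field_simps)
    moreover have "Theta_id c h = - ?d * Theta_id c h / (3 * ?\<phi>) * ?l"
      by (rule VF_span_Theta_id[OF c v])
    then have "(?l * ?d + 3 * ?\<phi>) * Theta_id c h = 0" using pos by (simp add: field_simps)
    ultimately have "len_deriv c h = 0" "Theta_id c h = 0" using nz by simp_all
    then have "h = v" using v(2) by simp
    then show "h \<in> Vert c" using v(1) by simp
  qed (use Vker in blast)
  show "{h \<in> loops. \<forall>k\<in>loops. Phi_form \<Phi> c h k = 0} = VF c" if z: "?l * ?d + 3 * ?\<phi> = 0"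
  proof (intro equalityI subsetI)
    fix h assume "h \<in> {h \<in> loops. \<forall>k\<in>loops. Phi_form \<Phi> c h k = 0}"
    then obtain v where v: "v \<in> Vert c" and hv: "h = (\<lambda>\<theta>. v \<theta> + ((- ?d * len_deriv c h / (3 * ?\<phi>)) *\<^sub>R c \<theta> +
      (- ?d * Theta_id c h / (3 * ?\<phi>)) *\<^sub>R ?X \<theta>))" using kerE by blast
    show "h \<in> VF c" by (subst hv) (rule VFI[OF v])
  next
    fix h assume "h \<in> VF c"
    then obtain v \<alpha> \<beta> where v: "v \<in> Vert c" and h: "h = (\<lambda>\<theta>. v \<theta> + (\<alpha> *\<^sub>R c \<theta> + \<beta> *\<^sub>R ?X \<theta>))"
      by (rule VFE)
    note hs = VF_span[OF c v h]
    \<comment> \<open>In the contact case the correction term is exactly -3 \<Phi> times the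
      non-vertical part of \<open>h\<close>, so only the vertical part of 3 \<Phi> h
      survives.\<close>
    have z': "?d * ?l = - 3 * ?\<phi>" using z by (simp add: mult.commute)
    have "(\<lambda>\<theta>. (3 * ?\<phi>) *\<^sub>R h \<theta> + ?d *\<^sub>R (len_deriv c h *\<^sub>R c \<theta> + Theta_id c h *\<^sub>R ?X \<theta>)) =
        (\<lambda>\<theta>. (3 * ?\<phi>) *\<^sub>R v \<theta>)"
    proof
      fix \<theta>
      have "?d *\<^sub>R (len_deriv c h *\<^sub>R c \<theta> + Theta_id c h *\<^sub>R ?X \<theta>) =
          (?d * ?l) *\<^sub>R (\<alpha> *\<^sub>R c \<theta> + \<beta> *\<^sub>R ?X \<theta>)"
        by (simp add: hs scaleR_add_right mult_ac)
      then show "(3 * ?\<phi>) *\<^sub>R h \<theta> + ?d *\<^sub>R (len_deriv c h *\<^sub>R c \<theta> + Theta_id c h *\<^sub>R ?X \<theta>) = (3 * ?\<phi>) *\<^sub>R v \<theta>"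
        unfolding z' by (simp add: h scaleR_add_right)
    qed
    then have "(\<lambda>\<theta>. (3 * ?\<phi>) *\<^sub>R h \<theta> + ?d *\<^sub>R (len_deriv c h *\<^sub>R c \<theta> + Theta_id c h *\<^sub>R ?X \<theta>)) \<in> Vert c"
      using Vert_scaleR[OF v] by simp
    then show "h \<in> {h \<in> loops. \<forall>k\<in>loops. Phi_form \<Phi> c h k = 0}"
      using Phi_form_zero_iff[OF c hs(1), of \<Phi>] hs(1) by blast
  qed
qed

text \<open>The curve \<open>c\<close> itself separates the two: the differential of the length is
  positive on it but vanishes on \<open>Vert c\<close>. This turns the case distinction for the
  kernel into an equivalence.\<close>

lemma VF_neq_Vert: "c \<in> Imm \<Longrightarrow> VF c \<noteq> Vert c"
proof
  assume c: "c \<in> Imm" "VF c = Vert c"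
  have "(\<lambda>\<theta>. 0 + (1 *\<^sub>R c \<theta> + 0 *\<^sub>R binormal c \<theta>)) \<in> VF c"
    by (rule VFI[OF Vert_0])
  then have "c \<in> Vert c" using c(2) by simp
  then show False using len_deriv_Vert[OF c(1)] len_deriv_self[OF c(1)] curve_length_pos[OF c(1)] by auto
qed

section \<open>The distributions\<close>

text \<open>The binormal field is one lift of the gradient by \<open>det_form_binormal\<close>, and
  two lifts differ by an element of the kernel of \<open>det_form\<close>, which is
  vertical.\<close>

lemma grad_lifts_MW_iff:
  assumes c: "c \<in> Imm"
  shows "Y \<in> grad_lifts Omega_MW curve_length c \<longleftrightarrow> Y \<in> loops \<and> (\<lambda>\<theta>. Y \<theta> + (- 1) *\<^sub>R binormal c \<theta>) \<in> Vert c"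
proof -
  have "det_form c (\<lambda>\<theta>. Y \<theta> + (- 1) *\<^sub>R binormal c \<theta>) k = Omega_MW c Y k - dir_deriv curve_length c k"
    if "Y \<in> loops" "k \<in> loops" for k
    using that c
    by (simp only: det_form_add det_form_scaleR Imm_loops loops_scaleR binormal_loops det_form_binormal
        Omega_MW_def Omega_id_eq dir_deriv_curve_length)
  then show ?thesis
    using det_form_zero_iff[OF c loops_add[OF _ loops_scaleR[OF binormal_loops[OF c]]], of Y "- 1"]
    by (auto simp: grad_lifts_def)
qed

text \<open>As for the Marsden-Weinstein form; \<open>Omega_id\<close> is three times
  \<open>det_form\<close>, so the gradient is one third of the binormal field.\<close>

lemma grad_lifts_id_iff:
  assumes c: "c \<in> Imm"
  shows "Y \<in> grad_lifts Omega_id curve_length c \<longleftrightarrow> Y \<in> loops \<and> (\<lambda>\<theta>. Y \<theta> + (- 1 / 3) *\<^sub>R binormal c \<theta>) \<in> Vert c"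
proof -
  have *: "3 * det_form c (\<lambda>\<theta>. Y \<theta> + (- 1 / 3) *\<^sub>R binormal c \<theta>) k = Omega_id c Y k - dir_deriv curve_length c k"
    if "Y \<in> loops" "k \<in> loops" for k
    using that c
    by (simp only: det_form_add det_form_scaleR Imm_loops loops_scaleR binormal_loops det_form_binormal
        Omega_id_eq dir_deriv_curve_length) simp
  have "(\<forall>k\<in>loops. Omega_id c Y k = dir_deriv curve_length c k) \<longleftrightarrow>
      (\<forall>k\<in>loops. det_form c (\<lambda>\<theta>. Y \<theta> + (- 1 / 3) *\<^sub>R binormal c \<theta>) k = 0)" if "Y \<in> loops"
  proof (intro ball_cong refl)
    fix k :: curve assume k: "k \<in> loops"
    show "(Omega_id c Y k = dir_deriv curve_length c k) \<longleftrightarrow>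
        (det_form c (\<lambda>\<theta>. Y \<theta> + (- 1 / 3) *\<^sub>R binormal c \<theta>) k = 0)"
      unfolding eq_iff_diff_eq_0[of "Omega_id c Y k"] *[OF that k, symmetric] by simp
  qed
  then show ?thesis
    using det_form_zero_iff[OF c loops_add[OF _ loops_scaleR[OF binormal_loops[OF c]]], of Y "- 1 / 3"]
    by (auto simp: grad_lifts_def)
qed

lemma is_hgrad_binormal:
  assumes c: "c \<in> Imm"
  shows "is_hgrad Omega_MW curve_length c (binormal c)"
  using Vert_0[of c]
  by (simp add: is_hgrad_def grad_lifts_MW_iff[OF c] binormal_loops[OF c])
    (simp add: binormal_def dot_cross_self)

text \<open>Two lifts differ by a tangential field; if both are orthogonal to the tangent, its
  coefficient vanishes. This uniqueness justifies the definite description in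
  \<open>hgrad\<close>.\<close>

lemma hgrad_eq_binormal:
  assumes c: "c \<in> Imm"
  shows "hgrad Omega_MW curve_length c = binormal c"
  unfolding hgrad_def
proof (rule the_equality)
  show "is_hgrad Omega_MW curve_length c (binormal c)" by (rule is_hgrad_binormal[OF c])
next
  fix Y assume Y: "is_hgrad Omega_MW curve_length c Y"
  then obtain a where a: "(\<lambda>\<theta>. Y \<theta> + (- 1) *\<^sub>R binormal c \<theta>) = (\<lambda>\<theta>. a \<theta> *\<^sub>R Ds c c \<theta>)"
    unfolding is_hgrad_def grad_lifts_MW_iff[OF c] by (auto elim: VertE)
  have "Y \<theta> = binormal c \<theta>" for \<theta>
  proof -
    have e: "Y \<theta> + (- 1) *\<^sub>R binormal c \<theta> = a \<theta> *\<^sub>R Ds c c \<theta>" using fun_cong[OF a] .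
    have "Y \<theta> \<bullet> Ds c c \<theta> = 0" "binormal c \<theta> \<bullet> Ds c c \<theta> = 0"
      using Y is_hgrad_binormal[OF c] by (simp_all add: is_hgrad_def)
    then have "(Y \<theta> + (- 1) *\<^sub>R binormal c \<theta>) \<bullet> Ds c c \<theta> = 0" by (simp add: inner_diff_left)
    then have "a \<theta> = 0" unfolding e by (simp add: inner_Ds_Ds[OF c])
    then show ?thesis using e by simp
  qed
  then show "Y = binormal c" by blast
qed

lemma vsum_Vert_F_fib:
  assumes c: "c \<in> Imm" shows "vsum (Vert c) (F_fib c) = VF c"
proof (intro equalityI subsetI)
  fix h assume "h \<in> vsum (Vert c) (F_fib c)"
  then obtain v f where v: "v \<in> Vert c" and f: "f \<in> F_fib c" and h: "h = (\<lambda>\<theta>. v \<theta> + f \<theta>)"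
    unfolding vsum_def by blast
  obtain \<alpha> \<beta> where "f = (\<lambda>\<theta>. \<alpha> *\<^sub>R c \<theta> + \<beta> *\<^sub>R binormal c \<theta>)"
    using f unfolding F_fib_def hgrad_eq_binormal[OF c] by blast
  then show "h \<in> VF c" using VFI[OF v] h by simp
next
  fix h assume "h \<in> VF c"
  then obtain v \<alpha> \<beta> where v: "v \<in> Vert c" and h: "h = (\<lambda>\<theta>. v \<theta> + (\<alpha> *\<^sub>R c \<theta> + \<beta> *\<^sub>R binormal c \<theta>))"
    by (rule VFE)
  have "(\<lambda>\<theta>. \<alpha> *\<^sub>R c \<theta> + \<beta> *\<^sub>R binormal c \<theta>) \<in> F_fib c"
    unfolding F_fib_def hgrad_eq_binormal[OF c] by blast
  then show "h \<in> vsum (Vert c) (F_fib c)" unfolding h by (rule vsumI[OF v])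
qed

lemma grad_length_span_eq:
  assumes c: "c \<in> Imm"
  shows "grad_length_span c = {(\<lambda>\<theta>. v \<theta> + \<beta> *\<^sub>R binormal c \<theta>) | v \<beta>. v \<in> Vert c}"
proof (intro equalityI subsetI)
  fix h assume "h \<in> grad_length_span c"
  then obtain v r Y where v: "v \<in> Vert c" and Y: "Y \<in> grad_lifts Omega_id curve_length c"
      and h: "h = (\<lambda>\<theta>. v \<theta> + r *\<^sub>R Y \<theta>)"
    unfolding grad_length_span_def vsum_def by blast
  have "(\<lambda>\<theta>. v \<theta> + r *\<^sub>R (Y \<theta> + (- 1 / 3) *\<^sub>R binormal c \<theta>)) \<in> Vert c" (is "?w \<in> _")
    using Y unfolding grad_lifts_id_iff[OF c] by (intro Vert_add[OF v] Vert_scaleR) blast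
  moreover have "h = (\<lambda>\<theta>. ?w \<theta> + (r / 3) *\<^sub>R binormal c \<theta>)"
    unfolding h by (rule ext) (simp add: scaleR_right_diff_distrib)
  ultimately show "h \<in> {(\<lambda>\<theta>. v \<theta> + \<beta> *\<^sub>R binormal c \<theta>) | v \<beta>. v \<in> Vert c}"
    by (intro CollectI exI[of _ ?w] exI[of _ "r / 3"] conjI)
next
  fix h assume "h \<in> {(\<lambda>\<theta>. v \<theta> + \<beta> *\<^sub>R binormal c \<theta>) | v \<beta>. v \<in> Vert c}"
  then obtain v \<beta> where v: "v \<in> Vert c" and h: "h = (\<lambda>\<theta>. v \<theta> + \<beta> *\<^sub>R binormal c \<theta>)" by blast
  let ?Y = "\<lambda>\<theta>. (1 / 3) *\<^sub>R binormal c \<theta>"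
  have Y: "?Y \<in> grad_lifts Omega_id curve_length c"
    using Vert_0[of c] by (simp add: grad_lifts_id_iff[OF c] loops_scaleR[OF binormal_loops[OF c]])
  have h': "h = (\<lambda>\<theta>. v \<theta> + (3 * \<beta>) *\<^sub>R ?Y \<theta>)" unfolding h by simp
  show "h \<in> grad_length_span c"
    unfolding grad_length_span_def h'
    by (intro vsumI[OF v] CollectI exI[of _ "3 * \<beta>"] exI[of _ ?Y] conjI refl Y)
qed

lemma T_Imm1_iff: "c \<in> Imm \<Longrightarrow> h \<in> T_Imm1 c \<longleftrightarrow> h \<in> loops \<and> len_deriv c h = 0"
  by (auto simp: T_Imm1_def dir_deriv_curve_length)

text \<open>The differential of the length reads off the coefficient of the scaling field, so
  tangency to the level set removes exactly that direction.\<close>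

lemma T_Imm1_inter_VF:
  assumes c: "c \<in> Imm"
  shows "T_Imm1 c \<inter> VF c = grad_length_span c"
proof (intro equalityI subsetI)
  fix h assume "h \<in> T_Imm1 c \<inter> VF c"
  then have t: "h \<in> T_Imm1 c" and "h \<in> VF c" by auto
  then obtain v \<alpha> \<beta> where v: "v \<in> Vert c" and h: "h = (\<lambda>\<theta>. v \<theta> + (\<alpha> *\<^sub>R c \<theta> + \<beta> *\<^sub>R binormal c \<theta>))"
    by (elim VFE)
  have "\<alpha> = 0"
    using t VF_span_len_deriv[OF c v h] curve_length_pos[OF c] by (simp add: T_Imm1_iff[OF c])
  then show "h \<in> grad_length_span c" unfolding grad_length_span_eq[OF c] h using v by auto
next
  fix h assume "h \<in> grad_length_span c"
  then obtain v \<beta> where v: "v \<in> Vert c" and h: "h = (\<lambda>\<theta>. v \<theta> + (0 *\<^sub>R c \<theta> + \<beta> *\<^sub>R binormal c \<theta>))"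
    unfolding grad_length_span_eq[OF c] by auto
  show "h \<in> T_Imm1 c \<inter> VF c"
    using VF_span[OF c v h] VFI[OF v, of 0 \<beta>, folded h] by (simp add: T_Imm1_iff[OF c])
qed

lemma loops_eq_T_Imm1_VF:
  assumes c: "c \<in> Imm"
  shows "loops = vsum (T_Imm1 c) (VF c)"
proof (intro equalityI subsetI)
  fix h :: curve assume h: "h \<in> loops"
  \<comment> \<open>The length derivative of \<open>c\<close> in direction \<open>c\<close> is the
    length itself, so subtracting this multiple of the scaling field makes \<open>h\<close> tangent
    to the level set.\<close>
  define r where "r = len_deriv c h / curve_length c"
  have "(\<lambda>\<theta>. h \<theta> + (- r) *\<^sub>R c \<theta>) \<in> T_Imm1 c" (is "?t \<in> _")
    using curve_length_pos[OF c] unfolding T_Imm1_iff[OF c]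
    by (simp only: len_deriv_add len_deriv_scaleR loops_add loops_scaleR Imm_loops c h len_deriv_self)
      (simp add: r_def)
  moreover have "(\<lambda>\<theta>. 0 + (r *\<^sub>R c \<theta> + 0 *\<^sub>R binormal c \<theta>)) \<in> VF c" (is "?f \<in> _")
    by (rule VFI[OF Vert_0])
  ultimately have "(\<lambda>\<theta>. ?t \<theta> + ?f \<theta>) \<in> vsum (T_Imm1 c) (VF c)" by (rule vsumI)
  then show "h \<in> vsum (T_Imm1 c) (VF c)" by simp
next
  fix h assume "h \<in> vsum (T_Imm1 c) (VF c)"
  then obtain t f where t: "t \<in> loops" "f \<in> VF c" "h = (\<lambda>\<theta>. t \<theta> + f \<theta>)"
    by (auto simp: vsum_def T_Imm1_def)
  have "f \<in> loops" by (rule VFE[OF t(2)]) (rule VF_span_loops[OF c])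
  then show "h \<in> loops" using t loops_add by simp
qed

text \<open>Level set directions together with the kernel span the whole tangent space. A tangent
  vector annihilating all level set directions therefore annihilates everything, and the radical is
  the kernel intersected with the tangent space of the level set.\<close>

lemma Phi_form_radical:
  assumes c: "c \<in> Imm" and ker: "{h \<in> loops. \<forall>k\<in>loops. Phi_form \<Phi> c h k = 0} = VF c"
  shows "{h \<in> T_Imm1 c. \<forall>k\<in>T_Imm1 c. Phi_form \<Phi> c h k = 0} = grad_length_span c"
proof -
  have TL: "h \<in> loops" if "h \<in> T_Imm1 c" for h using that T_Imm1_iff[OF c] by blast
  have "\<forall>k\<in>loops. Phi_form \<Phi> c h k = 0"
    if h: "h \<in> T_Imm1 c" and z: "\<forall>k\<in>T_Imm1 c. Phi_form \<Phi> c h k = 0" for h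
  proof
    fix k :: curve assume "k \<in> loops"
    then obtain t f where t: "t \<in> T_Imm1 c" and f: "f \<in> VF c" and k: "k = (\<lambda>\<theta>. t \<theta> + f \<theta>)"
      using loops_eq_T_Imm1_VF[OF c] unfolding vsum_def by blast
    have fl: "f \<in> loops" and "Phi_form \<Phi> c f h = 0" using f ker TL[OF h] by blast+
    then have "Phi_form \<Phi> c h f = 0" using Phi_form_alternating[of \<Phi> c h f] by simp
    moreover have "Phi_form \<Phi> c t h = 0" using z t Phi_form_alternating[of \<Phi> c t h] by auto
    moreover have "Phi_form \<Phi> c k h = Phi_form \<Phi> c t h + Phi_form \<Phi> c f h"
      unfolding k Phi_form_def using TL[OF t] TL[OF h] fl c
      by (simp add: det_form_add len_deriv_add Theta_id_add Imm_loops algebra_simps)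
    ultimately show "Phi_form \<Phi> c h k = 0" using \<open>Phi_form \<Phi> c f h = 0\<close> Phi_form_alternating[of \<Phi> c h k] by simp
  qed
  then have "{h \<in> T_Imm1 c. \<forall>k\<in>T_Imm1 c. Phi_form \<Phi> c h k = 0} = T_Imm1 c \<inter> VF c"
    unfolding ker[symmetric] using TL by blast
  then show ?thesis by (simp add: T_Imm1_inter_VF[OF c])
qed

section \<open>Contact with the cubic factor\<close>

text \<open>The value at r forces C = r^3 \<Phi>(r); the condition on the derivative then becomes
  the vanishing of the scalar that governs the kernel.\<close>

lemma cubic_contact_iff:
  assumes "r > 0"
  shows "cubic_contact \<Phi> r \<longleftrightarrow> r * deriv \<Phi> r + 3 * \<Phi> r = 0"
proof -
  have d: "deriv (\<lambda>l. C / l ^ 3) r = - 3 * C / r ^ 4" for C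
    by (rule DERIV_imp_deriv) (use assms in \<open>auto intro!: derivative_eq_intros simp: field_simps power_numeral_reduce\<close>)
  show ?thesis
  proof
    assume "cubic_contact \<Phi> r"
    then obtain C where C: "\<Phi> r = C / r ^ 3" "deriv \<Phi> r = - 3 * C / r ^ 4"
      unfolding cubic_contact_def d by blast
    show "r * deriv \<Phi> r + 3 * \<Phi> r = 0"
      unfolding C using assms by (simp add: field_simps power_numeral_reduce)
  next
    assume *: "r * deriv \<Phi> r + 3 * \<Phi> r = 0"
    have "\<Phi> r = \<Phi> r * r ^ 3 / r ^ 3" using assms by simp
    moreover have "deriv \<Phi> r = - 3 * (\<Phi> r * r ^ 3) / r ^ 4"
      using * assms by (simp add: field_simps power_numeral_reduce)
    ultimately show "cubic_contact \<Phi> r" unfolding cubic_contact_def d by blast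
  qed
qed

text \<open>Contact at r means that the derivative of r^3 \<Phi>(r) vanishes there. In
  contrapositive form this supplies a contact-free length whenever \<Phi> is not a cubic
  factor.\<close>

lemma cubic_if_contact:
  assumes s: "smooth_on {0<..} \<Phi>" and c: "\<And>r. r > 0 \<Longrightarrow> cubic_contact \<Phi> r"
  shows "\<exists>C. \<forall>r>0. \<Phi> r = C / r ^ 3"
proof -
  have "((\<lambda>r. r ^ 3 * \<Phi> r) has_field_derivative 0) (at r within {0<..})" if "r \<in> {0<..}" for r
  proof (rule has_field_derivative_at_within)
    have "((\<lambda>r. r ^ 3 * \<Phi> r) has_field_derivative 3 * r ^ 2 * \<Phi> r + deriv \<Phi> r * r ^ 3) (at r)"
      by (rule derivative_eq_intros smooth_on_DERIV[OF s that] refl | simp)+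
    moreover have "3 * r ^ 2 * \<Phi> r + deriv \<Phi> r * r ^ 3 = r ^ 2 * (r * deriv \<Phi> r + 3 * \<Phi> r)"
      by (simp add: algebra_simps power_numeral_reduce)
    ultimately show "((\<lambda>r. r ^ 3 * \<Phi> r) has_field_derivative 0) (at r)"
      using cubic_contact_iff c that by simp
  qed
  then obtain C where "\<And>r. r \<in> {0<..} \<Longrightarrow> r ^ 3 * \<Phi> r = C"
    using has_field_derivative_zero_constant[of "{0<..}" "\<lambda>r. r ^ 3 * \<Phi> r"] by auto
  then have "\<forall>r>0. \<Phi> r = C / r ^ 3" by (auto simp: field_simps)
  then show ?thesis ..
qed

lemma open_not_cubic_contact:
  assumes s: "smooth_on {0<..} \<Phi>"
  shows "open {r. r > 0 \<and> \<not> cubic_contact \<Phi> r}"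
proof -
  have "continuous_on {0<..} (\<lambda>r. r * deriv \<Phi> r + 3 * \<Phi> r)"
    by (intro continuous_intros smooth_on_imp_continuous_on smooth_on_deriv s)
  then have "open ({0<..} \<inter> (\<lambda>r. r * deriv \<Phi> r + 3 * \<Phi> r) -` (- {0}))"
    by (rule continuous_open_preimage[of "{0<..}"]) auto
  also have "{0<..} \<inter> (\<lambda>r. r * deriv \<Phi> r + 3 * \<Phi> r) -` (- {0}) = {r. r > 0 \<and> \<not> cubic_contact \<Phi> r}"
    using cubic_contact_iff by auto
  finally show ?thesis .
qed

text \<open>A planar round circle of radius \<open>r / (2 * pi)\<close>. Through it a contact-free
  length is realised by an actual curve.\<close>

lemma exists_Imm_length:
  assumes "r > 0"
  obtains c where "c \<in> Imm" "curve_length c = r"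
proof -
  define R where "R = r / (2 * pi)"
  have R: "R > 0" using assms by (simp add: R_def)
  let ?a = "R *\<^sub>R axis 1 1 :: real^3" and ?b = "R *\<^sub>R axis 2 1 :: real^3"
  let ?c = "\<lambda>\<theta>. cos \<theta> *\<^sub>R ?a + sin \<theta> *\<^sub>R ?b"
  \<comment> \<open>The sine is entered as a shifted cosine in order to apply
    \<open>smooth_on_cos\<close>.\<close>
  have "smooth_on UNIV (\<lambda>\<theta>. cos (\<theta> + 0) *\<^sub>R ?a + cos (\<theta> + - pi / 2) *\<^sub>R ?b)"
    by (intro smooth_on_add smooth_on_scaleR smooth_on_const smooth_on_cos open_UNIV)
  moreover have "cos (\<theta> + - pi / 2) = sin \<theta>" for \<theta> by (simp add: sin_cos_eq cos_minus[of "\<theta> - pi / 2", symmetric])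
  ultimately have l: "?c \<in> loops" by (simp add: circle_smooth_def)
  have d: "dtheta ?c \<theta> = (- sin \<theta>) *\<^sub>R ?a + cos \<theta> *\<^sub>R ?b" for \<theta>
    by (rule vector_derivative_at) (rule derivative_eq_intros refl | simp)+
  have n: "norm (dtheta ?c \<theta>) = R" for \<theta>
  proof -
    have "dtheta ?c \<theta> \<bullet> dtheta ?c \<theta> = R * (R * (cos \<theta> * cos \<theta>)) + R * (R * (sin \<theta> * sin \<theta>))"
      unfolding d by (simp add: inner_add_left inner_add_right inner_axis_axis algebra_simps)
    also have "\<dots> = R\<^sup>2 * ((cos \<theta>)\<^sup>2 + (sin \<theta>)\<^sup>2)"
      by (simp only: power2_eq_square distrib_left mult.assoc)
    finally have "dtheta ?c \<theta> \<bullet> dtheta ?c \<theta> = R\<^sup>2" by simp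
    then show ?thesis using R by (simp add: norm_eq_sqrt_inner)
  qed
  have "dtheta ?c \<theta> \<noteq> 0" for \<theta> using n[of \<theta>] R by (metis norm_zero less_irrefl)
  then have "?c \<in> Imm" using l unfolding Imm_def by blast
  moreover have "curve_length ?c = r" unfolding curve_length_def n by (simp add: R_def)
  ultimately show thesis by (rule that)
qed

text \<open>The unit tangent is invariant under scaling, so the vertical spaces agree. One further
  arc length derivative contributes the factor 1 / r in the binormal field.\<close>

lemma scaled_curve:
  assumes c: "c \<in> Imm" and r: "r > 0"
  shows scaled_Imm: "(\<lambda>\<theta>. r *\<^sub>R c \<theta>) \<in> Imm"
    and curve_length_scaled: "curve_length (\<lambda>\<theta>. r *\<^sub>R c \<theta>) = r * curve_length c"
    and Vert_scaled: "Vert (\<lambda>\<theta>. r *\<^sub>R c \<theta>) = Vert c"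
    and binormal_scaled: "binormal (\<lambda>\<theta>. r *\<^sub>R c \<theta>) \<theta> = (1 / r) *\<^sub>R binormal c \<theta>"
proof -
  let ?c = "\<lambda>\<theta>. r *\<^sub>R c \<theta>"
  note l = Imm_loops[OF c]
  have d: "dtheta ?c \<theta> = r *\<^sub>R dtheta c \<theta>" for \<theta> by (rule dtheta_scaleR[OF l])
  show "?c \<in> Imm" using loops_scaleR[OF l] r by (simp add: Imm_def d Imm_dtheta_nonzero[OF c])
  show "curve_length ?c = r * curve_length c"
    unfolding curve_length_def by (rule integral_circle_mult) (use r in \<open>simp add: d\<close>)
  have T: "Ds ?c ?c = Ds c c"
    using r by (simp add: Ds_def d fun_eq_iff)
  show "Vert ?c = Vert c" by (simp add: Vert_def T)
  have "Ds ?c (Ds c c) \<theta> = (1 / r) *\<^sub>R Ds c (Ds c c) \<theta>"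
    using r by (simp add: Ds_def d)
  then show "binormal ?c \<theta> = (1 / r) *\<^sub>R binormal c \<theta>"
    by (simp add: binormal_def T cross_mult_right)
qed

definition unit_length :: "curve \<Rightarrow> curve" where
  "unit_length c = (\<lambda>\<theta>. (1 / curve_length c) *\<^sub>R c \<theta>)"

lemma unit_length_Imm1: "c \<in> Imm \<Longrightarrow> unit_length c \<in> Imm1"
  using scaled_curve[of c "1 / curve_length c"] curve_length_pos[of c]
  by (simp add: unit_length_def Imm1_def)

lemma unit_length_id: "c \<in> Imm1 \<Longrightarrow> unit_length c = c"
  by (simp add: unit_length_def Imm1_def)

section \<open>Smooth families of curves\<close>

lemma smooth_on_partials:
  fixes G :: "real \<times> real \<Rightarrow> 'b::real_normed_vector"
  assumes "smooth_on UNIV G"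
  shows smooth_on_partial1: "((\<lambda>s. G (s, \<theta>)) has_vector_derivative frechet_derivative G (at (t, \<theta>)) (1, 0)) (at t)"
    and smooth_on_partial2: "((\<lambda>s. G (t, s)) has_vector_derivative frechet_derivative G (at (t, \<theta>)) (0, 1)) (at \<theta>)"
proof -
  let ?G' = "frechet_derivative G (at (t, \<theta>))"
  have d: "(G has_derivative ?G') (at (t, \<theta>))"
    using smooth_on_differentiable[OF assms] by (simp add: frechet_derivative_works)
  have lin: "?G' (r *\<^sub>R x) = r *\<^sub>R ?G' x" for r x
    by (rule linear_scale[OF has_derivative_linear[OF d]])
  have 1: "(\<lambda>r. ?G' (r, 0)) = (\<lambda>r. r *\<^sub>R ?G' (1, 0))" "(\<lambda>r. ?G' (0, r)) = (\<lambda>r. r *\<^sub>R ?G' (0, 1))"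
    unfolding lin[symmetric] by simp_all
  show "((\<lambda>s. G (s, \<theta>)) has_vector_derivative ?G' (1, 0)) (at t)"
    unfolding has_vector_derivative_def 1[symmetric]
    by (rule has_derivative_compose[OF has_derivative_Pair[OF has_derivative_ident has_derivative_const] d])
  show "((\<lambda>s. G (t, s)) has_vector_derivative ?G' (0, 1)) (at \<theta>)"
    unfolding has_vector_derivative_def 1[symmetric]
    by (rule has_derivative_compose[OF has_derivative_Pair[OF has_derivative_const has_derivative_ident] d])
qed

text \<open>
  Symmetry of mixed partial derivatives: differentiate \<open>G(s, \<theta>) = G(a, \<theta>) + \<integral>\<^sub>a\<^sup>s \<partial>\<^sub>1G(u, \<theta>) du\<close>
  under the integral sign with respect to \<open>\<theta>\<close>, and then with respect to \<open>s\<close>.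
\<close>

lemma mixed_partials:
  fixes G :: "real \<times> real \<Rightarrow> 'b::banach"
  assumes G: "smooth_on UNIV G"
  defines "p \<equiv> \<lambda>x. frechet_derivative G (at x) (1, 0)" and "q \<equiv> \<lambda>x. frechet_derivative G (at x) (0, 1)"
  shows "((\<lambda>s. q (s, \<theta>)) has_vector_derivative frechet_derivative p (at (t, \<theta>)) (0, 1)) (at t)"
proof -
  define r where "r = (\<lambda>x. frechet_derivative p (at x) (0, 1))"
  \<comment> \<open>A base point strictly below \<open>t\<close>, so that \<open>t\<close> is
    interior to the interval of integration and one-sided derivatives become two-sided.\<close>
  define a where "a = t - 1"
  have p: "smooth_on UNIV p" unfolding p_def by (rule smooth_on_frechet_derivative[OF G])
  have cont: "continuous_on UNIV p" "continuous_on UNIV r"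
    unfolding r_def by (intro smooth_on_imp_continuous_on smooth_on_frechet_derivative p)+
  have slice: "continuous_on S (\<lambda>u. p (u, \<theta>))" "continuous_on S (\<lambda>u. r (u, \<theta>))" for S \<theta>
    by (intro continuous_on_compose2[OF cont(1)] continuous_on_compose2[OF cont(2)]
        continuous_on_Pair continuous_on_const continuous_on_id subset_UNIV)+
  have int: "G (s, \<theta>) = G (a, \<theta>) + integral {a..s} (\<lambda>u. p (u, \<theta>))" if "a \<le> s" for s \<theta>
  proof -
    have "((\<lambda>u. p (u, \<theta>)) has_integral G (s, \<theta>) - G (a, \<theta>)) {a..s}"
      by (rule fundamental_theorem_of_calculus[OF that])
        (unfold p_def, rule has_vector_derivative_at_within[OF smooth_on_partial1[OF G]])
    then show ?thesis by (simp add: integral_unique)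
  qed
  have q: "q (s, \<theta>) = q (a, \<theta>) + integral {a..s} (\<lambda>u. r (u, \<theta>))" if s: "a \<le> s" for s
  proof -
    have "((\<lambda>\<theta>. integral (cbox a s) (\<lambda>u. p (u, \<theta>))) has_vector_derivative
        integral (cbox a s) (\<lambda>u. r (u, \<theta>))) (at \<theta> within UNIV)"
    proof (rule leibniz_rule_vector_derivative)
      show "((\<lambda>\<theta>. p (u, \<theta>)) has_vector_derivative r (u, \<theta>)) (at \<theta> within UNIV)" for \<theta> u
        unfolding r_def by (rule smooth_on_partial2[OF p])
      show "(\<lambda>u. p (u, \<theta>)) integrable_on cbox a s" for \<theta>
        by (intro integrable_continuous slice)
      have "continuous_on (UNIV \<times> cbox a s) (\<lambda>x. r (snd x, fst x))"
        by (intro continuous_on_compose2[OF cont(2)] continuous_on_Pair continuous_on_fst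
            continuous_on_snd continuous_on_id subset_UNIV)
      then show "continuous_on (UNIV \<times> cbox a s) (\<lambda>(\<theta>, u). r (u, \<theta>))"
        by (simp add: case_prod_unfold)
    qed simp_all
    then have "((\<lambda>\<theta>. G (a, \<theta>) + integral {a..s} (\<lambda>u. p (u, \<theta>))) has_vector_derivative
        q (a, \<theta>) + integral {a..s} (\<lambda>u. r (u, \<theta>))) (at \<theta>)"
      unfolding q_def cbox_interval by (rule has_vector_derivative_add[OF smooth_on_partial2[OF G]])
    then have "((\<lambda>\<theta>. G (s, \<theta>)) has_vector_derivative q (a, \<theta>) + integral {a..s} (\<lambda>u. r (u, \<theta>))) (at \<theta>)"
      by (simp only: int[OF s, symmetric])
    then show ?thesis
      unfolding q_def by (rule vector_derivative_unique_at[OF smooth_on_partial2[OF G]])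
  qed
  have t: "t \<in> {a..t + 1}" "t \<in> interior {a..t + 1}" by (simp_all add: a_def)
  have "((\<lambda>s. integral {a..s} (\<lambda>u. r (u, \<theta>))) has_vector_derivative r (t, \<theta>)) (at t within {a..t + 1})"
    by (rule integral_has_vector_derivative[OF slice(2) t(1)])
  then have "((\<lambda>s. integral {a..s} (\<lambda>u. r (u, \<theta>))) has_vector_derivative r (t, \<theta>)) (at t)"
    using at_within_interior[OF t(2)] by simp
  from has_vector_derivative_add[OF has_vector_derivative_const[of "q (a, \<theta>)"] this]
  have "((\<lambda>s. q (a, \<theta>) + integral {a..s} (\<lambda>u. r (u, \<theta>))) has_vector_derivative r (t, \<theta>)) (at t)"
    by (simp only: add_0)
  moreover have "open {a<..}" "t \<in> {a<..}" by (simp_all add: a_def)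
  ultimately have "((\<lambda>s. q (s, \<theta>)) has_vector_derivative r (t, \<theta>)) (at t)"
    by (rule has_vector_derivative_transform_within_open) (rule q[symmetric], simp)
  then show ?thesis by (simp add: r_def)
qed

text \<open>The paths of \<open>leaf_step\<close> are not straight lines, so directional derivatives
  do not apply to them. Differentiating the speed in t produces the t-derivative of the velocity,
  which \<open>mixed_partials\<close> turns into the \<theta>-derivative of the variation field
  \<open>v t\<close>, as in \<open>len_deriv\<close>.\<close>

lemma curve_length_family:
  assumes G: "smooth_on UNIV (\<lambda>(t, \<theta>). \<gamma> t \<theta>)" and \<gamma>: "\<And>t. \<gamma> t \<in> Imm"
  defines "v \<equiv> \<lambda>t \<theta>. vector_derivative (\<lambda>s. \<gamma> s \<theta>) (at t)"
  shows smooth_on_curve_length_family: "smooth_on UNIV (\<lambda>t. curve_length (\<gamma> t))"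
    and curve_length_family_derivative:
      "((\<lambda>t. curve_length (\<gamma> t)) has_field_derivative len_deriv (\<gamma> t) (v t)) (at t)"
proof -
  let ?G = "\<lambda>(t, \<theta>). \<gamma> t \<theta>"
  define p where "p = (\<lambda>x. frechet_derivative ?G (at x) (1, 0))"
  define q where "q = (\<lambda>x. frechet_derivative ?G (at x) (0, 1))"
  define r where "r = (\<lambda>x. frechet_derivative p (at x) (0, 1))"
  have ps: "smooth_on UNIV p" and qs: "smooth_on UNIV q"
    unfolding p_def q_def by (rule smooth_on_frechet_derivative[OF G])+
  have rs: "smooth_on UNIV r" unfolding r_def by (rule smooth_on_frechet_derivative[OF ps])
  have v: "v t = (\<lambda>\<theta>. p (t, \<theta>))" for t
    unfolding v_def p_def using smooth_on_partial1[OF G] by (auto intro!: vector_derivative_at)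
  have q: "dtheta (\<gamma> t) \<theta> = q (t, \<theta>)" for t \<theta>
    unfolding q_def using smooth_on_partial2[OF G] by (auto intro!: vector_derivative_at)
  have r: "dtheta (v t) \<theta> = r (t, \<theta>)" for t \<theta>
    unfolding v r_def by (rule vector_derivative_at[OF smooth_on_partial2[OF ps]])
  have nz: "q x \<noteq> 0" for x
    using Imm_dtheta_nonzero[OF \<gamma>, of "fst x" "snd x"] by (simp add: q)
  have ns: "smooth_on UNIV (\<lambda>x. norm (q x))" by (rule smooth_on_norm[OF open_UNIV qs nz])
  show "smooth_on UNIV (\<lambda>t. curve_length (\<gamma> t))"
    unfolding curve_length_def q by (rule smooth_on_integral[OF ns])
  have "((\<lambda>t. integral (cbox 0 (2 * pi)) (\<lambda>\<theta>. norm (q (t, \<theta>)))) has_field_derivative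
      integral (cbox 0 (2 * pi)) (\<lambda>\<theta>. q (t, \<theta>) \<bullet> r (t, \<theta>) / norm (q (t, \<theta>)))) (at t within UNIV)"
  proof (rule leibniz_rule_field_derivative)
    show "((\<lambda>t. norm (q (t, \<theta>))) has_field_derivative q (t, \<theta>) \<bullet> r (t, \<theta>) / norm (q (t, \<theta>))) (at t within UNIV)" for t \<theta>
    proof -
      have d: "((\<lambda>s. q (s, \<theta>)) has_derivative (\<lambda>s. s *\<^sub>R r (t, \<theta>))) (at t)"
        using mixed_partials[OF G, of \<theta> t] by (simp only: q_def r_def p_def has_vector_derivative_def)
      have n: "(norm has_derivative (\<lambda>h. h \<bullet> sgn (q (t, \<theta>)))) (at (q (t, \<theta>)))"
        by (rule has_derivative_norm[OF nz])
      have "(s *\<^sub>R r (t, \<theta>)) \<bullet> sgn (q (t, \<theta>)) = q (t, \<theta>) \<bullet> r (t, \<theta>) / norm (q (t, \<theta>)) * s" for s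
        by (simp add: sgn_div_norm inner_commute[of "r (t, \<theta>)"] divide_inverse)
      then have e: "(\<lambda>s. (s *\<^sub>R r (t, \<theta>)) \<bullet> sgn (q (t, \<theta>))) = (*) (q (t, \<theta>) \<bullet> r (t, \<theta>) / norm (q (t, \<theta>)))" by (rule ext)
      show ?thesis unfolding has_field_derivative_def e[symmetric]
        by (rule has_derivative_compose[OF d n])
    qed
    show "(\<lambda>\<theta>. norm (q (t, \<theta>))) integrable_on cbox 0 (2 * pi)" for t
      by (intro integrable_continuous continuous_on_compose2[OF smooth_on_imp_continuous_on[OF ns]]
          continuous_on_Pair continuous_on_const continuous_on_id subset_UNIV)
    have "continuous_on UNIV (\<lambda>x. q x \<bullet> r x / norm (q x))"
      by (intro continuous_on_divide continuous_on_inner smooth_on_imp_continuous_on ns qs rs) (simp add: nz)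
    then show "continuous_on (UNIV \<times> cbox 0 (2 * pi)) (\<lambda>(t, \<theta>). q (t, \<theta>) \<bullet> r (t, \<theta>) / norm (q (t, \<theta>)))"
      using continuous_on_subset[OF _ subset_UNIV] by (simp add: case_prod_unfold)
  qed simp_all
  then show "((\<lambda>t. curve_length (\<gamma> t)) has_field_derivative len_deriv (\<gamma> t) (v t)) (at t)"
    by (simp add: curve_length_def len_deriv_def q r)
qed

section \<open>The leaf spaces\<close>

lemma equiv_leaf_rel: "equiv M (leaf_rel M D)"
proof (rule equivI)
  have s: "sym ((leaf_step M D \<union> (leaf_step M D)\<inverse>)\<^sup>*)"
    by (intro sym_rtrancl sym_Un_converse)
  show "sym (leaf_rel M D)"
    using symD[OF s] by (auto simp: sym_def leaf_rel_def)
  show "trans (leaf_rel M D)" by (auto simp: trans_def leaf_rel_def)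
  show "refl_on M (leaf_rel M D)" by (auto simp: refl_on_def leaf_rel_def)
qed (auto simp: leaf_rel_def)

lemma leaf_step_in_leaf_rel:
  assumes "(c, c') \<in> leaf_step M D" "c \<in> M" "c' \<in> M"
  shows "(c, c') \<in> leaf_rel M D"
  using assms by (auto simp: leaf_rel_def)

lemma leaf_step_reparametrization:
  "c \<in> M \<Longrightarrow> c \<circ> \<phi> \<in> M \<Longrightarrow> \<phi> \<in> diff_plus \<Longrightarrow> (c, c \<circ> \<phi>) \<in> leaf_step M D"
  unfolding leaf_step_def by (intro UnI1 CollectI exI[of _ c] exI[of _ \<phi>] conjI refl)

lemma leaf_step_path:
  assumes "smooth_on UNIV (\<lambda>(t, \<theta>). \<gamma> t \<theta>)" "\<And>t. \<gamma> t \<in> M"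
    and "\<And>t. (\<lambda>\<theta>. vector_derivative (\<lambda>s. \<gamma> s \<theta>) (at t)) \<in> D (\<gamma> t)"
  shows "(\<gamma> 0, \<gamma> 1) \<in> leaf_step M D"
  unfolding leaf_step_def by (intro UnI2 CollectI exI[of _ \<gamma>] conjI allI refl assms)

lemma leaf_step_cases:
  assumes "(c, c') \<in> leaf_step M D"
  obtains (reparametrization) \<phi> where "c' = c \<circ> \<phi>" "c \<in> M" "c' \<in> M" "\<phi> \<in> diff_plus"
  | (path) \<gamma> where "c = \<gamma> 0" "c' = \<gamma> 1" "smooth_on UNIV (\<lambda>(t, \<theta>). \<gamma> t \<theta>)" "\<And>t. \<gamma> t \<in> M"
      "\<And>t. (\<lambda>\<theta>. vector_derivative (\<lambda>s. \<gamma> s \<theta>) (at t)) \<in> D (\<gamma> t)"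
  using assms unfolding leaf_step_def
proof (elim UnE CollectE exE conjE)
  fix d \<phi> assume "(c, c') = (d, d \<circ> \<phi>)" "d \<in> M" "d \<circ> \<phi> \<in> M" "\<phi> \<in> diff_plus"
  then show thesis using reparametrization[of \<phi>] by simp
next
  fix \<gamma> :: "real \<Rightarrow> curve"
  assume "(c, c') = (\<gamma> 0, \<gamma> 1)" "smooth_on UNIV (\<lambda>(t, \<theta>). \<gamma> t \<theta>)"
    "\<forall>t. \<gamma> t \<in> M \<and> (\<lambda>\<theta>. vector_derivative (\<lambda>s. \<gamma> s \<theta>) (at t)) \<in> D (\<gamma> t)"
  then show thesis using path[of \<gamma>] by simp
qed

lemma leaf_step_mono:
  assumes "M \<subseteq> M'" "\<And>c. c \<in> M \<Longrightarrow> D c \<subseteq> D' c"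
  shows "leaf_step M D \<subseteq> leaf_step M' D'"
proof (rule subrelI)
  fix c c' assume "(c, c') \<in> leaf_step M D"
  then show "(c, c') \<in> leaf_step M' D'"
  proof (cases rule: leaf_step_cases)
    case (reparametrization \<phi>)
    then show ?thesis using leaf_step_reparametrization[of c M' \<phi> D'] assms(1) by blast
  next
    case (path \<gamma>)
    show ?thesis unfolding path(1,2)
      by (rule leaf_step_path[OF path(3) subsetD[OF assms(1) path(4)] subsetD[OF assms(2)[OF path(4)] path(5)]])
  qed
qed

lemma leaf_Imm1_subset: "leaf_Imm1 \<subseteq> leaf_Imm"
proof -
  have I: "c \<in> Imm1 \<Longrightarrow> c \<in> Imm" for c by (simp add: Imm1_def)
  have D: "grad_length_span c \<subseteq> vsum (Vert c) (F_fib c)" if "c \<in> Imm" for c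
    using T_Imm1_inter_VF[OF that] vsum_Vert_F_fib[OF that] by blast
  have "leaf_step Imm1 grad_length_span \<subseteq> leaf_step Imm (\<lambda>c. vsum (Vert c) (F_fib c))"
    by (rule leaf_step_mono) (use I D in auto)
  then have "(leaf_step Imm1 grad_length_span \<union> (leaf_step Imm1 grad_length_span)\<inverse>)\<^sup>*
      \<subseteq> (leaf_step Imm (\<lambda>c. vsum (Vert c) (F_fib c)) \<union> (leaf_step Imm (\<lambda>c. vsum (Vert c) (F_fib c)))\<inverse>)\<^sup>*"
    by (intro rtrancl_mono Un_mono) auto
  then show ?thesis unfolding leaf_rel_def using I by auto
qed

lemma leaf_step_unit_length_reparametrize:
  assumes c: "c \<in> Imm" and \<phi>: "\<phi> \<in> diff_plus"
  shows "(unit_length c, unit_length (c \<circ> \<phi>)) \<in> leaf_step Imm1 D"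
proof -
  have "unit_length (c \<circ> \<phi>) = unit_length c \<circ> \<phi>"
    using curve_length_reparametrize[OF c Imm_loops[OF c] Imm_loops[OF c] \<phi>]
    by (simp add: unit_length_def o_def)
  then show ?thesis
    using unit_length_Imm1[OF c] unit_length_Imm1[OF Imm_compose[OF c \<phi>]] \<phi>
      leaf_step_reparametrization[of "unit_length c" Imm1 \<phi> D] by simp
qed

text \<open>By the quotient rule the derivative of the length removes precisely the scaling
  component of the path's velocity, leaving a vertical and a binormal part.\<close>

lemma leaf_step_unit_length_path:
  assumes G: "smooth_on UNIV (\<lambda>(t, \<theta>). \<gamma> t \<theta>)" and \<gamma>: "\<And>t. \<gamma> t \<in> Imm"
    and D: "\<And>t. (\<lambda>\<theta>. vector_derivative (\<lambda>s. \<gamma> s \<theta>) (at t)) \<in> VF (\<gamma> t)"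
  shows "(unit_length (\<gamma> 0), unit_length (\<gamma> 1)) \<in> leaf_step Imm1 grad_length_span"
proof -
  let ?n = "\<lambda>t. unit_length (\<gamma> t)" and ?l = "\<lambda>t. curve_length (\<gamma> t)"
  define v where "v = (\<lambda>t \<theta>. vector_derivative (\<lambda>s. \<gamma> s \<theta>) (at t))"
  note pos = curve_length_pos[OF \<gamma>]
  have "smooth_on UNIV (\<lambda>t. 1 / ?l t)"
    by (rule smooth_on_inverse_pos[OF open_UNIV smooth_on_curve_length_family[OF G \<gamma>] pos])
  then have "smooth_on UNIV (\<lambda>x::real \<times> real. 1 / ?l (fst x))"
    by (rule smooth_on_compose_linear[OF bounded_linear_fst open_UNIV])
  from smooth_on_scaleR[OF open_UNIV this G]
  have s: "smooth_on UNIV (\<lambda>(t, \<theta>). ?n t \<theta>)" by (simp add: unit_length_def case_prod_unfold)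
  have "(\<lambda>\<theta>. vector_derivative (\<lambda>s. ?n s \<theta>) (at t)) \<in> grad_length_span (?n t)" for t
  proof -
    obtain w \<alpha> \<beta> where w: "w \<in> Vert (\<gamma> t)" and vt: "v t = (\<lambda>\<theta>. w \<theta> + (\<alpha> *\<^sub>R \<gamma> t \<theta> + \<beta> *\<^sub>R binormal (\<gamma> t) \<theta>))"
      using D[of t] unfolding v_def by (rule VFE)
    \<comment> \<open>The length grows at the logarithmic rate \<alpha>, the coefficient of the
      scaling field.\<close>
    have l': "((\<lambda>t. ?l t) has_field_derivative \<alpha> * ?l t) (at t)"
      using curve_length_family_derivative[OF G \<gamma>, of t] VF_span_len_deriv[OF \<gamma> w vt]
      unfolding v_def by simp
    have "((\<lambda>s. ?n s \<theta>) has_vector_derivative (1 / ?l t) *\<^sub>R w \<theta> + (\<beta> / (?l t)\<^sup>2) *\<^sub>R binormal (?n t) \<theta>) (at t)" for \<theta>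
    proof -
      have d1: "((\<lambda>s. \<gamma> s \<theta>) has_vector_derivative v t \<theta>) (at t)"
        using smooth_on_partial1[OF G, of \<theta> t] unfolding v_def
        by (simp only: prod.case vector_derivative_at)
      have d2: "((\<lambda>s. 1 / ?l s) has_field_derivative - \<alpha> / ?l t) (at t)"
        by (rule DERIV_cong[OF DERIV_divide[OF DERIV_const l']]) (use pos[of t] in \<open>simp_all add: power2_eq_square\<close>)
      have "((\<lambda>s. (1 / ?l s) *\<^sub>R \<gamma> s \<theta>) has_vector_derivative (1 / ?l t) *\<^sub>R v t \<theta> + (- \<alpha> / ?l t) *\<^sub>R \<gamma> t \<theta>) (at t)"
        by (rule has_vector_derivative_scaleR[OF d2 d1])
      \<comment> \<open>One factor of the length in the denominator comes from the rescaling of the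
        path, the other from expressing the binormal field of the original curve by that of the
        rescaled one.\<close>
      moreover have "(1 / ?l t) *\<^sub>R v t \<theta> + (- \<alpha> / ?l t) *\<^sub>R \<gamma> t \<theta> = (1 / ?l t) *\<^sub>R w \<theta> + (\<beta> / (?l t)\<^sup>2) *\<^sub>R binormal (?n t) \<theta>"
      proof -
        have "binormal (?n t) \<theta> = ?l t *\<^sub>R binormal (\<gamma> t) \<theta>"
          unfolding unit_length_def using binormal_scaled[OF \<gamma>, of "1 / ?l t" t \<theta>] pos[of t] by simp
        then show ?thesis using pos[of t] by (simp add: vt scaleR_add_right power2_eq_square)
      qed
      ultimately show ?thesis by (simp add: unit_length_def)
    qed
    then have "(\<lambda>\<theta>. vector_derivative (\<lambda>s. ?n s \<theta>) (at t)) = (\<lambda>\<theta>. (1 / ?l t) *\<^sub>R w \<theta> + (\<beta> / (?l t)\<^sup>2) *\<^sub>R binormal (?n t) \<theta>)"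
      by (intro ext vector_derivative_at)
    moreover have "(\<lambda>\<theta>. (1 / ?l t) *\<^sub>R w \<theta>) \<in> Vert (?n t)"
      unfolding unit_length_def using Vert_scaled[OF \<gamma>, of "1 / ?l t" t] pos[of t] Vert_scaleR[OF w] by simp
    moreover have "?n t \<in> Imm" using unit_length_Imm1[OF \<gamma>[of t]] by (simp add: Imm1_def)
    ultimately show ?thesis
      unfolding grad_length_span_eq[OF \<open>?n t \<in> Imm\<close>]
      by (intro CollectI exI[of _ "\<lambda>\<theta>. (1 / ?l t) *\<^sub>R w \<theta>"] exI[of _ "\<beta> / (?l t)\<^sup>2"] conjI)
  qed
  then show ?thesis by (rule leaf_step_path[OF s unit_length_Imm1[OF \<gamma>]])
qed

lemma leaf_step_unit_length:
  assumes "(c, c') \<in> leaf_step Imm (\<lambda>c. vsum (Vert c) (F_fib c))"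
  shows "(unit_length c, unit_length c') \<in> leaf_step Imm1 grad_length_span"
  using assms
proof (cases rule: leaf_step_cases)
  case (reparametrization \<phi>)
  then show ?thesis using leaf_step_unit_length_reparametrize by simp
next
  case (path \<gamma>)
  show ?thesis unfolding path(1,2)
    by (rule leaf_step_unit_length_path[OF path(3,4)]) (use path(5) vsum_Vert_F_fib[OF path(4)] in simp)
qed

lemma leaf_Imm_unit_length:
  assumes "(c, c') \<in> leaf_Imm"
  shows "(unit_length c, unit_length c') \<in> leaf_Imm1"
proof -
  let ?S = "leaf_step Imm (\<lambda>c. vsum (Vert c) (F_fib c))" and ?S1 = "leaf_step Imm1 grad_length_span"
  have m: "c \<in> Imm" "c' \<in> Imm" and st: "(c, c') \<in> (?S \<union> ?S\<inverse>)\<^sup>*"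
    using assms unfolding leaf_rel_def by auto
  have "(unit_length c, unit_length c') \<in> (?S1 \<union> ?S1\<inverse>)\<^sup>*"
    using st
  proof (induction rule: rtrancl_induct)
    case (step y z)
    then have "(unit_length y, unit_length z) \<in> ?S1 \<union> ?S1\<inverse>"
      using leaf_step_unit_length by auto
    with step.IH show ?case by (rule rtrancl_into_rtrancl)
  qed simp
  then show ?thesis using unit_length_Imm1 m by (simp add: leaf_rel_def)
qed

text \<open>The flow line of a constant multiple of the scaling field through \<open>c\<close> is a
  path inside the leaf; an exponential parametrisation stays in \<open>Imm\<close> for all real
  times, as \<open>leaf_step\<close> demands.\<close>

lemma leaf_Imm_scaling:
  assumes c: "c \<in> Imm"
  shows "(c, unit_length c) \<in> leaf_Imm"
proof (rule leaf_step_in_leaf_rel[OF _ c])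
  \<comment> \<open>Chosen so that the exponential factor is 1 at time 0 and the reciprocal of the
    length at time 1.\<close>
  define a where "a = - ln (curve_length c)"
  define \<gamma> where "\<gamma> = (\<lambda>t \<theta>. exp (a * t) *\<^sub>R c \<theta>)"
  have ends: "c = \<gamma> 0" "unit_length c = \<gamma> 1"
    using curve_length_pos[OF c] by (simp_all add: \<gamma>_def a_def unit_length_def exp_minus inverse_eq_divide)
  have "smooth_on UNIV (\<lambda>x::real \<times> real. exp (a * fst x) *\<^sub>R c (snd x))"
    by (intro smooth_on_scaleR open_UNIV smooth_on_compose_linear[OF bounded_linear_snd, of _ c]
        smooth_on_compose_linear[of "\<lambda>x. a * fst x" UNIV exp] smooth_on_exp circle_smooth_imp_smooth Imm_loops c
        bounded_linear_const_mult bounded_linear_fst)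
  then have s: "smooth_on UNIV (\<lambda>(t, \<theta>). \<gamma> t \<theta>)" by (simp add: \<gamma>_def case_prod_unfold)
  have \<gamma>: "\<gamma> t \<in> Imm" for t unfolding \<gamma>_def by (rule scaled_Imm[OF c]) simp
  have "((\<lambda>s. \<gamma> s \<theta>) has_vector_derivative a *\<^sub>R \<gamma> t \<theta>) (at t)" for t \<theta>
  proof -
    have "((\<lambda>s. exp (a * s)) has_field_derivative a * exp (a * t)) (at t)"
      by (rule derivative_eq_intros refl | simp)+
    from has_vector_derivative_scaleR[OF this has_vector_derivative_const[of "c \<theta>"]]
    show ?thesis by (simp add: \<gamma>_def)
  qed
  then have "(\<lambda>\<theta>. vector_derivative (\<lambda>s. \<gamma> s \<theta>) (at t)) = (\<lambda>\<theta>. 0 + (a *\<^sub>R \<gamma> t \<theta> + 0 *\<^sub>R binormal (\<gamma> t) \<theta>))" for t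
    by (auto intro!: vector_derivative_at)
  then have "(\<lambda>\<theta>. vector_derivative (\<lambda>s. \<gamma> s \<theta>) (at t)) \<in> vsum (Vert (\<gamma> t)) (F_fib (\<gamma> t))" for t
    using VFI[OF Vert_0[of "\<gamma> t"], of a 0] vsum_Vert_F_fib[OF \<gamma>] by simp
  then have "(\<gamma> 0, \<gamma> 1) \<in> leaf_step Imm (\<lambda>c. vsum (Vert c) (F_fib c))"
    by (rule leaf_step_path[OF s \<gamma>])
  then show "(c, unit_length c) \<in> leaf_step Imm (\<lambda>c. vsum (Vert c) (F_fib c))"
    by (simp only: ends[symmetric])
  show "unit_length c \<in> Imm" using unit_length_Imm1[OF c] by (simp add: Imm1_def)
qed

text \<open>\<open>B\<close> meets every class of \<open>r\<close>, which gives surjectivity, and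
  \<open>r\<close> restricted to \<open>B\<close> is contained in \<open>s\<close>, which gives
  injectivity. Here \<open>B\<close> will be the set of curves of length one.\<close>

lemma bij_betw_quotients:
  assumes r: "equiv A r" and s: "equiv B s" and "s \<subseteq> r"
    and meets: "\<And>x. x \<in> A \<Longrightarrow> \<exists>y\<in>B. (x, y) \<in> r"
    and restr: "\<And>x y. x \<in> B \<Longrightarrow> y \<in> B \<Longrightarrow> (x, y) \<in> r \<Longrightarrow> (x, y) \<in> s"
  shows "bij_betw (\<lambda>Q. r `` Q) (B // s) (A // r)"
proof -
  have cls: "r `` (s `` {x}) = r `` {x}" if "x \<in> B" for x
  proof -
    have "(x, x) \<in> s" using s that by (simp add: equiv_def refl_on_def)
    moreover have "(x, z) \<in> r" if "(x, y) \<in> s" "(y, z) \<in> r" for y z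
      using that \<open>s \<subseteq> r\<close> r unfolding equiv_def by (meson subsetD transD)
    ultimately show ?thesis by blast
  qed
  have BA: "B \<subseteq> A"
  proof
    fix x assume "x \<in> B"
    then have "(x, x) \<in> r" using s \<open>s \<subseteq> r\<close> by (auto simp: equiv_def refl_on_def)
    then show "x \<in> A" using r by (auto simp: equiv_def)
  qed
  show ?thesis
  proof (rule bij_betwI')
    fix P Q assume "P \<in> B // s" "Q \<in> B // s"
    then obtain x y where x: "x \<in> B" "P = s `` {x}" and y: "y \<in> B" "Q = s `` {y}"
      by (auto elim!: quotientE)
    show "(r `` P = r `` Q) = (P = Q)"
    proof
      assume "r `` P = r `` Q"
      then have "r `` {x} = r `` {y}" using x y cls by simp
      then have "(x, y) \<in> r" using eq_equiv_class[OF _ r] BA y(1) by blast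
      then show "P = Q" using restr x y equiv_class_eq[OF s] by simp
    qed simp
  next
    show "r `` P \<in> A // r" if "P \<in> B // s" for P
      using that cls BA by (auto elim!: quotientE intro!: quotientI)
  next
    fix R assume "R \<in> A // r"
    then obtain x where x: "x \<in> A" "R = r `` {x}" by (auto elim!: quotientE)
    obtain y where y: "y \<in> B" "(x, y) \<in> r" using meets[OF x(1)] by blast
    then have "R = r `` (s `` {y})" using cls[OF y(1)] x(2) equiv_class_eq[OF r] by simp
    then show "\<exists>P\<in>B // s. R = r `` P" using quotientI[OF y(1)] by blast
  qed
qed

text \<open>Scaling paths join every curve to one of length one. Conversely
  \<open>unit_length\<close> carries a chain between two curves of length one into
  \<open>Imm1\<close> and fixes its end points.\<close>

lemma bij_betw_leaf_spaces: "bij_betw (\<lambda>A. leaf_Imm `` A) (Imm1 // leaf_Imm1) (Imm // leaf_Imm)"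
proof (rule bij_betw_quotients[OF equiv_leaf_rel equiv_leaf_rel leaf_Imm1_subset])
  show "\<exists>y\<in>Imm1. (x, y) \<in> leaf_Imm" if "x \<in> Imm" for x
    using unit_length_Imm1[OF that] leaf_Imm_scaling[OF that] by blast
  show "(x, y) \<in> leaf_Imm1" if "x \<in> Imm1" "y \<in> Imm1" "(x, y) \<in> leaf_Imm" for x y
    using leaf_Imm_unit_length[OF that(3)] unit_length_id that(1,2) by simp
qed

section \<open>Kernels and presymplectic structure of the conformal forms\<close>

lemma form_kernel_Omega_Phi:
  assumes "smooth_on {0<..} \<Phi>" "c \<in> Imm"
  shows "form_kernel (Omega_Phi \<Phi>) c = {h \<in> loops. \<forall>k\<in>loops. Phi_form \<Phi> c h k = 0}"
  unfolding radical_on_def using Omega_Phi_eq[OF assms] by auto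

lemma form_kernel_Omega_Phi_cases:
  assumes s: "smooth_on {0<..} \<Phi>" and pos: "\<And>r. r > 0 \<Longrightarrow> \<Phi> r > 0" and c: "c \<in> Imm"
  shows "form_kernel (Omega_Phi \<Phi>) c = (if cubic_contact \<Phi> (curve_length c) then VF c else Vert c)"
  using Phi_form_kernel[OF c, of \<Phi>] pos[OF curve_length_pos[OF c]]
    cubic_contact_iff[OF curve_length_pos[OF c], of \<Phi>]
  by (simp add: form_kernel_Omega_Phi[OF s c])

lemma presymplectic_Omega_Phi:
  assumes s: "smooth_on {0<..} \<Phi>"
  shows "presymplectic_Bi (Omega_Phi \<Phi>)"
  unfolding presymplectic_Bi_def
proof (intro conjI ballI)
  show "alternating_bilinear (Omega_Phi \<Phi>)"
    unfolding alternating_bilinear_def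
  proof (intro ballI conjI allI)
    fix c h k assume c: "c \<in> Imm" and h: "h \<in> loops" and k: "k \<in> loops"
    show "Omega_Phi \<Phi> c h k = - Omega_Phi \<Phi> c k h"
      unfolding Omega_Phi_eq[OF s c h k] Omega_Phi_eq[OF s c k h] by (rule Phi_form_alternating)
    show "Omega_Phi \<Phi> c (\<lambda>\<theta>. h \<theta> + m \<theta>) k = Omega_Phi \<Phi> c h k + Omega_Phi \<Phi> c m k" if m: "m \<in> loops" for m
      unfolding Omega_Phi_eq[OF s c loops_add[OF h m] k] Omega_Phi_eq[OF s c h k] Omega_Phi_eq[OF s c m k]
      by (simp add: Phi_form_def det_form_add len_deriv_add Theta_id_add Imm_loops c h k m algebra_simps)
    show "Omega_Phi \<Phi> c (\<lambda>\<theta>. r *\<^sub>R h \<theta>) k = r * Omega_Phi \<Phi> c h k" for r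
      unfolding Omega_Phi_eq[OF s c loops_scaleR[OF h] k] Omega_Phi_eq[OF s c h k]
      by (simp add: Phi_form_def det_form_scaleR len_deriv_scaleR Theta_id_scaleR h algebra_simps)
  qed
  show "closed_form (Omega_Phi \<Phi>)" by (rule closed_form_Omega_Phi[OF s])
  show "Omega_Phi \<Phi> (c \<circ> \<phi>) (h \<circ> \<phi>) (k \<circ> \<phi>) = Omega_Phi \<Phi> c h k"
    if "c \<in> Imm" "h \<in> loops" "k \<in> loops" "\<phi> \<in> diff_plus" for c h k \<phi>
    using that by (simp add: Omega_Phi_eq[OF s] Imm_compose circle_smooth_compose Phi_form_reparametrize)
  show "Vert c \<subseteq> form_kernel (Omega_Phi \<Phi>) c" if c: "c \<in> Imm" for c
    unfolding form_kernel_Omega_Phi[OF s c]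
    using Vert_loops[OF c] by (auto simp: Phi_form_def det_form_Vert len_deriv_Vert[OF c] Theta_id_Vert)
qed

text \<open>Part (a) has two clauses because degeneracy is decided at each length separately.
  Without contact at any length the form is symplectic; if \<Phi> is merely not a cubic factor, the
  contact-free lengths form an open set that some curve attains, and the kernel is vertical at
  exactly the curves of such length. In (b) the equality of tangent spaces says that the inclusion
  of the length-one curves induces an isomorphism on the tangent spaces of the leaf spaces.\<close>

theorem corollary4p1:
  fixes \<Phi> :: "real \<Rightarrow> real"
  assumes smooth: "smooth_on {0<..} \<Phi>"
    and pos: "\<And>r. r > 0 \<Longrightarrow> \<Phi> r > 0"
  shows
    "\<comment> \<open>the two formulas for \<open>\<Omega>\<^sup>\<Phi>\<close>\<close>
     (\<forall>c\<in>Imm. \<forall>h\<in>loops. \<forall>k\<in>loops.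
        has_dir_deriv (\<lambda>c. \<Phi> (curve_length c) * Theta_id c k) c h \<and>
        Omega_Phi \<Phi> c h k =
          \<Phi> (curve_length c) * Omega_id c h k
          - deriv \<Phi> (curve_length c) *
            (arc_integral c (\<lambda>\<theta>. Ds c h \<theta> \<bullet> Ds c c \<theta>) * Theta_id c k
             - arc_integral c (\<lambda>\<theta>. Ds c k \<theta> \<bullet> Ds c c \<theta>) * Theta_id c h) \<and>
        Omega_Phi \<Phi> c h k =
          \<Phi> (curve_length c) * Omega_id c h k
          + deriv \<Phi> (curve_length c) *
            (arc_integral c (\<lambda>\<theta>. h \<theta> \<bullet> Ds c (Ds c c) \<theta>) * Theta_id c k
             - arc_integral c (\<lambda>\<theta>. k \<theta> \<bullet> Ds c (Ds c c) \<theta>) * Theta_id c h) \<and>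
        Omega_id c h k = 3 * arc_integral c (\<lambda>\<theta>. cross3 (Ds c c \<theta>) (h \<theta>) \<bullet> k \<theta>))
     \<and> presymplectic_Bi (Omega_Phi \<Phi>)

     \<comment> \<open>(a)\<close>
     \<and> ((\<forall>r>0. \<not> cubic_contact \<Phi> r) \<longrightarrow> symplectic_Bi (Omega_Phi \<Phi>))
     \<and> (\<not> (\<exists>C. \<forall>r>0. \<Phi> r = C / r ^ 3) \<longrightarrow>
          open {r. r > 0 \<and> \<not> cubic_contact \<Phi> r} \<and>
          (\<exists>c\<in>Imm. \<not> cubic_contact \<Phi> (curve_length c)) \<and>
          (\<forall>c\<in>Imm. form_kernel (Omega_Phi \<Phi>) c = Vert c \<longleftrightarrow>
             \<not> cubic_contact \<Phi> (curve_length c)))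

     \<comment> \<open>(b): the bundle \<open>\<F>\<close>\<close>
     \<and> (\<forall>c\<in>Imm.
          is_hgrad Omega_MW curve_length c (hgrad Omega_MW curve_length c) \<and>
          hgrad Omega_MW curve_length c = (\<lambda>\<theta>. cross3 (Ds c c \<theta>) (Ds c (Ds c c) \<theta>)) \<and>
          (\<forall>\<alpha> \<beta>. (\<forall>\<theta>. \<alpha> *\<^sub>R c \<theta> + \<beta> *\<^sub>R hgrad Omega_MW curve_length c \<theta> = 0) \<longrightarrow>
             \<alpha> = 0 \<and> \<beta> = 0))

     \<comment> \<open>(b): the identification of the two leaf spaces and of their tangent spaces\<close>
     \<and> equiv Imm leaf_Imm \<and> equiv Imm1 leaf_Imm1
     \<and> bij_betw (\<lambda>A. leaf_Imm `` A) (Imm1 // leaf_Imm1) (Imm // leaf_Imm)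
     \<and> (\<forall>c\<in>Imm1.
          loops = vsum (T_Imm1 c) (vsum (Vert c) (F_fib c)) \<and>
          T_Imm1 c \<inter> vsum (Vert c) (F_fib c) = grad_length_span c)

     \<comment> \<open>(b): the induced form\<close>
     \<and> (\<forall>C. (\<forall>r>0. \<Phi> r = C / r ^ 3) \<longrightarrow>
          (\<forall>c\<in>Imm. form_kernel (Omega_Phi \<Phi>) c = vsum (Vert c) (F_fib c)) \<and>
          (\<forall>c\<in>Imm1. radical_on (T_Imm1 c) (Omega_Phi \<Phi>) c = grad_length_span c) \<and>
          (\<exists>m. m \<noteq> 0 \<and> (\<forall>c\<in>Imm1. \<forall>h\<in>T_Imm1 c. \<forall>k\<in>T_Imm1 c.
             Omega_Phi \<Phi> c h k = m * Omega_MW c h k)))"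
proof (intro conjI ballI impI allI)
  fix c h k assume c: "c \<in> Imm" and h: "h \<in> loops" and k: "k \<in> loops"
  note l = Imm_loops[OF c]
  show "has_dir_deriv (\<lambda>c. \<Phi> (curve_length c) * Theta_id c k) c h"
    by (rule dir_derivI(1)) (rule Phi_Theta_has_field_derivative[OF smooth c h k])
  show "Omega_Phi \<Phi> c h k = \<Phi> (curve_length c) * Omega_id c h k - deriv \<Phi> (curve_length c) *
      (arc_integral c (\<lambda>\<theta>. Ds c h \<theta> \<bullet> Ds c c \<theta>) * Theta_id c k
       - arc_integral c (\<lambda>\<theta>. Ds c k \<theta> \<bullet> Ds c c \<theta>) * Theta_id c h)"
    by (simp add: Omega_Phi_eq[OF smooth c h k] Phi_form_def Omega_id_eq[OF l h k] len_deriv_eq_arc_integral[OF c])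
  show "Omega_Phi \<Phi> c h k = \<Phi> (curve_length c) * Omega_id c h k + deriv \<Phi> (curve_length c) *
      (arc_integral c (\<lambda>\<theta>. h \<theta> \<bullet> Ds c (Ds c c) \<theta>) * Theta_id c k
       - arc_integral c (\<lambda>\<theta>. k \<theta> \<bullet> Ds c (Ds c c) \<theta>) * Theta_id c h)"
    by (simp add: Omega_Phi_eq[OF smooth c h k] Phi_form_def Omega_id_eq[OF l h k]
        len_deriv_by_parts[OF c h] len_deriv_by_parts[OF c k] algebra_simps)
  show "Omega_id c h k = 3 * arc_integral c (\<lambda>\<theta>. cross3 (Ds c c \<theta>) (h \<theta>) \<bullet> k \<theta>)"
    by (simp add: Omega_id_eq[OF l h k] arc_integral_det_form)
next
  show "presymplectic_Bi (Omega_Phi \<Phi>)" by (rule presymplectic_Omega_Phi[OF smooth])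
next
  assume "\<forall>r>0. \<not> cubic_contact \<Phi> r"
  then show "symplectic_Bi (Omega_Phi \<Phi>)"
    unfolding symplectic_Bi_def
    using presymplectic_Omega_Phi[OF smooth] form_kernel_Omega_Phi_cases[OF smooth pos] curve_length_pos by simp
next
  show "open {r. r > 0 \<and> \<not> cubic_contact \<Phi> r}" by (rule open_not_cubic_contact[OF smooth])
next
  assume "\<not> (\<exists>C. \<forall>r>0. \<Phi> r = C / r ^ 3)"
  then obtain r where r: "r > 0" "\<not> cubic_contact \<Phi> r" using cubic_if_contact[OF smooth] by blast
  obtain c where "c \<in> Imm" "curve_length c = r" using exists_Imm_length[OF r(1)] by blast
  then show "\<exists>c\<in>Imm. \<not> cubic_contact \<Phi> (curve_length c)" using r(2) by blast
next
  fix c assume c: "c \<in> Imm"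
  show "(form_kernel (Omega_Phi \<Phi>) c = Vert c) = (\<not> cubic_contact \<Phi> (curve_length c))"
    using VF_neq_Vert[OF c] by (simp add: form_kernel_Omega_Phi_cases[OF smooth pos c])
next
  fix c assume c: "c \<in> Imm"
  show "is_hgrad Omega_MW curve_length c (hgrad Omega_MW curve_length c)"
    unfolding hgrad_eq_binormal[OF c] by (rule is_hgrad_binormal[OF c])
  show "hgrad Omega_MW curve_length c = (\<lambda>\<theta>. cross3 (Ds c c \<theta>) (Ds c (Ds c c) \<theta>))"
    unfolding hgrad_eq_binormal[OF c] binormal_def ..
  fix \<alpha> \<beta> assume "\<forall>\<theta>. \<alpha> *\<^sub>R c \<theta> + \<beta> *\<^sub>R hgrad Omega_MW curve_length c \<theta> = 0"
  \<comment> \<open>Linear independence: the zero field is viewed as an element of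
    \<open>VF c\<close>, and the covectors of \<open>VF_span\<close> return its coefficients times
    the positive length.\<close>
  then have "(\<lambda>\<theta>. 0) = (\<lambda>\<theta>. 0 + (\<alpha> *\<^sub>R c \<theta> + \<beta> *\<^sub>R binormal c \<theta>))"
    by (simp add: hgrad_eq_binormal[OF c])
  note z = VF_span[OF c Vert_0 this]
  have "len_deriv c (\<lambda>\<theta>. 0) = 0" "Theta_id c (\<lambda>\<theta>. 0) = 0"
    using len_deriv_Vert[OF c Vert_0] Theta_id_Vert[OF Vert_0] by simp_all
  then show "\<alpha> = 0" "\<beta> = 0" using z curve_length_pos[OF c] by simp_all
next
  show "equiv Imm leaf_Imm" "equiv Imm1 leaf_Imm1" by (rule equiv_leaf_rel)+
  show "bij_betw (\<lambda>A. leaf_Imm `` A) (Imm1 // leaf_Imm1) (Imm // leaf_Imm)"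
    by (rule bij_betw_leaf_spaces)
next
  fix c assume "c \<in> Imm1"
  then have c: "c \<in> Imm" by (simp add: Imm1_def)
  show "loops = vsum (T_Imm1 c) (vsum (Vert c) (F_fib c))"
    unfolding vsum_Vert_F_fib[OF c] by (rule loops_eq_T_Imm1_VF[OF c])
  show "T_Imm1 c \<inter> vsum (Vert c) (F_fib c) = grad_length_span c"
    unfolding vsum_Vert_F_fib[OF c] by (rule T_Imm1_inter_VF[OF c])
next
  fix C assume C: "\<forall>r>0. \<Phi> r = C / r ^ 3"
  have contact: "cubic_contact \<Phi> r" if r: "r > 0" for r
  proof -
    have "deriv \<Phi> r = deriv (\<lambda>l. C / l ^ 3) r"
      \<comment> \<open>The hypothesis gives equality on the positive half-line only, which is a
        neighbourhood of \<open>r\<close>.\<close>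
      by (rule deriv_cong_ev) (use C r eventually_nhds_in_open[of "{0<..}" r] in \<open>auto elim: eventually_mono\<close>)
    then show ?thesis unfolding cubic_contact_def using C r by blast
  qed
  have ker: "form_kernel (Omega_Phi \<Phi>) c = VF c" if "c \<in> Imm" for c
    using form_kernel_Omega_Phi_cases[OF smooth pos that] contact[OF curve_length_pos[OF that]] by simp
  show "form_kernel (Omega_Phi \<Phi>) c = vsum (Vert c) (F_fib c)" if c: "c \<in> Imm" for c
    unfolding vsum_Vert_F_fib[OF c] by (rule ker[OF c])
  have TL: "h \<in> loops" if "h \<in> T_Imm1 c" for h c using that by (simp add: T_Imm1_def)
  show "radical_on (T_Imm1 c) (Omega_Phi \<Phi>) c = grad_length_span c" if "c \<in> Imm1" for c
  proof -
    have c: "c \<in> Imm" using that by (simp add: Imm1_def)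
    have "radical_on (T_Imm1 c) (Omega_Phi \<Phi>) c = {h \<in> T_Imm1 c. \<forall>k\<in>T_Imm1 c. Phi_form \<Phi> c h k = 0}"
      unfolding radical_on_def using Omega_Phi_eq[OF smooth c] TL by auto
    also have "\<dots> = grad_length_span c"
      by (rule Phi_form_radical[OF c]) (use ker[OF c] form_kernel_Omega_Phi[OF smooth c] in simp)
    finally show ?thesis .
  qed
  have "C > 0" using C pos[of 1] by simp
  \<comment> \<open>On the level set the differential of the length vanishes, so the \<Phi>' term
    drops out; moreover \<Phi>(1) = C, and the 3 is the ratio of \<open>Omega_id\<close> to
    \<open>Omega_MW\<close>.\<close>
  moreover have "Omega_Phi \<Phi> c h k = 3 * C * Omega_MW c h k"
    if "c \<in> Imm1" and h: "h \<in> T_Imm1 c" and k: "k \<in> T_Imm1 c" for c h k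
  proof -
    have c: "c \<in> Imm" and l: "curve_length c = 1" using that(1) by (simp_all add: Imm1_def)
    have "len_deriv c h = 0" "len_deriv c k = 0" using h k T_Imm1_iff[OF c] by blast+
    then show ?thesis
      using C l
      by (simp add: Omega_Phi_eq[OF smooth c TL[OF h] TL[OF k]] Phi_form_def Omega_MW_def
          Omega_id_eq[OF Imm_loops[OF c] TL[OF h] TL[OF k]])
  qed
  ultimately show "\<exists>m. m \<noteq> 0 \<and> (\<forall>c\<in>Imm1. \<forall>h\<in>T_Imm1 c. \<forall>k\<in>T_Imm1 c.
      Omega_Phi \<Phi> c h k = m * Omega_MW c h k)"
    by (intro exI[of _ "3 * C"]) simp
qed

end
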